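(* Let $m,n,s,k,c$ be positive integers such that $2\leq s\leq n$, $2\leq k\leq m$ and $ms=nk$, and set $d=\gcd(s,k)$. (1) A $\mathrm{MS}^0_{\mathbb Z_{nkc}}(m,n;s,k;c)$ exists if and only if $nkc$ is odd. (2) If $d\equiv 0\pmod 4$, then there exists a $\mathrm{MS}^0_{\Gamma}(m,n;s,k;c)$ for every finite abelian group $\Gamma\in\mathcal G$ of order $nkc$. (3) If $nk$ is odd and $\gcd(n,d-1)=1$, then there exists a $\mathrm{M}^0_{\mathbb Z_d\oplus\mathbb Z_{nk/d}}(m,n;s,k)$. (4) A $\mathrm{MS}^0_{\mathbb Z_{2nc+1}^*}(2,n;n,2;c)$ exists if and only if $n\geq 3$. (5) A $\mathrm{M}^0_{\mathbb Z_{mn+1}^*}(m,n;n,m)$ exists if and only if $mn$ is even and $mn>5$. (6) Let $\Gamma$ be an abelian group of order $2n+1$. There exists a $\mathrm{M}^0_{\Gamma^*}(2,n;n,2)$ if and only if $\Gamma\notin\{\mathbb Z_5,\mathbb Z_3\oplus\mathbb Z_3\}$.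
   Context: Let $(\Gamma,+)$ be an abelian group and $\Omega\subseteq\Gamma$ with $|\Omega|>1$. A partially filled array is an array in which some cells may be empty. A magic partially filled array $\mathrm{M}_\Omega(m,n;s,k)$ is an $m\times n$ partially filled array with entries in $\Omega$ such that every element of $\Omega$ appears exactly once, each row contains exactly $s$ filled cells, each column contains exactly $k$ filled cells, and there exist $x,y\in\Gamma$ such that every row sums to $x$ and every column sums to $y$. A magic partially filled array set $\mathrm{MS}_\Omega(m,n;s,k;c)$ is a set of $c$ partially filled $m\times n$ arrays with entries in $\Omega$ such that every element of $\Omega$ appears exactly once in exactly one of the arrays, every array has $s$ filled cells in each row and $k$ in each column, and there exist $x,y\in\Gamma$ such that in every array each row sums to $x$ and each column sums to $y$. The zero-sum versions $\mathrm{M}^0_\Omega(m,n;s,k)$ and $\mathrm{MS}^0_\Omega(m,n;s,k;c)$ are those with $x=y=0_\Gamma$. $\Gamma^*=\Gamma\setminus\{0_\Gamma\}$. $\mathcal G$ is the set of all finite abelian groups that either have odd order or contain more than one element of order $2$. $\mathbb Z_n$ denotes the cyclic group of order $n$. *)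

theory Defs
  imports "HOL-Algebra.Elementary_Groups" "HOL-Algebra.Multiplicative_Group"
begin

text \<open>Abelian groups are HOL-Algebra structures written multiplicatively:
  the group operation plays the role of +, and \<one> plays the role of 0.
  A partially filled m x n array with entries in a set is a function
  A :: nat => nat => 'a option, where A i j = None means cell (i,j) is empty;
  cells outside {..<m} x {..<n} are required to be empty.
  A set of c arrays is a function A :: nat => nat => nat => 'a option,
  indexed by t < c (array), i < m (row), j < n (column).\<close>

definition row_sum :: "('a, 'b) monoid_scheme \<Rightarrow> (nat \<Rightarrow> nat \<Rightarrow> 'a option) \<Rightarrow> nat \<Rightarrow> 'a" where
  "row_sum G A i = finprod G (\<lambda>j. the (A i j)) {j. A i j \<noteq> None}"

definition col_sum :: "('a, 'b) monoid_scheme \<Rightarrow> (nat \<Rightarrow> nat \<Rightarrow> 'a option) \<Rightarrow> nat \<Rightarrow> 'a" where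
  "col_sum G A j = finprod G (\<lambda>i. the (A i j)) {i. A i j \<noteq> None}"

definition magic_pfa_set ::
  "('a, 'b) monoid_scheme \<Rightarrow> 'a set \<Rightarrow> nat \<Rightarrow> nat \<Rightarrow> nat \<Rightarrow> nat \<Rightarrow> nat
     \<Rightarrow> (nat \<Rightarrow> nat \<Rightarrow> nat \<Rightarrow> 'a option) \<Rightarrow> 'a \<Rightarrow> 'a \<Rightarrow> bool" where
  "magic_pfa_set G \<Omega> m n s k c A x y \<longleftrightarrow>
     \<Omega> \<subseteq> carrier G \<and> 1 < card \<Omega> \<and>
     (\<forall>t i j. A t i j \<noteq> None \<longrightarrow> t < c \<and> i < m \<and> j < n) \<and>
     bij_betw (\<lambda>(t, i, j). the (A t i j)) {(t, i, j). A t i j \<noteq> None} \<Omega> \<and>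
     (\<forall>t<c. \<forall>i<m. card {j. A t i j \<noteq> None} = s) \<and>
     (\<forall>t<c. \<forall>j<n. card {i. A t i j \<noteq> None} = k) \<and>
     x \<in> carrier G \<and> y \<in> carrier G \<and>
     (\<forall>t<c. (\<forall>i<m. row_sum G (A t) i = x) \<and> (\<forall>j<n. col_sum G (A t) j = y))"

definition magic_pfa ::
  "('a, 'b) monoid_scheme \<Rightarrow> 'a set \<Rightarrow> nat \<Rightarrow> nat \<Rightarrow> nat \<Rightarrow> nat
     \<Rightarrow> (nat \<Rightarrow> nat \<Rightarrow> 'a option) \<Rightarrow> 'a \<Rightarrow> 'a \<Rightarrow> bool" where
  "magic_pfa G \<Omega> m n s k A x y \<longleftrightarrow>
     \<Omega> \<subseteq> carrier G \<and> 1 < card \<Omega> \<and>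
     (\<forall>i j. A i j \<noteq> None \<longrightarrow> i < m \<and> j < n) \<and>
     bij_betw (\<lambda>(i, j). the (A i j)) {(i, j). A i j \<noteq> None} \<Omega> \<and>
     (\<forall>i<m. card {j. A i j \<noteq> None} = s) \<and>
     (\<forall>j<n. card {i. A i j \<noteq> None} = k) \<and>
     x \<in> carrier G \<and> y \<in> carrier G \<and>
     (\<forall>i<m. row_sum G A i = x) \<and> (\<forall>j<n. col_sum G A j = y)"

definition exists_MS0 :: "('a, 'b) monoid_scheme \<Rightarrow> 'a set \<Rightarrow> nat \<Rightarrow> nat \<Rightarrow> nat \<Rightarrow> nat \<Rightarrow> nat \<Rightarrow> bool" where
  "exists_MS0 G \<Omega> m n s k c \<longleftrightarrow> (\<exists>A. magic_pfa_set G \<Omega> m n s k c A \<one>\<^bsub>G\<^esub> \<one>\<^bsub>G\<^esub>)"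

definition exists_M0 :: "('a, 'b) monoid_scheme \<Rightarrow> 'a set \<Rightarrow> nat \<Rightarrow> nat \<Rightarrow> nat \<Rightarrow> nat \<Rightarrow> bool" where
  "exists_M0 G \<Omega> m n s k \<longleftrightarrow> (\<exists>A. magic_pfa G \<Omega> m n s k A \<one>\<^bsub>G\<^esub> \<one>\<^bsub>G\<^esub>)"

definition nonzero :: "('a, 'b) monoid_scheme \<Rightarrow> 'a set" where
  "nonzero G = carrier G - {\<one>\<^bsub>G\<^esub>}"

definition in_class_G :: "('a, 'b) monoid_scheme \<Rightarrow> bool" where
  "in_class_G G \<longleftrightarrow> comm_group G \<and> finite (carrier G) \<and>
     (odd (order G) \<or> 1 < card {x \<in> carrier G. group.ord G x = 2})"

end

theory Submission
  imports Defs "HOL-Library.Product_Plus" "HOL-Algebra.Sylow" "HOL-Number_Theory.Cong"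
begin

text \<open>
  Write \<open>s = d s'\<close>, \<open>k = d k'\<close>, \<open>m = k' e\<close>, \<open>n = s' e\<close>. Everything is reduced to small arrays, which are
  then spread over the cells of a grid: \<open>e \<times> e\<close> arrays filled along \<open>d\<close> cyclic diagonals, full \<open>k \<times> s\<close>
  rectangles if \<open>d = 1\<close>, and \<open>2 \<times> n\<close> arrays.

  On diagonals of odd number, the rows and columns cancel because the entries run through multiples
  of a common quantity with multipliers in \<open>{1, -1, 2, -2}\<close> that are symmetric and sum to 0. If \<open>4\<close>
  divides \<open>d\<close>, the group is cut into quadruples \<open>{x, r/x, g/x, x r g}\<close> with \<open>r\<^sup>2 = g\<^sup>2 = 1\<close>, which form
  \<open>2 \<times> 2\<close> squares with row products \<open>r\<close> and column products \<open>g\<close>; two such squares meet in every row and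
  column. If \<open>r\<close> or \<open>g\<close> is a square in the group, the type \<open>(r, g)\<close> has to depend on the class of \<open>x\<^sup>2\<close>.

  A \<open>2 \<times> n\<close> array of nonzero elements amounts to choosing one element from each pair \<open>{x, 1/x}\<close> such
  that the product is 1. In cyclic groups the choice comes from Skolem sequences. In general it is
  lifted from a quotient of order different from 1 and 3 that is cyclic or \<open>\<int>\<^sub>3 \<oplus> \<int>\<^sub>3\<close>.
  The obstructions are the sum of all elements and the impossibility of a \<open>2 \<times> 2\<close> array.
\<close>


text \<open>Every element is used exactly once, so the entries have to come from an injective
  formula whose rows and columns cancel simultaneously. For odd order this explains the multipliers:
  \<open>1, -1, 2, -2\<close> are units modulo every odd number, so multiplying by them loses no
  element, whereas \<open>1\<close> and \<open>-1\<close> alone cannot cancel in a row of odd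
  length. If \<open>4 dvd d\<close>, the four members of a quadruple are distinct only if the square
  of \<open>x\<close> is neither \<open>r\<close> nor \<open>g\<close>. If some element of order 2
  is a nonsquare, so is a second one, and these two serve the whole group. Otherwise the Klein
  four-group of \<open>r\<close> and \<open>g\<close> consists of squares, and 16 then divides the
  order, which makes the counts fit when the type varies. In the last part, a quotient of order 1 or
  3 has no half-system with some coefficient 1 and trivial product, so it cannot be lifted.
  \<open>Z_5\<close> and \<open>Z_3 + Z_3\<close> have no half-system of product 1 either, but they
  are unavoidable as quotients, for instance of \<open>Z_5 + Z_5\<close> and of the elementary group
  of order 27. Allowing the coefficient 3 makes them liftable, so that only these two groups
  themselves remain exceptional.\<close>

section \<open>Placements of group elements\<close>

text \<open>A family of arrays is encoded by labels \<open>x \<in> I\<close>: label \<open>x\<close> puts the element \<open>v x\<close> into row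
  \<open>R x\<close> and column \<open>K x\<close> of array number \<open>T x\<close>.\<close>

definition placement ::
  "('a, 'b) monoid_scheme \<Rightarrow> 'i set \<Rightarrow> ('i \<Rightarrow> 'a) \<Rightarrow> ('i \<Rightarrow> nat) \<Rightarrow> ('i \<Rightarrow> nat) \<Rightarrow> ('i \<Rightarrow> nat)
    \<Rightarrow> nat \<Rightarrow> nat \<Rightarrow> nat \<Rightarrow> nat \<Rightarrow> nat \<Rightarrow> bool" where
  "placement G I v T R K m n s k c \<longleftrightarrow>
     finite I \<and> v \<in> I \<rightarrow> carrier G \<and> inj_on v I \<and> inj_on (\<lambda>x. (T x, R x, K x)) I \<and>
     (\<forall>x\<in>I. T x < c \<and> R x < m \<and> K x < n) \<and>
     (\<forall>t<c. \<forall>i<m. card {x \<in> I. T x = t \<and> R x = i} = s \<and>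
        finprod G v {x \<in> I. T x = t \<and> R x = i} = \<one>\<^bsub>G\<^esub>) \<and>
     (\<forall>t<c. \<forall>j<n. card {x \<in> I. T x = t \<and> K x = j} = k \<and>
        finprod G v {x \<in> I. T x = t \<and> K x = j} = \<one>\<^bsub>G\<^esub>)"

lemma exists_MS0_if_placement:
  assumes G: "comm_group G" and P: "placement G I v T R K m n s k c"
    and \<Omega>: "v ` I = \<Omega>" "1 < card \<Omega>"
  shows "exists_MS0 G \<Omega> m n s k c"
proof -
  interpret G: comm_group G by (rule G)
  let ?pos = "\<lambda>x. (T x, R x, K x)"
  define A where "A t i j = (if (t, i, j) \<in> ?pos ` I then Some (v (the_inv_into I ?pos (t, i, j))) else None)"
    for t i j
  have inj: "inj_on ?pos I" and vin: "v \<in> I \<rightarrow> carrier G" and vinj: "inj_on v I" and fin: "finite I"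
    using P by (auto simp: placement_def)
  have A_pos: "A (T x) (R x) (K x) = Some (v x)" if "x \<in> I" for x
    using the_inv_into_f_f[OF inj that] that by (simp add: A_def)
  have A_None: "A t i j \<noteq> None \<longleftrightarrow> (\<exists>x\<in>I. t = T x \<and> i = R x \<and> j = K x)" for t i j
    by (auto simp: A_def)
  have cells: "{(t, i, j). A t i j \<noteq> None} = ?pos ` I"
    by (auto simp: A_def)
  have "bij_betw (\<lambda>(t, i, j). the (A t i j)) (?pos ` I) \<Omega>"
  proof (rule bij_betw_imageI)
    show "inj_on (\<lambda>(t, i, j). the (A t i j)) (?pos ` I)"
      using vinj by (auto simp: inj_on_def A_pos)
    show "(\<lambda>(t, i, j). the (A t i j)) ` ?pos ` I = \<Omega>"
      using \<Omega>(1) by (auto simp: A_pos image_iff image_image)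
  qed
  moreover have "card {j. A t i j \<noteq> None} = s \<and> row_sum G (A t) i = \<one>\<^bsub>G\<^esub>" if "t < c" "i < m" for t i
  proof -
    let ?S = "{x \<in> I. T x = t \<and> R x = i}"
    have eq: "{j. A t i j \<noteq> None} = K ` ?S" unfolding A_None by auto
    have inj': "inj_on K ?S" using inj by (auto simp: inj_on_def)
    have "row_sum G (A t) i = finprod G (\<lambda>x. the (A t i (K x))) ?S"
      unfolding row_sum_def eq by (rule G.finprod_reindex[OF _ inj']) (use vin in \<open>auto simp: A_pos\<close>)
    also have "\<dots> = finprod G v ?S"
      by (rule G.finprod_cong') (use vin in \<open>auto simp: A_pos\<close>)
    finally show ?thesis
      using P that unfolding eq placement_def by (simp add: card_image[OF inj'])
  qed
  moreover have "card {i. A t i j \<noteq> None} = k \<and> col_sum G (A t) j = \<one>\<^bsub>G\<^esub>" if "t < c" "j < n" for t j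
  proof -
    let ?S = "{x \<in> I. T x = t \<and> K x = j}"
    have eq: "{i. A t i j \<noteq> None} = R ` ?S" unfolding A_None by auto
    have inj': "inj_on R ?S" using inj by (auto simp: inj_on_def)
    have "col_sum G (A t) j = finprod G (\<lambda>x. the (A t (R x) j)) ?S"
      unfolding col_sum_def eq by (rule G.finprod_reindex[OF _ inj']) (use vin in \<open>auto simp: A_pos\<close>)
    also have "\<dots> = finprod G v ?S"
      by (rule G.finprod_cong') (use vin in \<open>auto simp: A_pos\<close>)
    finally show ?thesis
      using P that unfolding eq placement_def by (simp add: card_image[OF inj'])
  qed
  ultimately have "magic_pfa_set G \<Omega> m n s k c A \<one>\<^bsub>G\<^esub> \<one>\<^bsub>G\<^esub>"
    using \<Omega> vin P unfolding magic_pfa_set_def cells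
    unfolding A_None by (auto simp: placement_def)
  then show ?thesis by (auto simp: exists_MS0_def)
qed

text \<open>The labels are the filled cells themselves, so every array set becomes a placement over
  one fixed label type. Transposing, inflating or applying an isomorphism then changes the maps and
  not the labels.\<close>

lemma placement_if_exists_MS0:
  assumes G: "comm_group G" and E: "exists_MS0 G \<Omega> m n s k c"
  obtains I :: "(nat \<times> nat \<times> nat) set" and v T R K
  where "placement G I v T R K m n s k c" "v ` I = \<Omega>" "1 < card \<Omega>"
proof -
  interpret G: comm_group G by (rule G)
  obtain A where A: "magic_pfa_set G \<Omega> m n s k c A \<one>\<^bsub>G\<^esub> \<one>\<^bsub>G\<^esub>"
    using E by (auto simp: exists_MS0_def)
  define I where "I = {(t, i, j). A t i j \<noteq> None}"
  define v where "v = (\<lambda>(t, i, j). the (A t i j))"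
  have bij: "bij_betw v I \<Omega>" and sub: "\<Omega> \<subseteq> carrier G"
    and rng: "A t i j \<noteq> None \<Longrightarrow> t < c \<and> i < m \<and> j < n" for t i j
    using A by (auto simp: magic_pfa_set_def I_def v_def)
  have vin: "v \<in> I \<rightarrow> carrier G" using bij sub by (auto simp: bij_betw_def)
  have vA: "z \<in> carrier G" if "A t i j = Some z" for t i j z
    using vin that by (force simp: I_def v_def)
  have fin: "finite I"
    by (rule finite_subset[of _ "{..<c} \<times> {..<m} \<times> {..<n}"]) (use rng in \<open>auto simp: I_def\<close>)
  have row: "card {x \<in> I. fst x = t \<and> fst (snd x) = i} = s \<and>
        finprod G v {x \<in> I. fst x = t \<and> fst (snd x) = i} = \<one>\<^bsub>G\<^esub>" if "t < c" "i < m" for t i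
  proof -
    have eq: "{x \<in> I. fst x = t \<and> fst (snd x) = i} = (\<lambda>j. (t, i, j)) ` {j. A t i j \<noteq> None}"
      by (auto simp: I_def)
    have inj: "inj_on (\<lambda>j. (t, i, j)) S" for S by (auto simp: inj_on_def)
    have "finprod G v ((\<lambda>j. (t, i, j)) ` {j. A t i j \<noteq> None}) = row_sum G (A t) i"
      unfolding row_sum_def
      by (subst G.finprod_reindex[OF _ inj]) (use vA in \<open>auto simp: v_def\<close>)
    then show ?thesis
      unfolding eq card_image[OF inj] using A that by (simp add: magic_pfa_set_def)
  qed
  have col: "card {x \<in> I. fst x = t \<and> snd (snd x) = j} = k \<and>
        finprod G v {x \<in> I. fst x = t \<and> snd (snd x) = j} = \<one>\<^bsub>G\<^esub>" if "t < c" "j < n" for t j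
  proof -
    have eq: "{x \<in> I. fst x = t \<and> snd (snd x) = j} = (\<lambda>i. (t, i, j)) ` {i. A t i j \<noteq> None}"
      by (auto simp: I_def)
    have inj: "inj_on (\<lambda>i. (t, i, j)) S" for S by (auto simp: inj_on_def)
    have "finprod G v ((\<lambda>i. (t, i, j)) ` {i. A t i j \<noteq> None}) = col_sum G (A t) j"
      unfolding col_sum_def
      by (subst G.finprod_reindex[OF _ inj]) (use vA in \<open>auto simp: v_def\<close>)
    then show ?thesis
      unfolding eq card_image[OF inj] using A that by (simp add: magic_pfa_set_def)
  qed
  have "placement G I v fst (fst \<circ> snd) (snd \<circ> snd) m n s k c"
    using fin vin bij row col rng by (auto simp: placement_def bij_betw_def inj_on_def I_def)
  then show thesis
    using that bij A by (auto simp: bij_betw_def magic_pfa_set_def)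
qed

lemma exists_M0_iff_exists_MS0: "exists_M0 G \<Omega> m n s k \<longleftrightarrow> exists_MS0 G \<Omega> m n s k 1"
proof
  assume "exists_M0 G \<Omega> m n s k"
  then obtain A where A: "magic_pfa G \<Omega> m n s k A \<one>\<^bsub>G\<^esub> \<one>\<^bsub>G\<^esub>" by (auto simp: exists_M0_def)
  define B where "B t = (if t = 0 then A else (\<lambda>i j. None))" for t :: nat
  have cells: "{(t, i, j). B t i j \<noteq> None} = Pair 0 ` {(i, j). A i j \<noteq> None}"
    by (auto simp: B_def split: if_splits)
  have "bij_betw (\<lambda>(i, j). the (A i j)) {(i, j). A i j \<noteq> None} \<Omega>"
    using A by (simp add: magic_pfa_def)
  then have "bij_betw (\<lambda>(t, i, j). the (B t i j)) {(t, i, j). B t i j \<noteq> None} \<Omega>"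
    unfolding cells by (auto simp: bij_betw_def inj_on_def image_image B_def case_prod_beta)
  then have "magic_pfa_set G \<Omega> m n s k 1 B \<one>\<^bsub>G\<^esub> \<one>\<^bsub>G\<^esub>"
    using A by (auto simp: magic_pfa_set_def magic_pfa_def B_def split: if_splits)
  then show "exists_MS0 G \<Omega> m n s k 1" by (auto simp: exists_MS0_def)
next
  assume "exists_MS0 G \<Omega> m n s k 1"
  then obtain B where B: "magic_pfa_set G \<Omega> m n s k 1 B \<one>\<^bsub>G\<^esub> \<one>\<^bsub>G\<^esub>" by (auto simp: exists_MS0_def)
  have t0: "t = 0" if "B t i j \<noteq> None" for t i j
    using that B unfolding magic_pfa_set_def by (metis less_one)
  have cells: "{(t, i, j). B t i j \<noteq> None} = Pair 0 ` {(i, j). B 0 i j \<noteq> None}"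
  proof -
    have "t = 0" if "B t i j = Some z" for t i j z using t0[of t i j] that by simp
    then show ?thesis by (force simp: image_iff)
  qed
  have "bij_betw (\<lambda>(t, i, j). the (B t i j)) {(t, i, j). B t i j \<noteq> None} \<Omega>"
    using B by (simp add: magic_pfa_set_def)
  then have "bij_betw (\<lambda>(i, j). the (B 0 i j)) {(i, j). B 0 i j \<noteq> None} \<Omega>"
    unfolding cells by (auto simp: bij_betw_def inj_on_def image_image case_prod_beta)
  then have "magic_pfa G \<Omega> m n s k (B 0) \<one>\<^bsub>G\<^esub> \<one>\<^bsub>G\<^esub>"
    using B by (auto simp: magic_pfa_set_def magic_pfa_def)
  then show "exists_M0 G \<Omega> m n s k" by (auto simp: exists_M0_def)
qed

lemma exists_MS0_transpose:
  assumes G: "comm_group G" and E: "exists_MS0 G \<Omega> m n s k c"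
  shows "exists_MS0 G \<Omega> n m k s c"
proof -
  obtain I :: "(nat \<times> nat \<times> nat) set" and v T R K
    where "placement G I v T R K m n s k c" "v ` I = \<Omega>" "1 < card \<Omega>"
    using placement_if_exists_MS0[OF assms] .
  moreover from this have "placement G I v T K R n m k s c"
    by (auto simp: placement_def inj_on_def)
  ultimately show ?thesis using exists_MS0_if_placement[OF G] by blast
qed

section \<open>Products over fibres and the sum obstruction\<close>

lemma (in comm_group) finprod_fibres:
  assumes "finite A" "finite Y" "g ` A \<subseteq> Y" "f \<in> A \<rightarrow> carrier G"
  shows "finprod G f A = (\<Otimes>y\<in>Y. finprod G f {x \<in> A. g x = y})"
proof -
  have "A = (\<Union>y\<in>Y. {x \<in> A. g x = y})" using assms by auto
  then have "finprod G f A = finprod G f (\<Union>y\<in>Y. {x \<in> A. g x = y})" by simp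
  also have "\<dots> = (\<Otimes>y\<in>Y. finprod G f {x \<in> A. g x = y})"
    by (rule finprod_UN_disjoint) (use assms in \<open>auto simp: disjnt_def pairwise_def\<close>)
  finally show ?thesis .
qed

lemma card_fibres_const:
  assumes "finite A" "finite Y" "g ` A \<subseteq> Y" "\<And>y. y \<in> Y \<Longrightarrow> card {x \<in> A. g x = y} = r"
  shows "card A = card Y * r"
proof -
  have "card A = (\<Sum>y\<in>Y. card {x \<in> A. g x = y})"
    using sum.group[OF assms(1-3), of "\<lambda>_. 1::nat"] by simp
  also have "\<dots> = card Y * r" using assms(4) by simp
  finally show ?thesis .
qed

text \<open>The rows of all arrays partition the entries, and every row has product 1. This is the
  obstruction for cyclic groups of even order.\<close>

lemma finprod_eq_one_if_exists_MS0:
  assumes G: "comm_group G" and E: "exists_MS0 G \<Omega> m n s k c"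
  shows "finprod G (\<lambda>x. x) \<Omega> = \<one>\<^bsub>G\<^esub>"
proof -
  interpret G: comm_group G by (rule G)
  obtain I :: "(nat \<times> nat \<times> nat) set" and v T R K
    where P: "placement G I v T R K m n s k c" and \<Omega>: "v ` I = \<Omega>" "1 < card \<Omega>"
    using placement_if_exists_MS0[OF assms] .
  have fin: "finite I" and v: "v \<in> I \<rightarrow> carrier G" and inj: "inj_on v I"
    using P by (auto simp: placement_def)
  have "finprod G (\<lambda>x. x) \<Omega> = finprod G v I"
    unfolding \<Omega>(1)[symmetric] by (rule G.finprod_reindex) (use v inj in auto)
  also have "\<dots> = (\<Otimes>\<^bsub>G\<^esub>y\<in>{..<c} \<times> {..<m}. finprod G v {x \<in> I. (T x, R x) = y})"
    by (rule G.finprod_fibres) (use fin v P in \<open>auto simp: placement_def\<close>)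
  also have "\<dots> = \<one>\<^bsub>G\<^esub>"
    by (rule G.finprod_one_eqI) (use P in \<open>auto simp: placement_def\<close>)
  finally show ?thesis .
qed

text \<open>Inflation: \<open>X = g a = h b\<close> small arrays at a time are placed into the cells of a \<open>g \<times> h\<close>
  grid, array number \<open>y\<close> going to cell \<open>(y div a, y mod h)\<close>.\<close>

lemma exists_MS0_inflate:
  assumes G: "comm_group G" and E: "exists_MS0 G \<Omega> p q s k (c * (g * a))"
    and X: "g * a = h * b" and ah: "a \<le> h" and pos: "0 < a" "0 < h"
  shows "exists_MS0 G \<Omega> (g * p) (h * q) (a * s) (b * k) c"
proof -
  interpret G: comm_group G by (rule G)
  obtain I :: "(nat \<times> nat \<times> nat) set" and v T R K
    where P: "placement G I v T R K p q s k (c * (g * a))" and \<Omega>: "v ` I = \<Omega>" "1 < card \<Omega>"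
    using placement_if_exists_MS0[OF G E] .
  define X where "X = g * a"
  have Xh: "X = h * b" using X by (simp add: X_def)
  have fin: "finite I" and v: "v \<in> I \<rightarrow> carrier G" and inj: "inj_on v I"
    and inj3: "inj_on (\<lambda>x. (T x, R x, K x)) I"
    and rng: "\<And>x. x \<in> I \<Longrightarrow> T x < c * X \<and> R x < p \<and> K x < q"
    using P by (auto simp: placement_def X_def)
  have Prow: "card {x \<in> I. T x = t \<and> R x = i} = s" "finprod G v {x \<in> I. T x = t \<and> R x = i} = \<one>\<^bsub>G\<^esub>"
    if "t < c * X" "i < p" for t i
    using P that by (simp_all add: placement_def X_def)
  have Pcol: "card {x \<in> I. T x = t \<and> K x = i} = k" "finprod G v {x \<in> I. T x = t \<and> K x = i} = \<one>\<^bsub>G\<^esub>"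
    if "t < c * X" "i < q" for t i
    using P that by (simp_all add: placement_def X_def)
  \<comment> \<open>A row of a large array is the union of the rows \<open>i\<close> of the small
    arrays whose numbers form some set \<open>Y\<close>; only the size of \<open>Y\<close>
    matters.\<close>
  have row: "card {x \<in> I. T x \<in> Y \<and> R x = i} = card Y * s \<and>
      finprod G v {x \<in> I. T x \<in> Y \<and> R x = i} = \<one>\<^bsub>G\<^esub>"
    if "Y \<subseteq> {..<c * X}" "i < p" for Y i
  proof -
    have Y: "finite Y" using that finite_subset by blast
    have eq: "{x \<in> {x \<in> I. T x \<in> Y \<and> R x = i}. T x = y} = {x \<in> I. T x = y \<and> R x = i}" if "y \<in> Y" for y
      using that by auto
    have "finprod G v {x \<in> I. T x \<in> Y \<and> R x = i}
        = (\<Otimes>\<^bsub>G\<^esub>y\<in>Y. finprod G v {x \<in> {x \<in> I. T x \<in> Y \<and> R x = i}. T x = y})"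
      by (rule G.finprod_fibres) (use fin v Y in auto)
    also have "\<dots> = \<one>\<^bsub>G\<^esub>"
      by (rule G.finprod_one_eqI, subst eq) (use that Prow(2) in auto)
    finally have *: "finprod G v {x \<in> I. T x \<in> Y \<and> R x = i} = \<one>\<^bsub>G\<^esub>" .
    have "card {x \<in> I. T x \<in> Y \<and> R x = i} = card Y * s"
      by (rule card_fibres_const[where g = T], use fin Y in force, use Y in force, force, subst eq)
        (use that Prow(1) in auto)
    with * show ?thesis by blast
  qed
  have col: "card {x \<in> I. T x \<in> Y \<and> K x = i} = card Y * k \<and>
      finprod G v {x \<in> I. T x \<in> Y \<and> K x = i} = \<one>\<^bsub>G\<^esub>"
    if "Y \<subseteq> {..<c * X}" "i < q" for Y i
  proof -
    have Y: "finite Y" using that finite_subset by blast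
    have eq: "{x \<in> {x \<in> I. T x \<in> Y \<and> K x = i}. T x = y} = {x \<in> I. T x = y \<and> K x = i}" if "y \<in> Y" for y
      using that by auto
    have "finprod G v {x \<in> I. T x \<in> Y \<and> K x = i}
        = (\<Otimes>\<^bsub>G\<^esub>y\<in>Y. finprod G v {x \<in> {x \<in> I. T x \<in> Y \<and> K x = i}. T x = y})"
      by (rule G.finprod_fibres) (use fin v Y in auto)
    also have "\<dots> = \<one>\<^bsub>G\<^esub>"
      by (rule G.finprod_one_eqI, subst eq) (use that Pcol(2) in auto)
    finally have *: "finprod G v {x \<in> I. T x \<in> Y \<and> K x = i} = \<one>\<^bsub>G\<^esub>" .
    have "card {x \<in> I. T x \<in> Y \<and> K x = i} = card Y * k"
      by (rule card_fibres_const[where g = T], use fin Y in force, use Y in force, force, subst eq)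
        (use that Pcol(1) in auto)
    with * show ?thesis by blast
  qed
  \<comment> \<open>\<open>T' x\<close> is the number of the large array and \<open>y x\<close> the
    number of the small array inside it.\<close>
  define y where "y x = T x mod X" for x
  define T' where "T' x = T x div X" for x
  define R' where "R' x = y x div a * p + R x" for x
  define K' where "K' x = y x mod h * q + K x" for x
  have X0: "0 < X" if "x \<in> I" for x using rng[OF that] by (cases X) auto
  have rng': "T' x < c \<and> R' x < g * p \<and> K' x < h * q" if "x \<in> I" for x
  proof -
    have "y x < X" using X0[OF that] by (simp add: y_def)
    then have "y x div a < g" by (simp add: X_def less_mult_imp_div_less)
    moreover have "y x mod h < h" using pos by simp
    ultimately have "Suc (y x div a) * p \<le> g * p" "Suc (y x mod h) * q \<le> h * q"
      by (intro mult_le_mono1 Suc_leI; simp)+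
    with rng[OF that] show ?thesis
      by (auto simp: T'_def R'_def K'_def less_mult_imp_div_less)
  qed
  have divmod: "R' x div p = y x div a \<and> R' x mod p = R x \<and> K' x div q = y x mod h \<and> K' x mod q = K x"
    if "x \<in> I" for x
    using rng[OF that] by (auto simp: R'_def K'_def)
  \<comment> \<open>No two small arrays may share a grid cell: those of one grid row are
    \<open>a\<close> consecutive numbers, and \<open>a \<le> h\<close> keeps their residues modulo
    \<open>h\<close> distinct.\<close>
  have yinj: "z = z'" if "z div a = z' div a" "z mod h = z' mod h" for z z' :: nat
  proof -
    have z: "z = a * (z div a) + z mod a" "z' = a * (z div a) + z' mod a"
      using that(1) mult_div_mod_eq[of a z] mult_div_mod_eq[of a z'] by simp_all
    have "z mod a < a" "z' mod a < a" using pos by auto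
    then have lt: "z mod a < h" "z' mod a < h" using ah by linarith+
    have "[a * (z div a) + z mod a = a * (z div a) + z' mod a] (mod h)"
      using that(2) z by (simp add: cong_def)
    then have "[z mod a = z' mod a] (mod h)" by (simp only: cong_add_lcancel_nat)
    then have "z mod a = z' mod a" using lt by (simp add: cong_def)
    then show ?thesis using z by simp
  qed
  have "inj_on (\<lambda>x. (T' x, R' x, K' x)) I"
  proof (rule inj_onI)
    fix x x' assume x: "x \<in> I" and x': "x' \<in> I" and eq: "(T' x, R' x, K' x) = (T' x', R' x', K' x')"
    then have "y x div a = y x' div a" "y x mod h = y x' mod h" "R x = R x'" "K x = K x'"
      using divmod[OF x] divmod[OF x'] by auto
    moreover have "T x = T x'"
    proof -
      have "y x = y x'" using yinj calculation by blast
      moreover have "T' x = T' x'" using eq by simp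
      ultimately show ?thesis
        unfolding y_def T'_def by (metis div_mult_mod_eq)
    qed
    ultimately show "x = x'" using inj3 x x' by (auto simp: inj_on_def)
  qed
  moreover have "card {x \<in> I. T' x = t \<and> R' x = i} = a * s \<and>
      finprod G v {x \<in> I. T' x = t \<and> R' x = i} = \<one>\<^bsub>G\<^esub>" if "t < c" "i < g * p" for t i
  proof -
    \<comment> \<open>A grid row receives \<open>a\<close> consecutive small arrays.\<close>
    define Y where "Y = {t * X + i div p * a..<t * X + i div p * a + a}"
    have "i div p < g" using that by (simp add: less_mult_imp_div_less)
    then have u: "i div p * a + a \<le> X" using mult_le_mono1[of "Suc (i div p)" g a] by (simp add: X_def)
    have tX: "t * X + X \<le> c * X" using that using mult_le_mono1[of "Suc t" c X] by simp
    have p0: "0 < p" using that by (cases p) auto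
    have "T' x = t \<and> R' x = i \<longleftrightarrow> T x \<in> Y \<and> R x = i mod p" if "x \<in> I" for x
    proof
      assume *: "T' x = t \<and> R' x = i"
      then have "y x div a = i div p" "R x = i mod p" using divmod[OF that] by auto
      moreover have "T x = t * X + y x" using * by (auto simp: T'_def y_def)
      moreover have "y x div a * a \<le> y x \<and> y x < y x div a * a + a"
        using dividend_less_div_times[OF pos(1), of "y x"] by (simp add: add.commute)
      ultimately show "T x \<in> Y \<and> R x = i mod p" by (simp add: Y_def)
    next
      assume *: "T x \<in> Y \<and> R x = i mod p"
      then obtain w where w: "T x = t * X + (i div p * a + w)" "w < a"
        by (auto simp: Y_def le_iff_add add.assoc)
      moreover have "i div p * a + w < X" using u w(2) by simp
      ultimately have "T' x = t" "y x = i div p * a + w"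
        by (auto simp: T'_def y_def)
      moreover from this have "y x div a = i div p" using w by simp
      ultimately show "T' x = t \<and> R' x = i" using * by (simp add: R'_def)
    qed
    then have eq: "{x \<in> I. T' x = t \<and> R' x = i} = {x \<in> I. T x \<in> Y \<and> R x = i mod p}" by blast
    have "Y \<subseteq> {..<c * X}" using u tX by (auto simp: Y_def)
    from row[OF this] show ?thesis unfolding eq using p0 by (simp add: Y_def)
  qed
  moreover have "card {x \<in> I. T' x = t \<and> K' x = j} = b * k \<and>
      finprod G v {x \<in> I. T' x = t \<and> K' x = j} = \<one>\<^bsub>G\<^esub>" if "t < c" "j < h * q" for t j
  proof -
    \<comment> \<open>A grid column receives a residue class modulo \<open>h\<close>, which has
      \<open>b\<close> members because \<open>X = h * b\<close>.\<close>
    define Y where "Y = (\<lambda>z. t * X + (j div q + h * z)) ` {..<b}"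
    have jq: "j div q < h" using that by (simp add: less_mult_imp_div_less)
    have q0: "0 < q" using that by (cases q) auto
    have tX: "t * X + X \<le> c * X" using that using mult_le_mono1[of "Suc t" c X] by simp
    have u: "j div q + h * z < X" if "z < b" for z
    proof -
      have "h * z + h \<le> h * b" using mult_le_mono2[of "Suc z" b h] that by simp
      then show ?thesis using jq by (simp add: Xh)
    qed
    have "T' x = t \<and> K' x = j \<longleftrightarrow> T x \<in> Y \<and> K x = j mod q" if "x \<in> I" for x
    proof
      assume *: "T' x = t \<and> K' x = j"
      then have "y x mod h = j div q" "K x = j mod q" using divmod[OF that] by auto
      moreover have "T x = t * X + y x" using * by (auto simp: T'_def y_def)
      moreover have "y x mod h + h * (y x div h) = y x" by simp
      moreover have "y x < b * h" using X0[OF that] by (simp add: y_def Xh mult.commute)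
      then have "y x div h < b" by (rule less_mult_imp_div_less)
      ultimately show "T x \<in> Y \<and> K x = j mod q" unfolding Y_def
        by (intro conjI image_eqI[of _ _ "y x div h"]) simp_all
    next
      assume *: "T x \<in> Y \<and> K x = j mod q"
      then obtain w where w: "T x = t * X + (j div q + h * w)" "w < b"
        by (auto simp: Y_def)
      then have "T' x = t" "y x = j div q + h * w"
        using u[OF w(2)] by (simp_all add: T'_def y_def)
      moreover from this have "y x mod h = j div q" using jq by simp
      ultimately show "T' x = t \<and> K' x = j" using * by (simp add: K'_def)
    qed
    then have eq: "{x \<in> I. T' x = t \<and> K' x = j} = {x \<in> I. T x \<in> Y \<and> K x = j mod q}" by blast
    have "Y \<subseteq> {..<c * X}" using u tX by (force simp: Y_def)
    moreover have "card Y = b" unfolding Y_def using pos by (subst card_image) (auto simp: inj_on_def)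
    ultimately show ?thesis unfolding eq using q0 col[of Y "j mod q"] by simp
  qed
  ultimately have "placement G I v T' R' K' (g * p) (h * q) (a * s) (b * k) c"
    using fin v inj rng' by (auto simp: placement_def)
  then show ?thesis by (rule exists_MS0_if_placement[OF G _ \<Omega>])
qed


section \<open>Cyclic groups of odd order\<close>

text \<open>Entry \<open>u f i \<delta>\<close> stands in row \<open>i\<close> on diagonal
  \<open>\<delta>\<close>, that is in column \<open>(i + \<delta>) mod e\<close>. So column
  \<open>j\<close> meets diagonal \<open>\<delta>\<close> in row \<open>j - \<delta>\<close> modulo
  \<open>e\<close>, where adding \<open>e\<close> avoids truncated subtraction. The bound
  \<open>d \<le> e\<close> keeps the diagonals disjoint.\<close>

lemma exists_MS0_diagonals:
  fixes u :: "nat \<Rightarrow> nat \<Rightarrow> nat \<Rightarrow> 'a"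
  assumes G: "comm_group G" and de: "d \<le> e" and fin: "finite (carrier G)"
    and bij: "bij_betw (\<lambda>(f, i, \<delta>). u f i \<delta>) ({..<F} \<times> {..<e} \<times> {..<d}) (carrier G)"
    and card: "1 < card (carrier G)"
    and row: "\<And>f i. f < F \<Longrightarrow> i < e \<Longrightarrow> (\<Otimes>\<^bsub>G\<^esub>\<delta>\<in>{..<d}. u f i \<delta>) = \<one>\<^bsub>G\<^esub>"
    and col: "\<And>f j. f < F \<Longrightarrow> j < e \<Longrightarrow> (\<Otimes>\<^bsub>G\<^esub>\<delta>\<in>{..<d}. u f ((j + e - \<delta>) mod e) \<delta>) = \<one>\<^bsub>G\<^esub>"
  shows "exists_MS0 G (carrier G) e e d d F"
proof -
  interpret G: comm_group G by (rule G)
  let ?I = "{..<F} \<times> {..<e} \<times> {..<d}"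
  let ?v = "\<lambda>(f, i, \<delta>). u f i \<delta>"
  let ?K = "\<lambda>(f::nat, i, \<delta>). (i + \<delta>) mod e"
  have inj: "inj_on ?v ?I" and img: "?v ` ?I = carrier G" using bij by (auto simp: bij_betw_def)
  have u: "u f i \<delta> \<in> carrier G" if "f < F" "i < e" "\<delta> < d" for f i \<delta>
    using img that by force
  have Keq: "(i + \<delta>) mod e = j \<longleftrightarrow> i = (j + e - \<delta>) mod e" if "i < e" "j < e" "\<delta> < e" for i j \<delta>
    using that by (auto simp: mod_if)
  have "placement G ?I ?v fst (fst \<circ> snd) ?K e e d d F"
    unfolding placement_def
  proof (intro conjI allI impI ballI)
    show "inj_on (\<lambda>x. (fst x, (fst \<circ> snd) x, ?K x)) ?I"
      using de by (auto simp: inj_on_def mod_if split: if_splits)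
  next
    fix f i assume fi: "f < F" "i < e"
    have eq: "{x \<in> ?I. fst x = f \<and> (fst \<circ> snd) x = i} = (\<lambda>\<delta>. (f, i, \<delta>)) ` {..<d}"
      using fi by auto
    have inj': "inj_on (\<lambda>\<delta>. (f, i, \<delta>)) {..<d}" by (auto simp: inj_on_def)
    show "card {x \<in> ?I. fst x = f \<and> (fst \<circ> snd) x = i} = d"
      unfolding eq card_image[OF inj'] by simp
    show "finprod G ?v {x \<in> ?I. fst x = f \<and> (fst \<circ> snd) x = i} = \<one>\<^bsub>G\<^esub>"
      unfolding eq using row[OF fi] u fi by (subst G.finprod_reindex[OF _ inj']) auto
  next
    fix f j assume fj: "f < F" "j < e"
    have eq: "{x \<in> ?I. fst x = f \<and> ?K x = j} = (\<lambda>\<delta>. (f, (j + e - \<delta>) mod e, \<delta>)) ` {..<d}"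
    proof -
      have "{x \<in> ?I. fst x = f \<and> ?K x = j}
          = {x \<in> ?I. fst x = f \<and> fst (snd x) = (j + e - snd (snd x)) mod e}"
      proof (rule Collect_cong)
        fix x :: "nat \<times> nat \<times> nat"
        obtain a i \<delta> where "x = (a, i, \<delta>)" by (cases x)
        then show "x \<in> ?I \<and> fst x = f \<and> ?K x = j \<longleftrightarrow>
            x \<in> ?I \<and> fst x = f \<and> fst (snd x) = (j + e - snd (snd x)) mod e"
          using Keq[of i j \<delta>] fj de by (cases "i < e \<and> \<delta> < d") auto
      qed
      also have "\<dots> = (\<lambda>\<delta>. (f, (j + e - \<delta>) mod e, \<delta>)) ` {..<d}"
      proof -
        define g where "g \<delta> = (j + e - \<delta>) mod e" for \<delta>
        have "g \<delta> < e" for \<delta> using fj by (simp add: g_def)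
        then show ?thesis unfolding g_def[symmetric] using fj(1) by (auto simp: image_iff)
      qed
      finally show ?thesis .
    qed
    have inj': "inj_on (\<lambda>\<delta>. (f, (j + e - \<delta>) mod e, \<delta>)) {..<d}" by (auto simp: inj_on_def)
    show "card {x \<in> ?I. fst x = f \<and> ?K x = j} = d"
      unfolding eq card_image[OF inj'] by simp
    show "finprod G ?v {x \<in> ?I. fst x = f \<and> ?K x = j} = \<one>\<^bsub>G\<^esub>"
      unfolding eq using col[OF fj] u fj by (subst G.finprod_reindex[OF _ inj']) auto
  qed (use inj u in auto)
  then show ?thesis using exists_MS0_if_placement[OF G _ img card] by blast
qed

text \<open>Lets the cancellation be computed with integers or pairs of integers and pushed into the
  group by \<open>\<phi>\<close> at the end.\<close>

lemma (in comm_group) finprod_hom_sum: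
  fixes \<phi> :: "'v::ab_group_add \<Rightarrow> 'a"
  assumes "\<And>x y. \<phi> (x + y) = \<phi> x \<otimes> \<phi> y" "\<And>x. \<phi> x \<in> carrier G" "finite A"
  shows "(\<Otimes>x\<in>A. \<phi> (f x)) = \<phi> (sum f A)"
  using assms(3)
proof (induction rule: finite_induct)
  case empty
  have "\<phi> 0 \<otimes> \<phi> 0 = \<phi> 0" using assms(1)[of 0 0] by simp
  then show ?case using assms(2) by simp
next
  case (insert x A)
  then show ?case using assms(1,2) by (simp add: Pi_def)
qed

lemma sum_odd_function:
  fixes g :: "int \<Rightarrow> int"
  assumes "\<And>v. g (- v) = - g v"
  shows "(\<Sum>v\<in>{-h..h}. g v) = 0"
proof -
  have "(\<Sum>v\<in>{-h..h}. g v) = (\<Sum>v\<in>{-h..h}. g (- v))"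
    by (rule sum.reindex_bij_witness[of _ uminus uminus]) auto
  then show ?thesis by (simp add: assms sum_negf)
qed

lemma balanced_symmetric_units:
  assumes "1 \<le> h"
  obtains \<mu> :: "int \<Rightarrow> int" where "\<And>v. \<mu> v \<in> {1, -1, 2, -2}" "\<And>v. \<mu> (- v) = \<mu> v"
    "(\<Sum>v\<in>{- int h..int h}. \<mu> v) = 0"
proof -
  have "\<exists>\<mu> :: int \<Rightarrow> int. (\<forall>v. \<mu> v \<in> {1, -1, 2, -2}) \<and> (\<forall>v. \<mu> (- v) = \<mu> v) \<and>
    (\<Sum>v\<in>{- int h..int h}. \<mu> v) = 0"
    using assms
  proof (induction h rule: less_induct)
    case (less h)
    consider "h = 1" | "h = 2" | h' where "h = h' + 2" "1 \<le> h'"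
    proof -
      have "h = 1 \<or> h = 2 \<or> h = h - 2 + 2 \<and> 1 \<le> h - 2" using less.prems by arith
      then show thesis using that by blast
    qed
    then show ?case
    proof cases
      case 1
      have "{-1..1} = {-1, 0, 1::int}" by auto
      then show ?thesis using 1 by (intro exI[of _ "\<lambda>v. if v = 0 then -2 else 1"]) auto
    next
      case 2
      have "{-2..2} = {-2, -1, 0, 1, 2::int}" by auto
      then show ?thesis using 2
        by (intro exI[of _ "\<lambda>v. if v = 0 then 2 else if \<bar>v\<bar> = 1 then -2 else 1"]) auto
    next
      case (3 h')
      then obtain \<mu> :: "int \<Rightarrow> int" where \<mu>: "\<forall>v. \<mu> v \<in> {1, -1, 2, -2}" "\<forall>v. \<mu> (- v) = \<mu> v"
        "(\<Sum>v\<in>{- int h'..int h'}. \<mu> v) = 0"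
        using less.IH[of h'] by auto
      define \<nu> where "\<nu> v = (if \<bar>v\<bar> \<le> int h' then \<mu> v else if \<bar>v\<bar> = int h' + 1 then 1 else -1)" for v
      have "{- int h..int h} = {- int h'..int h'} \<union> {- int h' - 2, - int h' - 1, int h' + 1, int h' + 2}"
        using 3 by auto
      then have "(\<Sum>v\<in>{- int h..int h}. \<nu> v) = (\<Sum>v\<in>{- int h'..int h'}. \<nu> v)
          + (\<Sum>v\<in>{- int h' - 2, - int h' - 1, int h' + 1, int h' + 2}. \<nu> v)"
        by (simp add: sum.union_disjoint)
      also have "(\<Sum>v\<in>{- int h'..int h'}. \<nu> v) = 0"
      proof -
        have "(\<Sum>v\<in>{- int h'..int h'}. \<nu> v) = (\<Sum>v\<in>{- int h'..int h'}. \<mu> v)"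
          by (rule sum.cong) (auto simp: \<nu>_def)
        then show ?thesis using \<mu>(3) by simp
      qed
      finally show ?thesis
        using \<mu> by (intro exI[of _ \<nu>]) (auto simp: \<nu>_def)
    qed
  qed
  then show thesis using that by blast
qed

lemma coprime_small_odd:
  fixes \<mu> :: int
  assumes "\<mu> \<in> {1, -1, 2, -2}" "odd M"
  shows "coprime \<mu> M"
  using assms by (auto simp: coprime_left_2_iff_odd)

lemma dvd_mult_small_odd:
  fixes \<mu> :: int
  assumes "\<mu> \<in> {1, -1, 2, -2}" "odd M"
  shows "M dvd \<mu> * x \<longleftrightarrow> M dvd x"
  using coprime_small_odd[OF assms] by (metis coprime_commute coprime_dvd_mult_right_iff)

lemma dvd_diff_imp_eq:
  fixes x y M :: int
  assumes "M dvd x - y" "\<bar>x - y\<bar> < M"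
  shows "x = y"
  using assms dvd_imp_le_int[of "x - y" M] by (cases "x = y") auto

text \<open>Cell \<open>\<delta>\<close> of row \<open>i\<close> in array \<open>f\<close> carries \<open>(\<delta> - h, \<mu> (\<delta> - h) * (f + F i))\<close>; as \<open>\<mu>\<close> is
  symmetric with sum 0, both \<open>\<mu>\<close> and \<open>\<delta> \<mu>\<close> sum to 0, which settles rows and columns.\<close>

lemma exists_MS0_odd_diagonals:
  fixes \<phi> :: "int \<times> int \<Rightarrow> 'a"
  assumes G: "comm_group G" and ord: "order G = F * e * d" and d: "d = 2 * h + 1" "1 \<le> h"
    and de: "d \<le> e" and odd: "odd (F * e)"
    and hom: "\<And>x y. \<phi> (x + y) = \<phi> x \<otimes>\<^bsub>G\<^esub> \<phi> y" "\<And>x. \<phi> x \<in> carrier G"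
    and ker: "\<And>y. int (F * e) dvd y \<Longrightarrow> \<phi> (0, y) = \<one>\<^bsub>G\<^esub>"
    and inj: "\<And>x y x' y'. \<bar>x\<bar> \<le> int h \<Longrightarrow> \<bar>x'\<bar> \<le> int h \<Longrightarrow> \<phi> (x, y) = \<phi> (x', y') \<Longrightarrow>
       x = x' \<and> int (F * e) dvd y - y'"
  shows "exists_MS0 G (carrier G) e e d d F"
proof -
  interpret G: comm_group G by (rule G)
  obtain \<mu> :: "int \<Rightarrow> int" where \<mu>: "\<And>v. \<mu> v \<in> {1, -1, 2, -2}" "\<And>v. \<mu> (- v) = \<mu> v"
    "(\<Sum>v\<in>{- int h..int h}. \<mu> v) = 0"
    using balanced_symmetric_units[OF d(2)] by blast
  \<comment> \<open>\<open>Q\<close> numbers the pairs \<open>(f, i)\<close> by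
    \<open>0, ..., F * e - 1\<close> and is linear in \<open>i\<close>, so a shift of the row by
    \<open>\<delta>\<close> only adds a multiple of \<open>\<delta>\<close>.\<close>
  define Q where "Q f i = int (f + F * i)" for f i
  define w where "w f i \<delta> = (int \<delta> - int h, \<mu> (int \<delta> - int h) * Q f i)" for f i \<delta>
  have centre: "(\<Sum>\<delta><d. g (int \<delta> - int h)) = (\<Sum>v\<in>{- int h..int h}. g v)" for g :: "int \<Rightarrow> int"
    by (rule sum.reindex_bij_witness[of _ "\<lambda>v. nat (v + int h)" "\<lambda>\<delta>. int \<delta> - int h"])
      (use d in auto)
  have \<mu>0: "(\<Sum>\<delta><d. \<mu> (int \<delta> - int h)) = 0" using centre[of \<mu>] \<mu>(3) by simp
  have id0: "(\<Sum>\<delta><d. int \<delta> - int h) = 0"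
    using centre[of "\<lambda>v. v"] sum_odd_function[of "\<lambda>v. v" "int h"] by simp
  have \<mu>1: "(\<Sum>\<delta><d. \<mu> (int \<delta> - int h) * (int \<delta> - int h)) = 0"
    using centre[of "\<lambda>v. \<mu> v * v"] sum_odd_function[of "\<lambda>v. \<mu> v * v" "int h"] \<mu>(2) by simp
  have finprod: "(\<Otimes>\<^bsub>G\<^esub>\<delta>\<in>{..<d}. \<phi> (w f (i \<delta>) \<delta>)) = \<phi> (0, \<Sum>\<delta><d. \<mu> (int \<delta> - int h) * Q f (i \<delta>))" for f i
  proof -
    have "(\<Otimes>\<^bsub>G\<^esub>\<delta>\<in>{..<d}. \<phi> (w f (i \<delta>) \<delta>)) = \<phi> (\<Sum>\<delta><d. w f (i \<delta>) \<delta>)"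
      by (rule G.finprod_hom_sum) (use hom in auto)
    also have "(\<Sum>\<delta><d. w f (i \<delta>) \<delta>) = (0, \<Sum>\<delta><d. \<mu> (int \<delta> - int h) * Q f (i \<delta>))"
      using id0 by (simp add: w_def prod_eq_iff fst_sum snd_sum)
    finally show ?thesis .
  qed
  have pos: "0 < F" "0 < e" using odd by (auto intro: Nat.gr0I)
  have odd': "odd (int (F * e))" using odd by simp
  let ?I = "{..<F} \<times> {..<e} \<times> {..<d}"
  have inj': "inj_on (\<lambda>(f, i, \<delta>). \<phi> (w f i \<delta>)) ?I"
  proof (clarsimp simp: inj_on_def)
    fix f i \<delta> f' i' \<delta>'
    assume lt: "f < F" "i < e" "\<delta> < d" "f' < F" "i' < e" "\<delta>' < d" and eq: "\<phi> (w f i \<delta>) = \<phi> (w f' i' \<delta>')"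
    have "\<bar>int \<delta> - int h\<bar> \<le> int h" "\<bar>int \<delta>' - int h\<bar> \<le> int h" using lt d by auto
    from inj[OF this eq[unfolded w_def]] have "\<delta> = \<delta>'" by simp
    from inj[OF \<open>\<bar>int \<delta> - int h\<bar> \<le> int h\<close> \<open>\<bar>int \<delta>' - int h\<bar> \<le> int h\<close> eq[unfolded w_def]]
    have dvd: "int (F * e) dvd \<mu> (int \<delta> - int h) * Q f i - \<mu> (int \<delta> - int h) * Q f' i'"
      unfolding \<open>\<delta> = \<delta>'\<close> by simp
    have "int (F * e) dvd \<mu> (int \<delta> - int h) * (Q f i - Q f' i')"
      using dvd by (simp add: right_diff_distrib)
    then have "int (F * e) dvd Q f i - Q f' i'"
      using dvd_mult_small_odd[OF \<mu>(1) odd'] by blast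
    moreover have bound: "0 \<le> Q f i \<and> Q f i < int (F * e)" if "f < F" "i < e" for f i
    proof -
      have "f + F * i < F * Suc i" using that by simp
      also have "\<dots> \<le> F * e" using that by (intro mult_le_mono2) simp
      finally show ?thesis unfolding Q_def by (metis of_nat_0_le_iff of_nat_less_iff)
    qed
    ultimately have "Q f i = Q f' i'"
      using bound[OF lt(1,2)] bound[OF lt(4,5)] by (intro dvd_diff_imp_eq) auto
    then have "f + F * i = f' + F * i'" unfolding Q_def by linarith
    then have "(f + F * i) mod F = (f' + F * i') mod F" "(f + F * i) div F = (f' + F * i') div F" by auto
    then show "f = f' \<and> i = i' \<and> \<delta> = \<delta>'" using lt \<open>\<delta> = \<delta>'\<close> by simp
  qed
  have fin: "finite (carrier G)" using ord pos d by (intro card_ge_0_finite) (simp add: order_def)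
  have "(\<lambda>(f, i, \<delta>). \<phi> (w f i \<delta>)) ` ?I = carrier G"
  proof (rule card_subset_eq[OF fin])
    show "card ((\<lambda>(f, i, \<delta>). \<phi> (w f i \<delta>)) ` ?I) = card (carrier G)"
      unfolding card_image[OF inj'] using ord by (simp add: order_def card_cartesian_product)
  qed (use hom(2) in \<open>auto simp: w_def\<close>)
  with inj' have bij: "bij_betw (\<lambda>(f, i, \<delta>). \<phi> (w f i \<delta>)) ?I (carrier G)" by (simp add: bij_betw_def)
  have "1 < 1 * 1 * d" using d by simp
  also have "\<dots> \<le> F * e * d" using pos by (intro mult_le_mono) auto
  finally have card: "1 < card (carrier G)" using ord by (simp add: order_def)
  show ?thesis
  proof (rule exists_MS0_diagonals[OF G de fin bij card])
    fix f i assume "f < F" "i < e"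
    have "(\<Sum>\<delta><d. \<mu> (int \<delta> - int h) * Q f i) = 0"
      using \<mu>0 by (simp flip: sum_distrib_right)
    then show "(\<Otimes>\<^bsub>G\<^esub>\<delta>\<in>{..<d}. \<phi> (w f i \<delta>)) = \<one>\<^bsub>G\<^esub>"
      unfolding finprod[of f "\<lambda>_. i"] by (simp add: ker)
  next
    fix f j assume "f < F" "j < e"
    \<comment> \<open>\<open>r \<delta>\<close> is the error made by dropping the reduction modulo
      \<open>e\<close>. It is a multiple of \<open>F * e\<close> and so vanishes under
      \<open>\<phi>\<close>; what is left is a combination of the sums of \<open>\<mu> v\<close> and
      of \<open>\<mu> v * v\<close>.\<close>
    define r where "r \<delta> = int (F * e) * (\<mu> (int \<delta> - int h) * int ((j + e - \<delta>) div e))" for \<delta>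
    have "(\<Sum>\<delta><d. \<mu> (int \<delta> - int h) * Q f ((j + e - \<delta>) mod e))
        = (\<Sum>\<delta><d. (int f + int F * (int j + int e - int h)) * \<mu> (int \<delta> - int h)
            - int F * (\<mu> (int \<delta> - int h) * (int \<delta> - int h)) - r \<delta>)"
    proof (rule sum.cong)
      fix \<delta> assume "\<delta> \<in> {..<d}"
      have "(j + e - \<delta>) mod e + e * ((j + e - \<delta>) div e) = j + e - \<delta>" by simp
      then have "int ((j + e - \<delta>) mod e) + int e * int ((j + e - \<delta>) div e) = int j + int e - int \<delta>"
        using \<open>\<delta> \<in> {..<d}\<close> de by (metis (no_types, lifting) lessThan_iff of_nat_add of_nat_diff of_nat_mult
            trans_le_add2 less_imp_le order_trans)
      then have "int ((j + e - \<delta>) mod e) = int j + int e - int \<delta> - int e * int ((j + e - \<delta>) div e)" by linarith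
      then show "\<mu> (int \<delta> - int h) * Q f ((j + e - \<delta>) mod e) =
          (int f + int F * (int j + int e - int h)) * \<mu> (int \<delta> - int h)
            - int F * (\<mu> (int \<delta> - int h) * (int \<delta> - int h)) - r \<delta>"
        unfolding Q_def r_def of_nat_add of_nat_mult by (simp only:) (simp add: algebra_simps)
    qed simp
    also have "\<dots> = - (\<Sum>\<delta><d. r \<delta>)"
      using \<mu>0 \<mu>1 by (simp add: sum_subtractf flip: sum_distrib_left)
    also have "int (F * e) dvd \<dots>"
      unfolding dvd_minus_iff by (rule dvd_sum) (simp add: r_def del: of_nat_mult)
    finally show "(\<Otimes>\<^bsub>G\<^esub>\<delta>\<in>{..<d}. \<phi> (w f ((j + e - \<delta>) mod e) \<delta>)) = \<one>\<^bsub>G\<^esub>"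
      unfolding finprod[of f "\<lambda>\<delta>. (j + e - \<delta>) mod e"] by (rule ker)
  qed
qed

lemma order_integer_mod_group: "0 < N \<Longrightarrow> order (integer_mod_group N) = N"
  by (simp add: order_def carrier_integer_mod_group)

text \<open>As \<open>d = 2 * h + 1\<close>, a value \<open>x\<close> with
  \<open>\<bar>x\<bar> \<le> h\<close> is recovered from the residue of \<open>x + d * y\<close>
  modulo \<open>d\<close>; the remaining factor \<open>F * e\<close> recovers
  \<open>y\<close>.\<close>

lemma exists_MS0_cyclic_diagonals:
  assumes d: "d = 2 * h + 1" "1 \<le> h" and de: "d \<le> e" and odd: "odd (F * e)"
  shows "exists_MS0 (integer_mod_group (F * e * d)) (carrier (integer_mod_group (F * e * d))) e e d d F"
proof -
  have pos: "0 < F * e * d" using odd d by (auto intro: Nat.gr0I)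
  let ?\<phi> = "\<lambda>(x, y). (x + int d * y) mod int (F * e * d)"
  show ?thesis
  proof (rule exists_MS0_odd_diagonals[OF abelian_integer_mod_group order_integer_mod_group[OF pos] d de odd,
        of ?\<phi>])
    show "?\<phi> (x + y) = ?\<phi> x \<otimes>\<^bsub>integer_mod_group (F * e * d)\<^esub> ?\<phi> y" for x y
      by (simp add: case_prod_beta mod_add_eq) (simp add: algebra_simps)
    show "?\<phi> x \<in> carrier (integer_mod_group (F * e * d))" for x
      using pos by (auto simp: carrier_integer_mod_group case_prod_beta pos_mod_bound simp del: of_nat_mult)
    show "?\<phi> (0, y) = \<one>\<^bsub>integer_mod_group (F * e * d)\<^esub>" if "int (F * e) dvd y" for y
    proof -
      have "int (F * e * d) dvd int d * y" using that
        by (metis mult.commute mult_dvd_mono dvd_refl of_nat_mult)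
      then show ?thesis by (simp add: dvd_eq_mod_eq_0)
    qed
    show "x = x' \<and> int (F * e) dvd y - y'"
      if "\<bar>x\<bar> \<le> int h" "\<bar>x'\<bar> \<le> int h" "?\<phi> (x, y) = ?\<phi> (x', y')" for x y x' y'
    proof -
      have dvd: "int (F * e * d) dvd (x + int d * y) - (x' + int d * y')"
        using that(3) by (simp add: mod_eq_dvd_iff)
      then have "int d dvd (x + int d * y) - (x' + int d * y')"
        by (metis dvd_mult_right of_nat_mult)
      then have "int d dvd (x - x') + int d * (y - y')" by (simp add: algebra_simps)
      then have "int d dvd x - x'" by (simp add: dvd_add_left_iff)
      then have "x = x'" by (rule dvd_diff_imp_eq) (use that d in auto)
      with dvd have "int d * int (F * e) dvd int d * (y - y')" by (simp add: algebra_simps)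
      then show ?thesis using \<open>x = x'\<close> d by (simp del: of_nat_mult)
    qed
  qed
qed

text \<open>The same pairs of integers, with each coordinate reduced in its own summand.\<close>

lemma exists_MS0_two_cyclic_diagonals:
  assumes d: "d = 2 * h + 1" "1 \<le> h" and de: "d \<le> e" and odd: "odd (F * e)"
  shows "exists_MS0 (integer_mod_group d \<times>\<times> integer_mod_group (F * e))
    (carrier (integer_mod_group d \<times>\<times> integer_mod_group (F * e))) e e d d F"
proof -
  have pos: "0 < F * e" "0 < d" using odd d by (auto intro: Nat.gr0I)
  let ?G = "integer_mod_group d \<times>\<times> integer_mod_group (F * e)"
  let ?\<phi> = "\<lambda>(x, y). (x mod int d, y mod int (F * e))"
  have ord: "order ?G = F * e * d"
    using pos by (simp add: order_def DirProd_def card_cartesian_product carrier_integer_mod_group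
        del: of_nat_mult)
  have G: "comm_group ?G"
    by (intro group.group_comm_groupI DirProd_group group_integer_mod_group)
      (auto simp: DirProd_def mult_integer_mod_group add.commute)
  show ?thesis
  proof (rule exists_MS0_odd_diagonals[OF G ord d de odd, of ?\<phi>])
    show "?\<phi> (x + y) = ?\<phi> x \<otimes>\<^bsub>?G\<^esub> ?\<phi> y" for x y
      by (simp add: case_prod_beta mod_simps DirProd_def)
    show "?\<phi> x \<in> carrier ?G" for x
      using pos by (auto simp: carrier_integer_mod_group DirProd_def case_prod_beta simp del: of_nat_mult)
    show "?\<phi> (0, y) = \<one>\<^bsub>?G\<^esub>" if "int (F * e) dvd y" for y
      using that by (simp add: DirProd_def dvd_eq_mod_eq_0)
    show "x = x' \<and> int (F * e) dvd y - y'"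
      if "\<bar>x\<bar> \<le> int h" "\<bar>x'\<bar> \<le> int h" "?\<phi> (x, y) = ?\<phi> (x', y')" for x y x' y'
    proof -
      have "int d dvd x - x'" "int (F * e) dvd y - y'" using that(3) by (simp_all add: mod_eq_dvd_iff)
      moreover from this(1) have "x = x'" by (rule dvd_diff_imp_eq) (use that d in auto)
      ultimately show ?thesis by blast
    qed
  qed
qed

text \<open>For coprime odd side lengths \<open>k\<close>, \<open>s\<close> the entries are \<open>s \<alpha> + k \<beta> + k s \<gamma>\<close>, where \<open>\<alpha> = a\<^sub>v u\<close>
  determines the residue modulo \<open>k\<close>, \<open>\<beta> = b\<^sub>\<alpha> v\<close> the residue modulo \<open>s\<close>, and \<open>\<gamma>\<close> separates the arrays.\<close>

lemma exists_MS0_cyclic_rectangles: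
  assumes k: "k = 2 * p + 1" "1 \<le> p" and s: "s = 2 * q + 1" "1 \<le> q"
    and cop: "coprime k s" and C: "odd C"
  shows "exists_MS0 (integer_mod_group (k * s * C)) (carrier (integer_mod_group (k * s * C))) k s s k C"
proof -
  let ?N = "k * s * C" let ?G = "integer_mod_group ?N"
  interpret G: comm_group ?G by (rule abelian_integer_mod_group)
  have C0: "0 < C" using C by (auto intro: Nat.gr0I)
  then have pos: "0 < ?N" using k s by simp
  obtain a :: "int \<Rightarrow> int" where a: "\<And>v. a v \<in> {1, -1, 2, -2}" "\<And>v. a (- v) = a v"
    "(\<Sum>v\<in>{- int q..int q}. a v) = 0"
    using balanced_symmetric_units[OF s(2)] by blast
  obtain \<mu> :: "int \<Rightarrow> int" where \<mu>: "\<And>v. \<mu> v \<in> {1, -1, 2, -2}" "\<And>v. \<mu> (- v) = \<mu> v"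
    "(\<Sum>v\<in>{- int p..int p}. \<mu> v) = 0"
    using balanced_symmetric_units[OF k(2)] by blast
  \<comment> \<open>The centred representative modulo \<open>k\<close>. Since \<open>b\<close>
    factors through \<open>cm\<close>, it is known as soon as the residue of an entry modulo
    \<open>k\<close> is known.\<close>
  define cm where "cm x = (x + int p) mod int k - int p" for x
  have cm_range: "cm x \<in> {- int p..int p}" for x
  proof -
    have "0 \<le> (x + int p) mod int k" "(x + int p) mod int k < int k"
      using k(1) by (intro pos_mod_sign pos_mod_bound; simp)+
    moreover have "int k = 2 * int p + 1" using k(1) by simp
    ultimately have "(x + int p) mod int k \<le> 2 * int p" "0 \<le> (x + int p) mod int k" by linarith+
    then show ?thesis by (simp add: cm_def)
  qed
  have cm_eq: "cm x = cm y \<longleftrightarrow> int k dvd x - y" for x y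
    by (simp add: cm_def mod_eq_dvd_iff)
  define b where "b x = \<mu> (cm x)" for x
  have oddk: "odd (int k)" and odds: "odd (int s)" and oddC: "odd (int C)" using k s C by auto
  have copi: "coprime (int k) (int s)" using cop by simp
  \<comment> \<open>In the last summand the factor \<open>a v\<close> makes the rows cancel, the
    factor \<open>\<mu> u\<close> the columns.\<close>
  define w where "w t u v = int s * (a v * u) + int k * (b (a v * u) * v)
      + int k * int s * (\<mu> u * a v * int t)" for t :: nat and u v :: int
  let ?U = "{- int p..int p}" let ?V = "{- int q..int q}"
  have rowsum: "(\<Sum>v\<in>?V. w t u v) = 0" for t u
  proof -
    have "(\<Sum>v\<in>?V. w t u v) = int s * u * (\<Sum>v\<in>?V. a v) + int k * (\<Sum>v\<in>?V. b (a v * u) * v)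
      + int k * int s * \<mu> u * int t * (\<Sum>v\<in>?V. a v)"
      by (simp add: w_def sum.distrib sum_distrib_left algebra_simps)
    \<comment> \<open>The summand is odd in \<open>v\<close>, because \<open>a\<close> is
      symmetric.\<close>
    moreover have "(\<Sum>v\<in>?V. b (a v * u) * v) = 0"
      by (rule sum_odd_function) (simp add: a(2))
    ultimately show ?thesis using a(3) by simp
  qed
  have colsum: "(\<Sum>u\<in>?U. w t u v) = 0" for t v
  proof -
    \<comment> \<open>Multiplication by the unit \<open>a v\<close> permutes the centred residues
      modulo \<open>k\<close>, so the values of \<open>b\<close> along a column are those of
      \<open>\<mu>\<close> in another order.\<close>
    have "inj_on (\<lambda>u. cm (a v * u)) ?U"
    proof (rule inj_onI)
      fix x y assume xy: "x \<in> ?U" "y \<in> ?U" "cm (a v * x) = cm (a v * y)"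
      then have "int k dvd a v * (x - y)" by (simp add: cm_eq right_diff_distrib)
      then have "int k dvd x - y" using dvd_mult_small_odd[OF a(1) oddk] by blast
      then show "x = y" by (rule dvd_diff_imp_eq) (use xy k in auto)
    qed
    moreover have "(\<lambda>u. cm (a v * u)) ` ?U \<subseteq> ?U" using cm_range by blast
    ultimately have "bij_betw (\<lambda>u. cm (a v * u)) ?U ?U"
      by (simp add: bij_betw_def endo_inj_surj)
    then have "(\<Sum>u\<in>?U. b (a v * u)) = (\<Sum>u\<in>?U. \<mu> u)"
      unfolding b_def by (rule sum.reindex_bij_betw)
    moreover have "(\<Sum>u\<in>?U. w t u v) = int s * a v * (\<Sum>u\<in>?U. u) + int k * v * (\<Sum>u\<in>?U. b (a v * u))
      + int k * int s * a v * int t * (\<Sum>u\<in>?U. \<mu> u)"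
      by (simp add: w_def sum.distrib sum_distrib_left algebra_simps)
    moreover have "(\<Sum>u\<in>?U. u) = 0" by (rule sum_odd_function) simp
    ultimately show ?thesis using \<mu>(3) by simp
  qed
  let ?I = "{..<C} \<times> ?U \<times> ?V"
  let ?v = "\<lambda>(t, u, v). w t u v mod int ?N"
  have vin0: "x mod int ?N \<in> carrier ?G" for x
    using pos by (auto simp: carrier_integer_mod_group simp del: of_nat_mult)
  then have vin: "?v \<in> ?I \<rightarrow> carrier ?G" by auto
  have finprod: "(\<Otimes>\<^bsub>?G\<^esub>x\<in>A. f x mod int ?N) = (\<Sum>x\<in>A. f x) mod int ?N" if "finite A"
    for A :: "int set" and f
    by (rule G.finprod_hom_sum[where \<phi> = "\<lambda>x. x mod int ?N"])
      (use that pos in \<open>auto simp: mod_simps carrier_integer_mod_group simp del: of_nat_mult\<close>)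
  \<comment> \<open>Reduction modulo \<open>k\<close> gives \<open>a v * u\<close> up to congruence
    and thus the value of \<open>b\<close>; reduction modulo \<open>s\<close> then gives
    \<open>v\<close>, the first congruence now gives \<open>u\<close>, and what remains determines
    \<open>t\<close> modulo \<open>C\<close>.\<close>
  have core: "t = t' \<and> u = u' \<and> v = v'"
    if lt: "t \<in> {..<C}" "u \<in> ?U" "v \<in> ?V" "t' \<in> {..<C}" "u' \<in> ?U" "v' \<in> ?V"
      and eq: "w t u v mod int ?N = w t' u' v' mod int ?N" for t t' u u' v v'
  proof -
    have dvd: "int k * int s * int C dvd w t u v - w t' u' v'"
      using eq by (simp add: mod_eq_dvd_iff)
    then have "int k dvd w t u v - w t' u' v'" by (metis dvd_mult_left)
    moreover have "w t u v - w t' u' v' = int s * (a v * u - a v' * u')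
        + int k * (b (a v * u) * v - b (a v' * u') * v' + int s * (\<mu> u * a v * int t - \<mu> u' * a v' * int t'))"
      by (simp add: w_def algebra_simps)
    ultimately have "int k dvd int s * (a v * u - a v' * u')" by (simp add: dvd_add_left_iff)
    then have k1: "int k dvd a v * u - a v' * u'" using copi by (simp add: coprime_dvd_mult_right_iff)
    then have b: "b (a v * u) = b (a v' * u')" by (simp add: b_def flip: cm_eq)
    have "int s dvd w t u v - w t' u' v'" using dvd by (metis dvd_mult_left dvd_mult_right)
    moreover have "w t u v - w t' u' v' = int k * (b (a v * u) * (v - v'))
        + int s * (a v * u - a v' * u' + int k * (\<mu> u * a v * int t - \<mu> u' * a v' * int t'))"
      using b by (simp add: w_def algebra_simps)
    ultimately have "int s dvd int k * (b (a v * u) * (v - v'))" by (simp add: dvd_add_left_iff)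
    then have "int s dvd b (a v * u) * (v - v')" using copi by (simp add: coprime_dvd_mult_right_iff coprime_commute)
    moreover have "b (a v * u) \<in> {1, -1, 2, -2}" unfolding b_def by (rule \<mu>(1))
    ultimately have "int s dvd v - v'" using dvd_mult_small_odd[OF _ odds] by blast
    then have v: "v = v'" by (rule dvd_diff_imp_eq) (use lt s in auto)
    then have "int k dvd a v * (u - u')" using k1 by (simp add: right_diff_distrib)
    then have "int k dvd u - u'" using dvd_mult_small_odd[OF a(1) oddk] by blast
    then have u: "u = u'" by (rule dvd_diff_imp_eq) (use lt k in auto)
    have "w t u v - w t' u' v' = int k * int s * (\<mu> u * (a v * (int t - int t')))"
      using u v by (simp add: w_def algebra_simps)
    then have "int C dvd \<mu> u * (a v * (int t - int t'))" using dvd k s by simp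
    then have "int C dvd int t - int t'"
      using dvd_mult_small_odd[OF a(1) oddC] dvd_mult_small_odd[OF \<mu>(1) oddC] by blast
    then have "int t = int t'" by (rule dvd_diff_imp_eq) (use lt in auto)
    then show ?thesis using u v by simp
  qed
  have inj: "inj_on ?v ?I"
  proof (rule inj_onI)
    fix x y assume xy: "x \<in> ?I" "y \<in> ?I" "?v x = ?v y"
    obtain t u v t' u' v' where x: "x = (t, u, v)" "y = (t', u', v')" by (cases x, cases y)
    show "x = y" using core[of t u v t' u' v'] xy unfolding x by (simp del: of_nat_mult)
  qed
  have "card ?U = k" "card ?V = s" using k s by simp_all
  then have "card (?v ` ?I) = ?N"
    unfolding card_image[OF inj] card_cartesian_product by (simp add: ac_simps)
  then have img: "?v ` ?I = carrier ?G"
  proof (intro card_subset_eq)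
    show "finite (carrier ?G)" using pos by (simp add: carrier_integer_mod_group)
    show "?v ` ?I \<subseteq> carrier ?G" using vin by blast
  qed (use order_integer_mod_group[OF pos] in \<open>simp add: order_def\<close>)
  have "placement ?G ?I ?v fst (\<lambda>(t, u, v). nat (u + int p)) (\<lambda>(t, u, v). nat (v + int q)) k s s k C"
    unfolding placement_def
  proof (intro conjI allI impI)
    show "inj_on (\<lambda>x. (fst x, (case x of (t, u, v) \<Rightarrow> nat (u + int p)), case x of (t, u, v) \<Rightarrow> nat (v + int q))) ?I"
      by (auto simp: inj_on_def)
    show "\<forall>x\<in>?I. fst x < C \<and> (case x of (t, u, v) \<Rightarrow> nat (u + int p)) < k \<and>
       (case x of (t, u, v) \<Rightarrow> nat (v + int q)) < s" using k s by auto
  next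
    fix t i assume ti: "t < C" "i < k"
    have eq: "{x \<in> ?I. fst x = t \<and> (case x of (t, u, v) \<Rightarrow> nat (u + int p)) = i}
        = (\<lambda>v. (t, int i - int p, v)) ` ?V" using ti k by auto
    have inj': "inj_on (\<lambda>v. (t, int i - int p, v)) ?V" by (auto simp: inj_on_def)
    show "card {x \<in> ?I. fst x = t \<and> (case x of (t, u, v) \<Rightarrow> nat (u + int p)) = i} = s"
      unfolding eq card_image[OF inj'] using s by simp
    show "finprod ?G ?v {x \<in> ?I. fst x = t \<and> (case x of (t, u, v) \<Rightarrow> nat (u + int p)) = i} = \<one>\<^bsub>?G\<^esub>"
      unfolding eq
      by (subst G.finprod_reindex[OF _ inj'])
        (use vin0 in \<open>auto simp: finprod rowsum simp del: of_nat_mult mult_integer_mod_group\<close>)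
  next
    fix t j assume tj: "t < C" "j < s"
    have eq: "{x \<in> ?I. fst x = t \<and> (case x of (t, u, v) \<Rightarrow> nat (v + int q)) = j}
        = (\<lambda>u. (t, u, int j - int q)) ` ?U" using tj s by auto
    have inj': "inj_on (\<lambda>u. (t, u, int j - int q)) ?U" by (auto simp: inj_on_def)
    show "card {x \<in> ?I. fst x = t \<and> (case x of (t, u, v) \<Rightarrow> nat (v + int q)) = j} = k"
      unfolding eq card_image[OF inj'] using k by simp
    show "finprod ?G ?v {x \<in> ?I. fst x = t \<and> (case x of (t, u, v) \<Rightarrow> nat (v + int q)) = j} = \<one>\<^bsub>?G\<^esub>"
      unfolding eq
      by (subst G.finprod_reindex[OF _ inj'])
        (use vin0 in \<open>auto simp: finprod colsum simp del: of_nat_mult mult_integer_mod_group\<close>)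
  qed (use vin inj in auto)
  moreover have "1 < card (carrier ?G)"
  proof -
    have "3 * 3 * 1 \<le> k * s * C" using k s C0 by (intro mult_le_mono) auto
    then show ?thesis using order_integer_mod_group[OF pos] by (simp add: order_def)
  qed
  ultimately show ?thesis using exists_MS0_if_placement[OF abelian_integer_mod_group _ img] by blast
qed

section \<open>Assembly for arbitrary parameters\<close>

text \<open>Dividing \<open>m * s = n * k\<close> by the gcd gives \<open>m * s' = n * k'\<close>;
  coprimality forces \<open>s'\<close> to divide \<open>n\<close>, and the cofactor \<open>e\<close>
  is shared by \<open>m\<close>. Dividing \<open>s \<le> n\<close> by \<open>s'\<close> gives
  \<open>gcd s k \<le> e\<close>.\<close>

lemma array_parameters:
  fixes m n s k :: nat
  assumes "0 < s" "0 < k" "s \<le> n" "m * s = n * k"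
  obtains s' k' e where "s = gcd s k * s'" "k = gcd s k * k'" "m = k' * e" "n = s' * e"
    "gcd s k \<le> e" "coprime s' k'" "0 < s'" "0 < k'" "0 < gcd s k"
proof -
  let ?d = "gcd s k"
  obtain s' k' where sk: "s = s' * ?d" "k = k' * ?d" "coprime s' k'"
    using gcd_coprime_exists[of s k] assms by auto
  have d: "0 < ?d" using assms by simp
  have pos: "0 < s'" "0 < k'" using sk assms by (metis mult_0 neq0_conv)+
  have "m * s' * ?d = n * k' * ?d" using assms(4) sk by (metis mult.assoc)
  then have eq: "m * s' = n * k'" using d by (metis mult_right_cancel less_not_refl2)
  then have "s' dvd n * k'" by (metis dvd_triv_right)
  then have "s' dvd n" using sk(3) by (simp add: coprime_dvd_mult_left_iff)
  then obtain e where e: "n = s' * e" by (auto elim: dvdE)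
  have "m = k' * e" using eq e pos by simp
  moreover have "?d \<le> e" using assms(3) sk(1) e pos
    by (metis mult_le_cancel1)
  ultimately show thesis using that[of s' k' e] sk pos e d by (simp add: mult.commute)
qed

text \<open>One diagonal cannot cancel, so for \<open>d = 1\<close> full \<open>k\<close> by
  \<open>s\<close> rectangles are put on the block diagonal of an \<open>e\<close> by
  \<open>e\<close> grid. For \<open>d \<ge> 3\<close>, arrays of size \<open>e\<close> fill every
  cell of a \<open>k'\<close> by \<open>s'\<close> grid.\<close>

lemma exists_MS0_cyclic_odd:
  assumes "2 \<le> s" "s \<le> n" "2 \<le> k" "k \<le> m" "m * s = n * k" "odd (n * k * c)"
  shows "exists_MS0 (integer_mod_group (n * k * c)) (carrier (integer_mod_group (n * k * c))) m n s k c"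
proof -
  obtain s' k' e where p: "s = gcd s k * s'" "k = gcd s k * k'" "m = k' * e" "n = s' * e"
    "gcd s k \<le> e" "coprime s' k'" "0 < s'" "0 < k'" "0 < gcd s k"
    using array_parameters[of s k n m] assms by auto
  define d where "d = gcd s k"
  note p = p[folded d_def]
  have odd: "odd s'" "odd k'" "odd d" "odd e" "odd c" using assms(6) p(2,4) by auto
  show ?thesis
  proof (cases "d = 1")
    case True
    then have s: "s = s'" "k = k'" using p by auto
    have "exists_MS0 (integer_mod_group (k * s * (c * e))) (carrier (integer_mod_group (k * s * (c * e))))
       k s s k (c * e)"
    proof (rule exists_MS0_cyclic_rectangles[where p = "k div 2" and q = "s div 2"])
      show "coprime k s" using p(6) s by (simp add: coprime_commute)
      show "k = 2 * (k div 2) + 1" "s = 2 * (s div 2) + 1" using odd(1,2) s by simp_all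
      show "1 \<le> k div 2" "1 \<le> s div 2" using assms(1,3) by linarith+
      show "odd (c * e)" using odd by simp
    qed
    then have "exists_MS0 (integer_mod_group (k * s * (c * e))) (carrier (integer_mod_group (k * s * (c * e))))
       (e * k) (e * s) (1 * s) (1 * k) c"
      using odd(4) odd_pos[of e] by (intro exists_MS0_inflate) auto
    moreover have "k * s * (c * e) = n * k * c" "e * k = m" "e * s = n" using p s by auto
    ultimately show ?thesis by simp
  next
    case False
    have "exists_MS0 (integer_mod_group (c * (k' * s') * e * d)) (carrier (integer_mod_group (c * (k' * s') * e * d)))
       e e d d (c * (k' * s'))"
    proof (rule exists_MS0_cyclic_diagonals[where h = "d div 2"])
      show "d = 2 * (d div 2) + 1" using odd(3) by simp
      show "1 \<le> d div 2" using odd(3) False by presburger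
    qed (use p(5) odd in simp_all)
    then have "exists_MS0 (integer_mod_group (c * (k' * s') * e * d)) (carrier (integer_mod_group (c * (k' * s') * e * d)))
       (k' * e) (s' * e) (s' * d) (k' * d) c"
      using p(7,8) by (intro exists_MS0_inflate) simp_all
    moreover have "c * (k' * s') * e * d = n * k * c" by (subst p(2), subst p(4)) (simp add: ac_simps)
    moreover have "s' * d = s" "k' * d = k" using p by (simp_all add: mult.commute)
    ultimately show ?thesis using p(3,4) by simp
  qed
qed

lemma exists_M0_two_cyclic:
  fixes m n s k :: nat
  defines "d \<equiv> gcd s k"
  assumes "2 \<le> s" "s \<le> n" "2 \<le> k" "k \<le> m" "m * s = n * k" "odd (n * k)" "gcd n (d - 1) = 1"
  shows "exists_M0 (integer_mod_group d \<times>\<times> integer_mod_group (n * k div d))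
    (carrier (integer_mod_group d \<times>\<times> integer_mod_group (n * k div d))) m n s k"
proof -
  obtain s' k' e where p: "s = gcd s k * s'" "k = gcd s k * k'" "m = k' * e" "n = s' * e"
    "gcd s k \<le> e" "coprime s' k'" "0 < s'" "0 < k'" "0 < gcd s k"
    using array_parameters[of s k n m] assms(2-6) by auto
  note p = p[folded d_def]
  have odd: "odd s'" "odd k'" "odd d" "odd e" using assms(7) p(2,4) by auto
  \<comment> \<open>For \<open>d = 1\<close> the gcd would be \<open>gcd n 0 = n\<close>, which is
    at least 2.\<close>
  have "d \<noteq> 1" using assms(2,3,8) by auto
  have "exists_MS0 (integer_mod_group d \<times>\<times> integer_mod_group (1 * (k' * s') * e))
      (carrier (integer_mod_group d \<times>\<times> integer_mod_group (1 * (k' * s') * e))) e e d d (1 * (k' * s'))"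
  proof (rule exists_MS0_two_cyclic_diagonals[where h = "d div 2"])
    show "d = 2 * (d div 2) + 1" using odd(3) by simp
    show "1 \<le> d div 2" using odd(3) \<open>d \<noteq> 1\<close> by presburger
  qed (use p(5) odd in simp_all)
  moreover have "n * k div d = 1 * (k' * s') * e" using p(2,4,9) by simp
  moreover have "comm_group (integer_mod_group d \<times>\<times> integer_mod_group (n * k div d))"
    by (intro group.group_comm_groupI DirProd_group group_integer_mod_group)
      (auto simp: DirProd_def mult_integer_mod_group add.commute)
  ultimately have "exists_MS0 (integer_mod_group d \<times>\<times> integer_mod_group (n * k div d))
      (carrier (integer_mod_group d \<times>\<times> integer_mod_group (n * k div d))) (k' * e) (s' * e) (s' * d) (k' * d) 1"
    using p(7,8) by (intro exists_MS0_inflate) simp_all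
  then show ?thesis using p(1-4) by (simp add: exists_M0_iff_exists_MS0 mult.commute)
qed


section \<open>Two-rowed arrays over the nonzero elements\<close>

text \<open>Column \<open>j\<close> of array \<open>t\<close> holds \<open>w t j\<close> above its
  inverse. There are \<open>2 * n * c\<close> cells and as many nonzero elements, so covering
  already forces each element to occur exactly once.\<close>

lemma exists_MS0_half_systems:
  fixes w :: "nat \<Rightarrow> nat \<Rightarrow> 'a"
  assumes G: "comm_group G" and w: "\<And>t j. t < c \<Longrightarrow> j < n \<Longrightarrow> w t j \<in> carrier G"
    and prod: "\<And>t. t < c \<Longrightarrow> (\<Otimes>\<^bsub>G\<^esub>j\<in>{..<n}. w t j) = \<one>\<^bsub>G\<^esub>"
    and cover: "\<And>x. x \<in> nonzero G \<Longrightarrow> \<exists>t<c. \<exists>j<n. x = w t j \<or> x = inv\<^bsub>G\<^esub> (w t j)"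
    and card: "card (nonzero G) = 2 * n * c" "1 < card (nonzero G)"
  shows "exists_MS0 G (nonzero G) 2 n n 2 c"
proof -
  interpret G: comm_group G by (rule G)
  let ?I = "{..<c} \<times> {..<n} \<times> {..<2::nat}"
  let ?v = "\<lambda>(t, j, b::nat). if b = 0 then w t j else inv\<^bsub>G\<^esub> (w t j)"
  have sub: "nonzero G \<subseteq> ?v ` ?I"
  proof
    fix x assume "x \<in> nonzero G"
    then obtain t j where tj: "t < c" "j < n" and "x = w t j \<or> x = inv\<^bsub>G\<^esub> (w t j)"
      using cover by blast
    then consider "x = ?v (t, j, 0)" | "x = ?v (t, j, 1)" by fastforce
    then show "x \<in> ?v ` ?I" using tj by cases (erule image_eqI, simp)+
  qed
  have cI: "card ?I = card (nonzero G)" using card(1) by (simp add: card_cartesian_product)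
  have "card (?v ` ?I) \<le> card ?I" by (rule card_image_le) simp
  then have img: "?v ` ?I = nonzero G"
    using card_seteq[OF _ sub] cI by auto
  then have inj: "inj_on ?v ?I" using cI by (intro eq_card_imp_inj_on) simp_all
  have vin: "?v \<in> ?I \<rightarrow> carrier G" using w by auto
  have "placement G ?I ?v fst (snd \<circ> snd) (fst \<circ> snd) 2 n n 2 c"
    unfolding placement_def
  proof (intro conjI allI impI)
    show "inj_on (\<lambda>x. (fst x, (snd \<circ> snd) x, (fst \<circ> snd) x)) ?I" by (auto simp: inj_on_def)
  next
    fix t b assume tb: "t < c" "b < (2::nat)"
    have eq: "{x \<in> ?I. fst x = t \<and> (snd \<circ> snd) x = b} = (\<lambda>j. (t, j, b)) ` {..<n}"
      using tb by auto
    have inj': "inj_on (\<lambda>j. (t, j, b)) {..<n}" by (auto simp: inj_on_def)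
    show "card {x \<in> ?I. fst x = t \<and> (snd \<circ> snd) x = b} = n"
      unfolding eq card_image[OF inj'] by simp
    have "(\<Otimes>\<^bsub>G\<^esub>j\<in>{..<n}. inv\<^bsub>G\<^esub> (w t j)) = \<one>\<^bsub>G\<^esub>"
    proof -
      have "\<one>\<^bsub>G\<^esub> = (\<Otimes>\<^bsub>G\<^esub>j\<in>{..<n}. w t j \<otimes>\<^bsub>G\<^esub> inv\<^bsub>G\<^esub> (w t j))"
        by (rule G.finprod_one_eqI[symmetric]) (use w tb in auto)
      also have "\<dots> = (\<Otimes>\<^bsub>G\<^esub>j\<in>{..<n}. w t j) \<otimes>\<^bsub>G\<^esub> (\<Otimes>\<^bsub>G\<^esub>j\<in>{..<n}. inv\<^bsub>G\<^esub> (w t j))"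
        by (rule G.finprod_multf) (use w tb in auto)
      also have "\<dots> = (\<Otimes>\<^bsub>G\<^esub>j\<in>{..<n}. inv\<^bsub>G\<^esub> (w t j))"
        unfolding prod[OF tb(1)] by (rule G.l_one) (use w tb in auto)
      finally show ?thesis by simp
    qed
    then have "(\<Otimes>\<^bsub>G\<^esub>j\<in>{..<n}. ?v (t, j, b)) = \<one>\<^bsub>G\<^esub>"
      using prod[OF tb(1)] by (cases "b = 0") simp_all
    then show "finprod G ?v {x \<in> ?I. fst x = t \<and> (snd \<circ> snd) x = b} = \<one>\<^bsub>G\<^esub>"
      unfolding eq by (subst G.finprod_reindex[OF _ inj']) (use w tb in auto)
  next
    fix t j assume tj: "t < c" "j < n"
    have eq: "{x \<in> ?I. fst x = t \<and> (fst \<circ> snd) x = j} = {(t, j, 0), (t, j, 1)}"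
      using tj by auto
    show "card {x \<in> ?I. fst x = t \<and> (fst \<circ> snd) x = j} = 2" unfolding eq by simp
    show "finprod G ?v {x \<in> ?I. fst x = t \<and> (fst \<circ> snd) x = j} = \<one>\<^bsub>G\<^esub>"
      unfolding eq using w[OF tj] by simp
  qed (use inj vin in auto)
  then show ?thesis using exists_MS0_if_placement[OF G _ img card(2)] by blast
qed

text \<open>The parity of \<open>1 + \<dots> + L\<close> decides whether \<open>{1..L}\<close> can be signed to sum 0; otherwise \<open>L\<close> is
  replaced by \<open>L + 1\<close>, which is \<open>- L\<close> modulo \<open>2 L + 1\<close>.\<close>

definition abs_range :: "nat \<Rightarrow> nat set" where
  "abs_range L = {x. 1 \<le> x \<and> (if L mod 4 = 0 \<or> L mod 4 = 3 then x \<le> L else x < L \<or> x = L + 1)}"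

text \<open>Only covering is recorded. As \<open>abs_range (n * c)\<close> has \<open>n * c\<close>
  elements, it forces the absolute values of the \<open>n * c\<close> entries to be
  distinct.\<close>

definition zero_sum_cover :: "nat \<Rightarrow> nat \<Rightarrow> nat set \<Rightarrow> bool" where
  "zero_sum_cover n c H \<longleftrightarrow> (\<exists>w :: nat \<Rightarrow> nat \<Rightarrow> int. (\<forall>t<c. (\<Sum>j<n. w t j) = 0) \<and>
     (\<forall>x\<in>H. \<exists>t<c. \<exists>j<n. \<bar>w t j\<bar> = int x))"

text \<open>Each array receives four further numbers as in
  \<open>x - (x + 1) - (x + 2) + (x + 3) = 0\<close>. The length grows by \<open>4 * c\<close>, so
  its residue modulo 4, and with it the shape of \<open>abs_range\<close>, stays the same.\<close>

lemma zero_sum_cover_add4: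
  assumes "zero_sum_cover n c (abs_range (n * c))"
  shows "zero_sum_cover (n + 4) c (abs_range ((n + 4) * c))"
proof -
  define L where "L = n * c"
  obtain w :: "nat \<Rightarrow> nat \<Rightarrow> int" where w: "\<And>t. t < c \<Longrightarrow> (\<Sum>j<n. w t j) = 0"
    "\<And>x. x \<in> abs_range L \<Longrightarrow> \<exists>t<c. \<exists>j<n. \<bar>w t j\<bar> = int x"
    using assms unfolding zero_sum_cover_def L_def by blast
  define full where "full \<longleftrightarrow> L mod 4 = 0 \<or> L mod 4 = 3"
  \<comment> \<open>In the shape with a hole the offsets \<open>0, 2, 3, 5\<close> cancel under the
    same signs: quadruple \<open>t\<close> fills the hole at \<open>L + 4 * t\<close> and opens one
    at \<open>L + 4 * t + 4\<close>.\<close>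
  define q :: "nat \<Rightarrow> nat \<Rightarrow> int" where "q t i = (if full then
      (if i = 0 then int (L + 4 * t + 1) else if i = 1 then - int (L + 4 * t + 2)
       else if i = 2 then - int (L + 4 * t + 3) else int (L + 4 * t + 4))
    else
      (if i = 0 then int (L + 4 * t) else if i = 1 then - int (L + 4 * t + 2)
       else if i = 2 then - int (L + 4 * t + 3) else int (L + 4 * t + 5)))" for t i
  define w' where "w' t j = (if j < n then w t j else q t (j - n))" for t j
  have split: "(\<Sum>j<n + 4. w' t j) = (\<Sum>j<n. w t j) + (q t 0 + q t 1 + q t 2 + q t 3)" for t
  proof -
    have "(\<Sum>j<n + 4. w' t j) = (\<Sum>j<n. w' t j) + w' t n + w' t (n + 1) + w' t (n + 2) + w' t (n + 3)"
      by (simp add: eval_nat_numeral)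
    then show ?thesis by (simp add: w'_def)
  qed
  have "(\<Sum>j<n + 4. w' t j) = 0" if "t < c" for t
    unfolding split w(1)[OF that] by (simp add: q_def)
  moreover have "\<exists>t<c. \<exists>j<n + 4. \<bar>w' t j\<bar> = int x" if x: "x \<in> abs_range ((n + 4) * c)" for x
  proof -
    have L': "(n + 4) * c = L + 4 * c" by (simp add: L_def algebra_simps)
    have full': "((n + 4) * c) mod 4 = 0 \<or> ((n + 4) * c) mod 4 = 3 \<longleftrightarrow> full"
      unfolding L' full_def by simp
    have x': "1 \<le> x" "if full then x \<le> L + 4 * c else x < L + 4 * c \<or> x = L + 4 * c + 1"
      using x unfolding abs_range_def full' by (auto simp: L')
    have new: ?thesis if "t < c" "i < 4" "\<bar>q t i\<bar> = int x" for t i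
      using that by (intro exI[of _ t] conjI exI[of _ "n + i"]) (auto simp: w'_def)
    show ?thesis
    proof (cases "x \<in> abs_range L")
      case True
      then obtain t j where "t < c" "j < n" "\<bar>w t j\<bar> = int x" using w(2) by blast
      then show ?thesis by (intro exI[of _ t] conjI exI[of _ j]) (auto simp: w'_def)
    next
      case False
      show ?thesis
      proof (cases full)
        case True
        then have "L < x" using False x'(1) by (auto simp: abs_range_def full_def)
        have "\<exists>t i. x = L + 4 * t + i + 1 \<and> t < c \<and> i < 4"
          using \<open>L < x\<close> x'(2) True
          by (intro exI[of _ "(x - L - 1) div 4"] exI[of _ "(x - L - 1) mod 4"]) auto
        then obtain t i where ti: "x = L + 4 * t + i + 1" "t < c" "i < 4" by blast
        then have "i = 0 \<or> i = 1 \<or> i = 2 \<or> i = 3" by linarith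
        then have "\<bar>q t i\<bar> = int x" using True unfolding ti(1) by (auto simp: q_def)
        then show ?thesis using new ti(2,3) by blast
      next
        case fl: False
        then have ge: "L \<le> x" "x \<noteq> L + 1" using False x'(1) by (auto simp: abs_range_def full_def)
        define z where "z = x - L"
        have x: "x = L + z" "z \<noteq> 1" "z < 4 * c \<or> z = 4 * c + 1" using ge x'(2) fl by (auto simp: z_def)
        consider t where "t < c" "z = 4 * t" | t where "t < c" "z = 4 * t + 2"
          | t where "t < c" "z = 4 * t + 3" | t where "t < c" "z = 4 * t + 5"
        proof -
          have "(\<exists>t<c. z = 4 * t) \<or> (\<exists>t<c. z = 4 * t + 2) \<or> (\<exists>t<c. z = 4 * t + 3) \<or> (\<exists>t<c. z = 4 * t + 5)"
            using x(2,3) by presburger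
          then show thesis using that by blast
        qed
        then show ?thesis
        proof cases
          case 1 then show ?thesis using fl x(1) by (intro new[of _ 0]) (auto simp: q_def)
        next
          case 2 then show ?thesis using fl x(1) by (intro new[of _ 1]) (auto simp: q_def)
        next
          case 3 then show ?thesis using fl x(1) by (intro new[of _ 2]) (auto simp: q_def)
        next
          case 4 then show ?thesis using fl x(1) by (intro new[of _ 3]) (auto simp: q_def)
        qed
      qed
    qed
  qed
  ultimately show ?thesis unfolding zero_sum_cover_def by blast
qed

text \<open>Skolem sequences and hooked Skolem sequences: the pairs have the differences \<open>1, \<dots>, c\<close> and
  together exhaust \<open>{1..2 c}\<close> or \<open>{1..2 c - 1} \<union> {2 c + 1}\<close>. The families below are the classical ones.\<close>

definition skolem_range :: "int \<Rightarrow> int set" where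
  "skolem_range c = {x. 1 \<le> x \<and> (if c mod 4 \<le> 1 then x \<le> 2 * c else x < 2 * c \<or> x = 2 * c + 1)}"

definition skolem :: "int \<Rightarrow> (int \<times> int) list \<Rightarrow> bool" where
  "skolem c ps \<longleftrightarrow> length ps = nat c \<and> (\<forall>i\<in>{1..c}. \<exists>(a, b)\<in>set ps. b = a + i) \<and>
     (\<forall>x\<in>skolem_range c. \<exists>(a, b)\<in>set ps. x = a \<or> x = b)"

text \<open>The four families below start at \<open>c = 8, 9, 6, 7\<close>.\<close>

lemma ex_skolem_small:
  assumes "1 \<le> c" "c \<le> 5"
  shows "\<exists>ps. skolem c ps"
proof -
  consider "c = 1" | "c = 2" | "c = 3" | "c = 4" | "c = 5" using assms by linarith
  then show ?thesis
  proof cases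
    case 1
    show ?thesis unfolding skolem_def skolem_range_def 1
      by (rule exI[of _ "[(1, 2)]"]) (auto; presburger)
  next
    case 2
    show ?thesis unfolding skolem_def skolem_range_def 2
      by (rule exI[of _ "[(3, 5), (1, 2)]"]) (auto; presburger)
  next
    case 3
    show ?thesis unfolding skolem_def skolem_range_def 3
      by (rule exI[of _ "[(1, 4), (5, 7), (2, 3)]"]) (auto; presburger)
  next
    case 4
    show ?thesis unfolding skolem_def skolem_range_def 4
      by (rule exI[of _ "[(1, 5), (3, 6), (2, 4), (7, 8)]"]) (auto; presburger)
  next
    case 5
    show ?thesis unfolding skolem_def skolem_range_def 5
      by (rule exI[of _ "[(1, 6), (3, 7), (5, 8), (2, 4), (9, 10)]"]) (auto; presburger)
  qed
qed

text \<open>Pairs nested around a common centre have differences of one parity. The first list gives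
  the even differences \<open>2, ..., 4*s\<close>, the other two the odd ones
  \<open>2*s+3, ..., 4*s-3\<close> and \<open>3, ..., 2*s-3\<close>. The single pairs supply
  \<open>2*s+1, 1, 2*s-1, 4*s-1\<close>.\<close>

lemma ex_skolem_0:
  fixes s :: int
  assumes "2 \<le> s"
  shows "\<exists>ps. skolem (4 * s) ps"
proof -
  let ?ps = "map (\<lambda>r. (4*s+r-1, 8*s-r+1)) [1..2*s] @ map (\<lambda>r. (r, 4*s-r-1)) [1..s-2] @ map (\<lambda>r. (s+r+1, 3*s-r)) [1..s-2]
    @ [(s-1, 3*s), (s, s+1), (2*s, 4*s-1), (2*s+1, 6*s)]"
  have "length ?ps = nat (4 * s)" using assms by simp
  moreover have "\<exists>(a, b)\<in>set ?ps. b = a + i" if "1 \<le> i" "i \<le> 4 * s" for i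
  proof -
    have "(\<exists>r. 1 \<le> r \<and> r \<le> 2*s \<and> 8*s-r+1 = 4*s+r-1 + i) \<or> (\<exists>r. 1 \<le> r \<and> r \<le> s-2 \<and> 4*s-r-1 = r + i) \<or> (\<exists>r. 1 \<le> r \<and> r \<le> s-2 \<and> 3*s-r = s+r+1 + i)
      \<or> 3*s = s-1 + i \<or> s+1 = s + i \<or> 4*s-1 = 2*s + i \<or> 6*s = 2*s+1 + i"
      using assms that by presburger
    then show ?thesis by (fastforce simp: bex_Un)
  qed
  moreover have "\<exists>(a, b)\<in>set ?ps. x = a \<or> x = b" if "1 \<le> x" "x \<le> 8 * s" for x
  proof -
    have "(4*s \<le> x \<and> x \<le> 6*s-1 \<or> 6*s+1 \<le> x \<and> x \<le> 8*s)
      \<or> (1 \<le> x \<and> x \<le> s-2 \<or> 3*s+1 \<le> x \<and> x \<le> 4*s-2)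
      \<or> (s+2 \<le> x \<and> x \<le> 2*s-1 \<or> 2*s+2 \<le> x \<and> x \<le> 3*s-1)
      \<or> x = s-1 \<or> x = 3*s \<or> x = s \<or> x = s+1 \<or> x = 2*s \<or> x = 4*s-1 \<or> x = 2*s+1 \<or> x = 6*s"
      using assms that by smt
    moreover have "\<exists>r. 1 \<le> r \<and> r \<le> 2*s \<and> (x = 4*s+r-1 \<or> x = 8*s-r+1)"
      if "4*s \<le> x \<and> x \<le> 6*s-1 \<or> 6*s+1 \<le> x \<and> x \<le> 8*s" using that by presburger
    moreover have "\<exists>r. 1 \<le> r \<and> r \<le> s-2 \<and> (x = r \<or> x = 4*s-r-1)"
      if "1 \<le> x \<and> x \<le> s-2 \<or> 3*s+1 \<le> x \<and> x \<le> 4*s-2" using that by presburger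
    moreover have "\<exists>r. 1 \<le> r \<and> r \<le> s-2 \<and> (x = s+r+1 \<or> x = 3*s-r)"
      if "s+2 \<le> x \<and> x \<le> 2*s-1 \<or> 2*s+2 \<le> x \<and> x \<le> 3*s-1" using that by presburger
    ultimately have "(\<exists>r. 1 \<le> r \<and> r \<le> 2*s \<and> (x = 4*s+r-1 \<or> x = 8*s-r+1))
      \<or> (\<exists>r. 1 \<le> r \<and> r \<le> s-2 \<and> (x = r \<or> x = 4*s-r-1))
      \<or> (\<exists>r. 1 \<le> r \<and> r \<le> s-2 \<and> (x = s+r+1 \<or> x = 3*s-r))
      \<or> x = s-1 \<or> x = 3*s \<or> x = s \<or> x = s+1 \<or> x = 2*s \<or> x = 4*s-1 \<or> x = 2*s+1 \<or> x = 6*s" by blast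
    then show ?thesis by (fastforce simp: bex_Un)
  qed
  moreover have "x \<in> skolem_range (4 * s) \<Longrightarrow> 1 \<le> x \<and> x \<le> 8 * s" for x
    unfolding skolem_range_def by (simp split: if_splits)
  ultimately show ?thesis unfolding skolem_def
    by (intro exI[of _ ?ps] conjI ballI; (simp only: atLeastAtMost_iff)?; blast)
qed

text \<open>The lists give the differences \<open>2, ..., 4*s\<close> (even),
  \<open>2*s+1, ..., 4*s-1\<close> and \<open>3, ..., 2*s-3\<close> (odd), the single pairs
  \<open>1, 4*s+1, 2*s-1\<close>.\<close>

lemma ex_skolem_1:
  fixes s :: int
  assumes "2 \<le> s"
  shows "\<exists>ps. skolem (4 * s + 1) ps"
proof -
  let ?ps = "map (\<lambda>r. (4*s+r+1, 8*s-r+3)) [1..2*s] @ map (\<lambda>r. (r, 4*s-r+1)) [1..s] @ map (\<lambda>r. (s+r+2, 3*s-r+1)) [1..s-2]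
    @ [(s+1, s+2), (2*s+1, 6*s+2), (2*s+2, 4*s+1)]"
  have "length ?ps = nat (4 * s + 1)" using assms by simp
  moreover have "\<exists>(a, b)\<in>set ?ps. b = a + i" if "1 \<le> i" "i \<le> 4 * s + 1" for i
  proof -
    have "(\<exists>r. 1 \<le> r \<and> r \<le> 2*s \<and> 8*s-r+3 = 4*s+r+1 + i) \<or> (\<exists>r. 1 \<le> r \<and> r \<le> s \<and> 4*s-r+1 = r + i) \<or> (\<exists>r. 1 \<le> r \<and> r \<le> s-2 \<and> 3*s-r+1 = s+r+2 + i)
      \<or> s+2 = s+1 + i \<or> 6*s+2 = 2*s+1 + i \<or> 4*s+1 = 2*s+2 + i"
      using assms that by presburger
    then show ?thesis by (fastforce simp: bex_Un)
  qed
  moreover have "\<exists>(a, b)\<in>set ?ps. x = a \<or> x = b" if "1 \<le> x" "x \<le> 8 * s + 2" for x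
  proof -
    have "(4*s+2 \<le> x \<and> x \<le> 6*s+1 \<or> 6*s+3 \<le> x \<and> x \<le> 8*s+2)
      \<or> (1 \<le> x \<and> x \<le> s \<or> 3*s+1 \<le> x \<and> x \<le> 4*s)
      \<or> (s+3 \<le> x \<and> x \<le> 2*s \<or> 2*s+3 \<le> x \<and> x \<le> 3*s)
      \<or> x = s+1 \<or> x = s+2 \<or> x = 2*s+1 \<or> x = 6*s+2 \<or> x = 2*s+2 \<or> x = 4*s+1"
      using assms that by smt
    moreover have "\<exists>r. 1 \<le> r \<and> r \<le> 2*s \<and> (x = 4*s+r+1 \<or> x = 8*s-r+3)"
      if "4*s+2 \<le> x \<and> x \<le> 6*s+1 \<or> 6*s+3 \<le> x \<and> x \<le> 8*s+2" using that by presburger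
    moreover have "\<exists>r. 1 \<le> r \<and> r \<le> s \<and> (x = r \<or> x = 4*s-r+1)"
      if "1 \<le> x \<and> x \<le> s \<or> 3*s+1 \<le> x \<and> x \<le> 4*s" using that by presburger
    moreover have "\<exists>r. 1 \<le> r \<and> r \<le> s-2 \<and> (x = s+r+2 \<or> x = 3*s-r+1)"
      if "s+3 \<le> x \<and> x \<le> 2*s \<or> 2*s+3 \<le> x \<and> x \<le> 3*s" using that by presburger
    ultimately have "(\<exists>r. 1 \<le> r \<and> r \<le> 2*s \<and> (x = 4*s+r+1 \<or> x = 8*s-r+3))
      \<or> (\<exists>r. 1 \<le> r \<and> r \<le> s \<and> (x = r \<or> x = 4*s-r+1))
      \<or> (\<exists>r. 1 \<le> r \<and> r \<le> s-2 \<and> (x = s+r+2 \<or> x = 3*s-r+1))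
      \<or> x = s+1 \<or> x = s+2 \<or> x = 2*s+1 \<or> x = 6*s+2 \<or> x = 2*s+2 \<or> x = 4*s+1" by blast
    then show ?thesis by (fastforce simp: bex_Un)
  qed
  moreover have "x \<in> skolem_range (4 * s + 1) \<Longrightarrow> 1 \<le> x \<and> x \<le> 8 * s + 2" for x
    unfolding skolem_range_def by (simp split: if_splits)
  ultimately show ?thesis unfolding skolem_def
    by (intro exI[of _ ?ps] conjI ballI; (simp only: atLeastAtMost_iff)?; blast)
qed

text \<open>Hooked: the last position is \<open>8*s+5 = 2*c+1\<close>. The lists give the
  differences \<open>2, ..., 4*s\<close> (even), \<open>2*s+3, ..., 4*s-1\<close> and
  \<open>3, ..., 2*s-1\<close> (odd), the single pairs
  \<open>4*s+1, 2*s+1, 4*s+2, 1\<close>.\<close>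

lemma ex_skolem_2:
  fixes s :: int
  assumes "1 \<le> s"
  shows "\<exists>ps. skolem (4 * s + 2) ps"
proof -
  let ?ps = "map (\<lambda>r. (r, 4*s-r+2)) [1..2*s] @ map (\<lambda>r. (4*s+r+3, 8*s-r+4)) [1..s-1] @ map (\<lambda>r. (5*s+r+2, 7*s-r+3)) [1..s-1]
    @ [(2*s+1, 6*s+2), (4*s+2, 6*s+3), (4*s+3, 8*s+5), (7*s+3, 7*s+4)]"
  have "length ?ps = nat (4 * s + 2)" using assms by simp
  moreover have "\<exists>(a, b)\<in>set ?ps. b = a + i" if "1 \<le> i" "i \<le> 4 * s + 2" for i
  proof -
    have "(\<exists>r. 1 \<le> r \<and> r \<le> 2*s \<and> 4*s-r+2 = r + i) \<or> (\<exists>r. 1 \<le> r \<and> r \<le> s-1 \<and> 8*s-r+4 = 4*s+r+3 + i) \<or> (\<exists>r. 1 \<le> r \<and> r \<le> s-1 \<and> 7*s-r+3 = 5*s+r+2 + i)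
      \<or> 6*s+2 = 2*s+1 + i \<or> 6*s+3 = 4*s+2 + i \<or> 8*s+5 = 4*s+3 + i \<or> 7*s+4 = 7*s+3 + i"
      using assms that by presburger
    then show ?thesis by (fastforce simp: bex_Un)
  qed
  moreover have "\<exists>(a, b)\<in>set ?ps. x = a \<or> x = b" if "1 \<le> x" "(x < 8 * s + 4 \<or> x = 8 * s + 5)" for x
  proof -
    have "(1 \<le> x \<and> x \<le> 2*s \<or> 2*s+2 \<le> x \<and> x \<le> 4*s+1)
      \<or> (4*s+4 \<le> x \<and> x \<le> 5*s+2 \<or> 7*s+5 \<le> x \<and> x \<le> 8*s+3)
      \<or> (5*s+3 \<le> x \<and> x \<le> 6*s+1 \<or> 6*s+4 \<le> x \<and> x \<le> 7*s+2)
      \<or> x = 2*s+1 \<or> x = 6*s+2 \<or> x = 4*s+2 \<or> x = 6*s+3 \<or> x = 4*s+3 \<or> x = 8*s+5 \<or> x = 7*s+3 \<or> x = 7*s+4"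
      using assms that by smt
    moreover have "\<exists>r. 1 \<le> r \<and> r \<le> 2*s \<and> (x = r \<or> x = 4*s-r+2)"
      if "1 \<le> x \<and> x \<le> 2*s \<or> 2*s+2 \<le> x \<and> x \<le> 4*s+1" using that by presburger
    moreover have "\<exists>r. 1 \<le> r \<and> r \<le> s-1 \<and> (x = 4*s+r+3 \<or> x = 8*s-r+4)"
      if "4*s+4 \<le> x \<and> x \<le> 5*s+2 \<or> 7*s+5 \<le> x \<and> x \<le> 8*s+3" using that by presburger
    moreover have "\<exists>r. 1 \<le> r \<and> r \<le> s-1 \<and> (x = 5*s+r+2 \<or> x = 7*s-r+3)"
      if "5*s+3 \<le> x \<and> x \<le> 6*s+1 \<or> 6*s+4 \<le> x \<and> x \<le> 7*s+2" using that by presburger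
    ultimately have "(\<exists>r. 1 \<le> r \<and> r \<le> 2*s \<and> (x = r \<or> x = 4*s-r+2))
      \<or> (\<exists>r. 1 \<le> r \<and> r \<le> s-1 \<and> (x = 4*s+r+3 \<or> x = 8*s-r+4))
      \<or> (\<exists>r. 1 \<le> r \<and> r \<le> s-1 \<and> (x = 5*s+r+2 \<or> x = 7*s-r+3))
      \<or> x = 2*s+1 \<or> x = 6*s+2 \<or> x = 4*s+2 \<or> x = 6*s+3 \<or> x = 4*s+3 \<or> x = 8*s+5 \<or> x = 7*s+3 \<or> x = 7*s+4" by blast
    then show ?thesis by (fastforce simp: bex_Un)
  qed
  moreover have "x \<in> skolem_range (4 * s + 2) \<Longrightarrow> 1 \<le> x \<and> (x < 8 * s + 4 \<or> x = 8 * s + 5)" for x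
    unfolding skolem_range_def by (simp split: if_splits) presburger
  ultimately show ?thesis unfolding skolem_def
    by (intro exI[of _ ?ps] conjI ballI; (simp only: atLeastAtMost_iff)?; blast)
qed

text \<open>Hooked: the last position is \<open>8*s-1 = 2*c+1\<close>. The lists give the
  differences \<open>2, ..., 4*s-4\<close> (even), \<open>2*s+3, ..., 4*s-3\<close> and
  \<open>3, ..., 2*s-3\<close> (odd), the single pairs
  \<open>2*s+1, 1, 2*s-1, 4*s-2, 4*s-1\<close>.\<close>

lemma ex_skolem_3:
  fixes s :: int
  assumes "2 \<le> s"
  shows "\<exists>ps. skolem (4 * s - 1) ps"
proof -
  let ?ps = "map (\<lambda>r. (4*s+r, 8*s-r-2)) [1..2*s-2] @ map (\<lambda>r. (r, 4*s-r-1)) [1..s-2] @ map (\<lambda>r. (s+r+1, 3*s-r)) [1..s-2]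
    @ [(s-1, 3*s), (s, s+1), (2*s, 4*s-1), (2*s+1, 6*s-1), (4*s, 8*s-1)]"
  have "length ?ps = nat (4 * s - 1)" using assms by simp
  moreover have "\<exists>(a, b)\<in>set ?ps. b = a + i" if "1 \<le> i" "i \<le> 4 * s - 1" for i
  proof -
    have "(\<exists>r. 1 \<le> r \<and> r \<le> 2*s-2 \<and> 8*s-r-2 = 4*s+r + i) \<or> (\<exists>r. 1 \<le> r \<and> r \<le> s-2 \<and> 4*s-r-1 = r + i) \<or> (\<exists>r. 1 \<le> r \<and> r \<le> s-2 \<and> 3*s-r = s+r+1 + i)
      \<or> 3*s = s-1 + i \<or> s+1 = s + i \<or> 4*s-1 = 2*s + i \<or> 6*s-1 = 2*s+1 + i \<or> 8*s-1 = 4*s + i"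
      using assms that by presburger
    then show ?thesis by (fastforce simp: bex_Un)
  qed
  moreover have "\<exists>(a, b)\<in>set ?ps. x = a \<or> x = b" if "1 \<le> x" "(x < 8 * s - 2 \<or> x = 8 * s - 1)" for x
  proof -
    have "(4*s+1 \<le> x \<and> x \<le> 6*s-2 \<or> 6*s \<le> x \<and> x \<le> 8*s-3)
      \<or> (1 \<le> x \<and> x \<le> s-2 \<or> 3*s+1 \<le> x \<and> x \<le> 4*s-2)
      \<or> (s+2 \<le> x \<and> x \<le> 2*s-1 \<or> 2*s+2 \<le> x \<and> x \<le> 3*s-1)
      \<or> x = s-1 \<or> x = 3*s \<or> x = s \<or> x = s+1 \<or> x = 2*s \<or> x = 4*s-1 \<or> x = 2*s+1 \<or> x = 6*s-1 \<or> x = 4*s \<or> x = 8*s-1"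
      using assms that by smt
    moreover have "\<exists>r. 1 \<le> r \<and> r \<le> 2*s-2 \<and> (x = 4*s+r \<or> x = 8*s-r-2)"
      if "4*s+1 \<le> x \<and> x \<le> 6*s-2 \<or> 6*s \<le> x \<and> x \<le> 8*s-3" using that by presburger
    moreover have "\<exists>r. 1 \<le> r \<and> r \<le> s-2 \<and> (x = r \<or> x = 4*s-r-1)"
      if "1 \<le> x \<and> x \<le> s-2 \<or> 3*s+1 \<le> x \<and> x \<le> 4*s-2" using that by presburger
    moreover have "\<exists>r. 1 \<le> r \<and> r \<le> s-2 \<and> (x = s+r+1 \<or> x = 3*s-r)"
      if "s+2 \<le> x \<and> x \<le> 2*s-1 \<or> 2*s+2 \<le> x \<and> x \<le> 3*s-1" using that by presburger
    ultimately have "(\<exists>r. 1 \<le> r \<and> r \<le> 2*s-2 \<and> (x = 4*s+r \<or> x = 8*s-r-2))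
      \<or> (\<exists>r. 1 \<le> r \<and> r \<le> s-2 \<and> (x = r \<or> x = 4*s-r-1))
      \<or> (\<exists>r. 1 \<le> r \<and> r \<le> s-2 \<and> (x = s+r+1 \<or> x = 3*s-r))
      \<or> x = s-1 \<or> x = 3*s \<or> x = s \<or> x = s+1 \<or> x = 2*s \<or> x = 4*s-1 \<or> x = 2*s+1 \<or> x = 6*s-1 \<or> x = 4*s \<or> x = 8*s-1" by blast
    then show ?thesis by (fastforce simp: bex_Un)
  qed
  moreover have "x \<in> skolem_range (4 * s - 1) \<Longrightarrow> 1 \<le> x \<and> (x < 8 * s - 2 \<or> x = 8 * s - 1)" for x
    unfolding skolem_range_def by (simp split: if_splits) presburger
  ultimately show ?thesis unfolding skolem_def
    by (intro exI[of _ ?ps] conjI ballI; (simp only: atLeastAtMost_iff)?; blast)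
qed

lemma ex_skolem:
  assumes "1 \<le> c"
  shows "\<exists>ps. skolem c ps"
proof (cases "c \<le> 5")
  case True
  then show ?thesis using assms ex_skolem_small by blast
next
  case False
  have "c = 4 * (c div 4) \<or> c = 4 * (c div 4) + 1 \<or> c = 4 * (c div 4) + 2 \<or> c = 4 * (c div 4 + 1) - 1"
    by presburger
  moreover have "1 \<le> c div 4" "c \<noteq> 4 * (c div 4) + 2 \<and> c \<noteq> 4 * (c div 4 + 1) - 1 \<longrightarrow> 2 \<le> c div 4"
    using False by presburger+
  ultimately show ?thesis
    using ex_skolem_0[of "c div 4"] ex_skolem_1[of "c div 4"] ex_skolem_2[of "c div 4"]
      ex_skolem_3[of "c div 4 + 1"] by auto
qed



section \<open>From Skolem sequences to zero-sum covers\<close>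

text \<open>Modulo 4, \<open>3 * c\<close> is \<open>- c\<close>, so the two ranges have a hole for
  the same \<open>c\<close>, namely those congruent to 2 or 3.\<close>

lemma abs_range_3_skolem_range:
  assumes "x \<in> abs_range (3 * c)" "c < x"
  shows "int x - int c \<in> skolem_range (int c)"
proof -
  have "3 * c mod 4 = 3 * (c mod 4) mod 4" "int c mod 4 = int (c mod 4)"
    by (simp_all add: mod_mult_right_eq zmod_int)
  moreover have "c mod 4 = 0 \<or> c mod 4 = 1 \<or> c mod 4 = 2 \<or> c mod 4 = 3" by linarith
  ultimately show ?thesis using assms by (elim disjE) (simp_all add: abs_range_def skolem_range_def, linarith+)
qed

lemma skolem_cover_3:
  assumes "skolem (int c) ps" and "x \<in> abs_range (3 * c)"
  shows "\<exists>(a, b)\<in>set ps. int x = \<bar>b - a\<bar> \<or> int x = int c + a \<or> int x = int c + b"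
proof (cases "x \<le> c")
  case True
  then have "int x \<in> {1..int c}" using assms(2) by (auto simp: abs_range_def)
  then obtain a b where "(a, b) \<in> set ps" "b = a + int x"
    using assms(1) unfolding skolem_def by blast
  then show ?thesis by (intro bexI[of _ "(a, b)"]) auto
next
  case False
  then have "int x - int c \<in> skolem_range (int c)" using assms(2) by (intro abs_range_3_skolem_range) auto
  then obtain a b where "(a, b) \<in> set ps" "int x - int c = a \<or> int x - int c = b"
    using assms(1) unfolding skolem_def by blast
  then show ?thesis by (intro bexI[of _ "(a, b)"]) auto
qed

text \<open>The classical difference triples: a pair \<open>(a, b)\<close> yields
  \<open>(b - a) + (c + a) - (c + b) = 0\<close>, where the differences use up \<open>{1..c}\<close>
  and the shifted positions the numbers above \<open>c\<close>.\<close>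

lemma zero_sum_cover_3:
  assumes "0 < c"
  shows "zero_sum_cover 3 c (abs_range (3 * c))"
proof -
  obtain ps where ps: "skolem (int c) ps" using ex_skolem[of "int c"] assms by auto
  have len: "length ps = c" using ps by (simp add: skolem_def)
  define w where "w t j = (case ps ! t of (a, b) \<Rightarrow>
    if j = 0 then b - a else if j = 1 then int c + a else - (int c + b))" for t and j :: nat
  have "(\<Sum>j<3. w t j) = 0" for t
    by (simp add: w_def eval_nat_numeral split: prod.split)
  moreover have "\<exists>t<c. \<exists>j<3. \<bar>w t j\<bar> = int x" if x: "x \<in> abs_range (3 * c)" for x
  proof -
    obtain a b where ab: "(a, b) \<in> set ps" "int x = \<bar>b - a\<bar> \<or> int x = int c + a \<or> int x = int c + b"
      using skolem_cover_3[OF ps x] by blast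
    then obtain t where t: "t < c" "ps ! t = (a, b)" unfolding len[symmetric] by (metis in_set_conv_nth)
    then have "\<bar>w t 0\<bar> = int x \<or> \<bar>w t 1\<bar> = int x \<or> \<bar>w t 2\<bar> = int x"
      using ab(2) by (auto simp: w_def)
    then show ?thesis using t(1) by (metis numeral_2_eq_2 numeral_3_eq_3 One_nat_def lessI less_Suc_eq)
  qed
  ultimately show ?thesis unfolding zero_sum_cover_def by blast
qed

text \<open>Two arrays are joined side by side. This provides \<open>n = 6\<close>, which is not
  reached from 0, 3 and 5 by adding fours.\<close>

lemma zero_sum_cover_double:
  assumes "zero_sum_cover n (2 * c) H"
  shows "zero_sum_cover (2 * n) c H"
proof -
  obtain w :: "nat \<Rightarrow> nat \<Rightarrow> int" where w: "\<And>t. t < 2 * c \<Longrightarrow> (\<Sum>j<n. w t j) = 0"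
    "\<And>x. x \<in> H \<Longrightarrow> \<exists>t<2 * c. \<exists>j<n. \<bar>w t j\<bar> = int x"
    using assms unfolding zero_sum_cover_def by blast
  define w' where "w' t j = (if j < n then w (2 * t) j else w (2 * t + 1) (j - n))" for t j
  have "(\<Sum>j<2 * n. w' t j) = 0" if "t < c" for t
  proof -
    have "(\<Sum>j<2 * n. w' t j) = (\<Sum>j<n. w' t j) + (\<Sum>j\<in>{n..<n + n}. w' t j)"
      by (subst sum.union_disjoint[symmetric]) (auto intro: sum.cong)
    also have "(\<Sum>j\<in>{n..<n + n}. w' t j) = (\<Sum>j<n. w' t (n + j))"
      by (rule sum.reindex_bij_witness[of _ "\<lambda>j. n + j" "\<lambda>j. j - n"]) auto
    finally show ?thesis using w(1)[of "2 * t"] w(1)[of "2 * t + 1"] that by (simp add: w'_def)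
  qed
  moreover have "\<exists>t<c. \<exists>j<2 * n. \<bar>w' t j\<bar> = int x" if x: "x \<in> H" for x
  proof -
    obtain t j where tj: "t < 2 * c" "j < n" "\<bar>w t j\<bar> = int x" using w(2)[OF x] by blast
    show ?thesis
    proof (cases "even t")
      case True
      then show ?thesis using tj by (intro exI[of _ "t div 2"] conjI exI[of _ j]) (auto simp: w'_def)
    next
      case False
      then show ?thesis using tj by (intro exI[of _ "t div 2"] conjI exI[of _ "n + j"]) (auto simp: w'_def)
    qed
  qed
  ultimately show ?thesis unfolding zero_sum_cover_def by blast
qed

text \<open>In the triple of a Skolem pair with difference \<open>i\<close>, the entry
  \<open>i\<close> is replaced by three entries \<open>f i, g i, h i\<close> of the same sum. The
  positions still cover the part of \<open>abs_range (3 * c)\<close> above \<open>c\<close>, so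
  \<open>f, g, h\<close> have to cover only the rest.\<close>

lemma zero_sum_cover_5I:
  fixes f g h :: "int \<Rightarrow> int"
  assumes c: "0 < c" and sum: "\<And>i. f i + g i + h i = i"
    and cov: "\<And>x. x \<in> abs_range (5 * c) \<Longrightarrow> int x \<le> int c \<or> x \<notin> abs_range (3 * c) \<Longrightarrow>
      \<exists>i\<in>{1..int c}. int x = \<bar>f i\<bar> \<or> int x = \<bar>g i\<bar> \<or> int x = \<bar>h i\<bar>"
  shows "zero_sum_cover 5 c (abs_range (5 * c))"
proof -
  obtain ps where ps: "skolem (int c) ps" using ex_skolem[of "int c"] c by auto
  have len: "length ps = c" using ps by (simp add: skolem_def)
  define w where "w t j = (case ps ! t of (a, b) \<Rightarrow>
    if j = 0 then f (b - a) else if j = 1 then int c + a else if j = 2 then - (int c + b)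
    else if j = 3 then g (b - a) else h (b - a))" for t and j :: nat
  have "(\<Sum>j<5. w t j) = 0" for t
  proof -
    obtain a b where "ps ! t = (a, b)" by (cases "ps ! t")
    then show ?thesis using sum[of "b - a"] by (simp add: w_def eval_nat_numeral)
  qed
  moreover have "\<exists>t<c. \<exists>j<5. \<bar>w t j\<bar> = int x" if x: "x \<in> abs_range (5 * c)" for x
  proof -
    have "\<exists>(a, b)\<in>set ps. int x = \<bar>f (b - a)\<bar> \<or> int x = \<bar>g (b - a)\<bar> \<or> int x = \<bar>h (b - a)\<bar> \<or>
        int x = \<bar>int c + a\<bar> \<or> int x = \<bar>int c + b\<bar>"
    proof (cases "int x \<le> int c \<or> x \<notin> abs_range (3 * c)")
      case True
      then obtain i where i: "i \<in> {1..int c}" "int x = \<bar>f i\<bar> \<or> int x = \<bar>g i\<bar> \<or> int x = \<bar>h i\<bar>"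
        using cov[OF x] by blast
      then obtain a b where "(a, b) \<in> set ps" "b = a + i" using ps unfolding skolem_def by blast
      then show ?thesis using i(2) by (intro bexI[of _ "(a, b)"]) auto
    next
      case False
      then have "int x - int c \<in> skolem_range (int c)" by (intro abs_range_3_skolem_range) auto
      then obtain a b where "(a, b) \<in> set ps" "int x - int c = a \<or> int x - int c = b"
        using ps unfolding skolem_def by blast
      then show ?thesis by (intro bexI[of _ "(a, b)"]) auto
    qed
    then obtain a b where ab: "(a, b) \<in> set ps" "int x = \<bar>f (b - a)\<bar> \<or> int x = \<bar>g (b - a)\<bar> \<or>
        int x = \<bar>h (b - a)\<bar> \<or> int x = \<bar>int c + a\<bar> \<or> int x = \<bar>int c + b\<bar>" by blast
    then obtain t where t: "t < c" "ps ! t = (a, b)" unfolding len[symmetric] by (metis in_set_conv_nth)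
    then have "\<exists>j\<in>{0, 1, 2, 3, 4}. \<bar>w t j\<bar> = int x"
      using ab(2) by (auto simp: w_def)
    then obtain j where "j \<in> {0, 1, 2, 3, 4}" "\<bar>w t j\<bar> = int x" by blast
    then show ?thesis using t(1) by (intro exI[of _ t] conjI exI[of _ j]) auto
  qed
  ultimately show ?thesis unfolding zero_sum_cover_def by blast
qed

text \<open>For five summands the small element \<open>i\<close> of a Skolem triple is replaced by \<open>f i\<close>, where \<open>f\<close>
  permutes \<open>{1..c}\<close> up to sign, and a pair \<open>g i\<close>, \<open>h i\<close> with difference 1 or 2 makes up for it.\<close>

lemma zero_sum_cover_5:
  assumes "0 < c"
  shows "zero_sum_cover 5 c (abs_range (5 * c))"
proof (cases "c = 2")
  case True
  \<comment> \<open>The pattern for \<open>c\<close> congruent to 2 modulo 4 below needs the indices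
    1 to 4, so it starts at \<open>c = 6\<close>.\<close>
  define w :: "nat \<Rightarrow> nat \<Rightarrow> int" where "w t j = (if t = 0 then [1, -2, 3, 4, -6] ! j else [5, 7, 8, -9, -11] ! j)"
    for t j
  have "(\<Sum>j<5. w t j) = 0" for t
    by (simp add: w_def eval_nat_numeral)
  moreover have "\<exists>t<2. \<exists>j<5. \<bar>w t j\<bar> = int x" if "x \<in> abs_range 10" for x
  proof -
    have "x \<in> {1, 2, 3, 4, 6} \<or> x \<in> {5, 7, 8, 9, 11}" using that by (auto simp: abs_range_def)
    then have "(\<exists>j\<in>{0, 1, 2, 3, 4}. \<bar>w 0 j\<bar> = int x) \<or> (\<exists>j\<in>{0, 1, 2, 3, 4}. \<bar>w 1 j\<bar> = int x)"
      by (auto simp: w_def)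
    then show ?thesis
    proof (elim disjE bexE)
      fix j assume "j \<in> {0, 1, 2, 3, 4::nat}" "\<bar>w 0 j\<bar> = int x"
      then show ?thesis by (intro exI[of _ 0] conjI exI[of _ j]) auto
    next
      fix j assume "j \<in> {0, 1, 2, 3, 4::nat}" "\<bar>w 1 j\<bar> = int x"
      then show ?thesis by (intro exI[of _ 1] conjI exI[of _ j]) auto
    qed
  qed
  ultimately have "zero_sum_cover 5 2 (abs_range 10)" unfolding zero_sum_cover_def by blast
  then show ?thesis using True by simp
next
  case c2: False
  define C where "C = int c"
  have c: "0 < c" "C = int c" "0 < C" "C \<noteq> 2" using assms c2 by (auto simp: C_def)
  have mod: "C mod 4 = int (c mod 4)" "3 * c mod 4 = 3 * (c mod 4) mod 4" "5 * c mod 4 = c mod 4"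
    unfolding C_def by (simp_all add: mod_mult_right_eq zmod_int) presburger
  have cases4: "c mod 4 = 0 \<or> c mod 4 = 1 \<or> c mod 4 = 2 \<or> c mod 4 = 3" by linarith
  have range5: "x \<in> abs_range (5 * c) \<longleftrightarrow> 1 \<le> int x \<and>
      (if C mod 4 = 0 \<or> C mod 4 = 3 then int x \<le> 5 * C else int x < 5 * C \<or> int x = 5 * C + 1)" for x
    using cases4 by (elim disjE) (simp_all add: abs_range_def mod, simp_all add: C_def, linarith+)
  have range3: "x \<in> abs_range (3 * c) \<longleftrightarrow> 1 \<le> int x \<and>
      (if C mod 4 = 0 \<or> C mod 4 = 1 then int x \<le> 3 * C else int x < 3 * C \<or> int x = 3 * C + 1)" for x
    using cases4 by (elim disjE) (simp_all add: abs_range_def mod, simp_all add: C_def, linarith+)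
  define alt :: "int \<Rightarrow> int \<Rightarrow> int" where "alt i y = (if odd i then y else - y)" for i y
  have abs_alt: "\<bar>alt i y\<bar> = \<bar>y\<bar>" for i y by (simp add: alt_def)
  \<comment> \<open>Exchanging \<open>2 j - 1\<close> and \<open>2 j\<close> changes
    \<open>i\<close> by 1, upwards for odd \<open>i\<close> and downwards for even \<open>i\<close>;
    consecutive numbers \<open>y, y + 1\<close> with signs given by the parity of \<open>i\<close>
    compensate this.\<close>
  define swap :: "int \<Rightarrow> int" where "swap i = (if odd i then i + 1 else i - 1)" for i
  have swap: "swap i + alt i y + alt i (- (y + 1)) = i" for i y by (simp add: swap_def alt_def)
  have swap_swap: "swap (swap i) = i" for i by (simp add: swap_def)
  have half: "\<exists>i. X = 3 * C + 2 * i + 1 \<or> X = 3 * C + 2 * i + 2" for X by presburger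
  have "C mod 4 = 0 \<or> C mod 4 = 1 \<or> C mod 4 = 2 \<or> C mod 4 = 3" by presburger
  then consider "C mod 4 = 0" | "C mod 4 = 1" | "C mod 4 = 2" | "C mod 4 = 3" by blast
  then show ?thesis
  proof cases
    case 1
    \<comment> \<open>Neither range has a hole, and \<open>3 * C + 1, ..., 5 * C\<close> is cut into
      consecutive pairs.\<close>
    define y where "y i = 3 * C + 2 * i - 1" for i
    show ?thesis
    proof (rule zero_sum_cover_5I[where f = swap and g = "\<lambda>i. alt i (y i)" and h = "\<lambda>i. alt i (- (y i + 1))", OF c(1)])
      fix x assume x: "x \<in> abs_range (5 * c)" "int x \<le> int c \<or> x \<notin> abs_range (3 * c)"
      define X where "X = int x"
      have X: "1 \<le> X" "X \<le> 5 * C" "X \<le> C \<or> 3 * C < X"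
        using x 1 unfolding range5 range3 X_def C_def by auto
      show "\<exists>i\<in>{1..int c}. int x = \<bar>swap i\<bar> \<or> int x = \<bar>alt i (y i)\<bar> \<or> int x = \<bar>alt i (- (y i + 1))\<bar>"
        unfolding X_def[symmetric] C_def[symmetric] abs_alt
      proof (cases "X \<le> C")
        case True
        have "1 \<le> swap X \<and> swap X \<le> C" unfolding swap_def using X(1) True 1 by presburger
        then show "\<exists>i\<in>{1..C}. X = \<bar>swap i\<bar> \<or> X = \<bar>y i\<bar> \<or> X = \<bar>- (y i + 1)\<bar>"
          using X(1) by (intro bexI[of _ "swap X"]) (auto simp: swap_swap)
      next
        case False
        obtain i where "X = 3 * C + 2 * i + 1 \<or> X = 3 * C + 2 * i + 2" using half by blast
        then show "\<exists>i\<in>{1..C}. X = \<bar>swap i\<bar> \<or> X = \<bar>y i\<bar> \<or> X = \<bar>- (y i + 1)\<bar>"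
          using X False c by (intro bexI[of _ "i + 1"]) (auto simp: y_def)
      qed
    qed (rule swap)
  next
    case 2
    \<comment> \<open>\<open>C\<close> is odd, so 1 is left without a partner. It is negated, and
      the pair \<open>5 * C - 1, 5 * C + 1\<close> around the hole of the large range makes up the
      difference 2. The exchange acts on the pairs \<open>(2, 3), (4, 5), ...\<close>.\<close>
    define y where "y i = 3 * C + 2 * i - 3" for i
    define f where "f i = (if i = 1 then - 1 else swap (i - 1) + 1)" for i
    define g where "g i = (if i = 1 then - (5 * C - 1) else alt (i - 1) (y i))" for i
    define h where "h i = (if i = 1 then 5 * C + 1 else alt (i - 1) (- (y i + 1)))" for i
    show ?thesis
    proof (rule zero_sum_cover_5I[where f = f and g = g and h = h, OF c(1)])
      show "f i + g i + h i = i" for i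
        using swap[of "i - 1" "y i"] by (simp add: f_def g_def h_def)
      fix x assume x: "x \<in> abs_range (5 * c)" "int x \<le> int c \<or> x \<notin> abs_range (3 * c)"
      define X where "X = int x"
      have X: "1 \<le> X" "X < 5 * C \<or> X = 5 * C + 1" "X \<le> C \<or> 3 * C < X"
        using x 2 unfolding range5 range3 X_def C_def by (auto split: if_splits)
      show "\<exists>i\<in>{1..int c}. int x = \<bar>f i\<bar> \<or> int x = \<bar>g i\<bar> \<or> int x = \<bar>h i\<bar>"
        unfolding X_def[symmetric] C_def[symmetric]
      proof -
        consider "X = 1 \<or> X = 5 * C - 1 \<or> X = 5 * C + 1" | "2 \<le> X" "X \<le> C" | "3 * C < X" "X < 5 * C - 1"
          using X by linarith
        then show "\<exists>i\<in>{1..C}. X = \<bar>f i\<bar> \<or> X = \<bar>g i\<bar> \<or> X = \<bar>h i\<bar>"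
        proof cases
          case 1
          then show ?thesis using c by (intro bexI[of _ 1]) (auto simp: f_def g_def h_def)
        next
          case r: 2
          have "2 \<le> swap (X - 1) + 1 \<and> swap (X - 1) + 1 \<le> C" unfolding swap_def using r 2 by presburger
          then show ?thesis using r by (intro bexI[of _ "swap (X - 1) + 1"]) (auto simp: f_def swap_swap)
        next
          case 3
          obtain i where "X = 3 * C + 2 * i + 1 \<or> X = 3 * C + 2 * i + 2" using half by blast
          then show ?thesis
            using 3 c by (intro bexI[of _ "i + 2"]) (auto simp: g_def h_def y_def abs_alt)
        qed
      qed
    qed
  next
    case 3
    \<comment> \<open>Both ranges have a hole, which leaves two pairs of difference 2:
      \<open>3 * C, 3 * C + 2\<close> and \<open>5 * C - 1, 5 * C + 1\<close>. They go to
      \<open>1 \<mapsto> -1\<close> and \<open>4 \<mapsto> 2\<close>; the assignments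
      \<open>2 \<mapsto> 3\<close>, \<open>3 \<mapsto> 4\<close> complete a signed permutation of
      \<open>{1..4}\<close>.\<close>
    define y where "y i = (if i = 2 \<or> i = 3 then 3 * C + 2 * i - 1 else 3 * C + 2 * i - 3)" for i
    define f where "f i = (if i = 1 then - 1 else if i = 4 then 2 else if i = 2 \<or> i = 3 then i + 1 else swap i)" for i
    define g where "g i = (if i = 1 then - (3 * C) else if i = 4 then - (5 * C - 1)
      else if i = 2 \<or> i = 3 then y i else alt i (y i))" for i
    define h where "h i = (if i = 1 then 3 * C + 2 else if i = 4 then 5 * C + 1
      else if i = 2 \<or> i = 3 then - (y i + 1) else alt i (- (y i + 1)))" for i
    have C6: "6 \<le> C" using c 3 by presburger
    show ?thesis
    proof (rule zero_sum_cover_5I[where f = f and g = g and h = h, OF c(1)])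
      show "f i + g i + h i = i" for i
        using swap[of i "y i"] by (simp add: f_def g_def h_def)
      fix x assume x: "x \<in> abs_range (5 * c)" "int x \<le> int c \<or> x \<notin> abs_range (3 * c)"
      define X where "X = int x"
      have X: "1 \<le> X" "X < 5 * C \<or> X = 5 * C + 1" "X \<le> C \<or> X = 3 * C \<or> 3 * C + 2 \<le> X"
        using x 3 unfolding range5 range3 X_def C_def by (auto split: if_splits)
      show "\<exists>i\<in>{1..int c}. int x = \<bar>f i\<bar> \<or> int x = \<bar>g i\<bar> \<or> int x = \<bar>h i\<bar>"
        unfolding X_def[symmetric] C_def[symmetric]
      proof -
        have "(X = 1 \<or> X = 3 * C \<or> X = 3 * C + 2) \<or> (X = 2 \<or> X = 5 * C - 1 \<or> X = 5 * C + 1)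
          \<or> (X = 3 \<or> X = 3 * C + 3 \<or> X = 3 * C + 4) \<or> (X = 4 \<or> X = 3 * C + 5 \<or> X = 3 * C + 6)
          \<or> (5 \<le> X \<and> X \<le> C) \<or> (3 * C + 6 < X \<and> X < 5 * C - 1)"
          using X by smt
        then consider "X = 1 \<or> X = 3 * C \<or> X = 3 * C + 2" | "X = 2 \<or> X = 5 * C - 1 \<or> X = 5 * C + 1"
          | "X = 3 \<or> X = 3 * C + 3 \<or> X = 3 * C + 4" | "X = 4 \<or> X = 3 * C + 5 \<or> X = 3 * C + 6"
          | "5 \<le> X" "X \<le> C" | "3 * C + 6 < X" "X < 5 * C - 1"
          by blast
        then show "\<exists>i\<in>{1..C}. X = \<bar>f i\<bar> \<or> X = \<bar>g i\<bar> \<or> X = \<bar>h i\<bar>"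
        proof cases
          case 1
          then show ?thesis using C6 by (intro bexI[of _ 1]) (auto simp: f_def g_def h_def)
        next
          case 2
          then show ?thesis using C6 by (intro bexI[of _ 4]) (auto simp: f_def g_def h_def)
        next
          case 3
          then show ?thesis using C6 by (intro bexI[of _ 2]) (auto simp: f_def g_def h_def y_def)
        next
          case 4
          then show ?thesis using C6 by (intro bexI[of _ 3]) (auto simp: f_def g_def h_def y_def)
        next
          case r: 5
          have "5 \<le> swap X \<and> swap X \<le> C" unfolding swap_def using r 3 by presburger
          then show ?thesis using r by (intro bexI[of _ "swap X"]) (auto simp: f_def swap_swap)
        next
          case r: 6
          obtain i where "X = 3 * C + 2 * i + 1 \<or> X = 3 * C + 2 * i + 2" using half by blast
          then show ?thesis
            using r by (intro bexI[of _ "i + 2"]) (auto simp: g_def h_def y_def abs_alt)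
        qed
      qed
    qed
  next
    case 4
    \<comment> \<open>Only the small range has a hole; its pair \<open>3 * C, 3 * C + 2\<close> of
      difference 2 serves the unpaired 1, which is negated.\<close>
    define y where "y i = 3 * C + 2 * i - 1" for i
    define f where "f i = (if i = 1 then - 1 else swap (i - 1) + 1)" for i
    define g where "g i = (if i = 1 then - (3 * C) else alt (i - 1) (y i))" for i
    define h where "h i = (if i = 1 then 3 * C + 2 else alt (i - 1) (- (y i + 1)))" for i
    show ?thesis
    proof (rule zero_sum_cover_5I[where f = f and g = g and h = h, OF c(1)])
      show "f i + g i + h i = i" for i
        using swap[of "i - 1" "y i"] by (simp add: f_def g_def h_def)
      fix x assume x: "x \<in> abs_range (5 * c)" "int x \<le> int c \<or> x \<notin> abs_range (3 * c)"
      define X where "X = int x"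
      have X: "1 \<le> X" "X \<le> 5 * C" "X \<le> C \<or> X = 3 * C \<or> 3 * C + 2 \<le> X"
        using x 4 unfolding range5 range3 X_def C_def by (auto split: if_splits)
      show "\<exists>i\<in>{1..int c}. int x = \<bar>f i\<bar> \<or> int x = \<bar>g i\<bar> \<or> int x = \<bar>h i\<bar>"
        unfolding X_def[symmetric] C_def[symmetric]
      proof -
        consider "X = 1 \<or> X = 3 * C \<or> X = 3 * C + 2" | "2 \<le> X" "X \<le> C" | "3 * C + 3 \<le> X" "X \<le> 5 * C"
          using X by linarith
        then show "\<exists>i\<in>{1..C}. X = \<bar>f i\<bar> \<or> X = \<bar>g i\<bar> \<or> X = \<bar>h i\<bar>"
        proof cases
          case 1
          then show ?thesis using c by (intro bexI[of _ 1]) (auto simp: f_def g_def h_def)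
        next
          case r: 2
          have "2 \<le> swap (X - 1) + 1 \<and> swap (X - 1) + 1 \<le> C" unfolding swap_def using r 4 by presburger
          then show ?thesis using r by (intro bexI[of _ "swap (X - 1) + 1"]) (auto simp: f_def swap_swap)
        next
          case 3
          obtain i where "X = 3 * C + 2 * i + 1 \<or> X = 3 * C + 2 * i + 2" using half by blast
          then show ?thesis
            using 3 c by (intro bexI[of _ "i + 1"]) (auto simp: g_def h_def y_def abs_alt)
        qed
      qed
    qed
  qed
qed

text \<open>Adding fours to the seeds 0, 3, 5, 6 reaches every number except 1 and 2.\<close>

lemma zero_sum_cover:
  assumes "3 \<le> n" "0 < c"
  shows "zero_sum_cover n c (abs_range (n * c))"
proof -
  have "zero_sum_cover n c (abs_range (n * c))" if "n = 0 \<or> 3 \<le> n" for n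
    using that
  proof (induction n rule: less_induct)
    case (less n)
    have "n = 0 \<or> n = 3 \<or> n = 5 \<or> n = 6 \<or> n = n - 4 + 4 \<and> n - 4 < n \<and> (n - 4 = 0 \<or> 3 \<le> n - 4)"
      using less.prems by presburger
    then consider "n = 0" | "n = 3" | "n = 5" | "n = 6"
      | k where "n = k + 4" "k < n" "k = 0 \<or> 3 \<le> k" by blast
    then show ?case
    proof cases
      case 1
      then show ?thesis by (simp add: zero_sum_cover_def abs_range_def)
    next
      case 2
      then show ?thesis using zero_sum_cover_3 assms(2) by simp
    next
      case 3
      then show ?thesis using zero_sum_cover_5 assms(2) by simp
    next
      case 4
      then show ?thesis using zero_sum_cover_double[OF zero_sum_cover_3[of "2 * c"]] assms(2) by simp
    next
      case (5 k)
      then show ?thesis using zero_sum_cover_add4[OF less.IH[of k]] by simp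
    qed
  qed
  then show ?thesis using assms by blast
qed

section \<open>Two-rowed arrays over cyclic groups\<close>

lemma nonzero_integer_mod_group: "0 < N \<Longrightarrow> nonzero (integer_mod_group N) = {1..<int N}"
  by (auto simp: nonzero_def carrier_integer_mod_group)

lemma exists_MS0_two_rows:
  assumes "3 \<le> n" "0 < c"
  shows "exists_MS0 (integer_mod_group (2 * n * c + 1)) (nonzero (integer_mod_group (2 * n * c + 1))) 2 n n 2 c"
proof -
  define N where "N = 2 * n * c + 1"
  let ?G = "integer_mod_group N"
  interpret G: comm_group ?G by (rule abelian_integer_mod_group)
  obtain w :: "nat \<Rightarrow> nat \<Rightarrow> int" where w: "\<And>t. t < c \<Longrightarrow> (\<Sum>j<n. w t j) = 0"
    "\<And>x. x \<in> abs_range (n * c) \<Longrightarrow> \<exists>t<c. \<exists>j<n. \<bar>w t j\<bar> = int x"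
    using zero_sum_cover[OF assms] unfolding zero_sum_cover_def by blast
  have N0: "0 < N" by (simp add: N_def)
  have in_G: "x mod int N \<in> carrier ?G" for x using N0 by (simp add: carrier_integer_mod_group)
  have card: "card (nonzero ?G) = 2 * n * c" 
    unfolding nonzero_integer_mod_group[OF N0] by (simp add: N_def del: of_nat_mult)
  have "3 * 1 \<le> n * c" using assms by (intro mult_le_mono) auto
  then have "1 < 2 * n * c" by linarith
  with card have "exists_MS0 ?G (nonzero ?G) 2 n n 2 c"
  proof (intro exists_MS0_half_systems[where w = "\<lambda>t j. w t j mod int N"])
    show "(\<Otimes>\<^bsub>?G\<^esub>j\<in>{..<n}. w t j mod int N) = \<one>\<^bsub>?G\<^esub>" if "t < c" for t
      by (subst G.finprod_hom_sum[where \<phi> = "\<lambda>x. x mod int N"]) (use in_G w(1)[OF that] in \<open>auto simp: mod_simps\<close>)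
    fix x assume "x \<in> nonzero ?G"
    then have x: "1 \<le> x" "x < int N" by (auto simp: nonzero_integer_mod_group[OF N0])
    \<comment> \<open>One of \<open>x\<close> and \<open>N - x\<close> is at most
      \<open>n * c\<close>; in the shape with a hole, the value \<open>n * c\<close> is represented
      by its negative \<open>n * c + 1\<close>.\<close>
    have "nat x \<in> abs_range (n * c) \<or> nat (int N - x) \<in> abs_range (n * c)"
    proof -
      have "nat x \<in> abs_range L \<or> nat (int N - x) \<in> abs_range L" if "int N = 2 * int L + 1" for L
        using that x unfolding abs_range_def by (auto split: if_splits)
      then show ?thesis by (simp add: N_def)
    qed
    then obtain t j where tj: "t < c" "j < n" "\<bar>w t j\<bar> = x \<or> \<bar>w t j\<bar> = int N - x"
      using w(2) x by (metis int_nat_eq less_imp_le diff_ge_0_iff_ge order_trans zero_le_one)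
    have "w t j = x \<or> - w t j = x \<or> - w t j = x - int N \<or> w t j = x - int N" using tj(3) by linarith
    moreover have "x mod int N = x" "(x - int N) mod int N = x"
      using x by (simp_all flip: mod_diff_right_eq)
    ultimately have "x = w t j mod int N \<or> x = (- w t j) mod int N" by metis
    moreover have "inv\<^bsub>?G\<^esub> (w t j mod int N) = (- w t j) mod int N"
      using in_G by (simp add: mod_minus_eq)
    ultimately show "\<exists>t<c. \<exists>j<n. x = w t j mod int N \<or> x = inv\<^bsub>?G\<^esub> (w t j mod int N)"
      using tj(1,2) by metis
  qed (use in_G in auto)
  then show ?thesis by (simp add: N_def)
qed


section \<open>Groups with several involutions\<close>

text \<open>Classes are removed one at a time. Numbering the representatives is what later allows
  quadruples to be dealt out to positions by arithmetic on indices.\<close>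

lemma uniform_partition:
  assumes "finite S" "\<And>x. x \<in> S \<Longrightarrow> x \<in> orb x \<and> orb x \<subseteq> S \<and> card (orb x) = q"
    "\<And>x y. x \<in> S \<Longrightarrow> y \<in> orb x \<Longrightarrow> orb y = orb x"
  shows "\<exists>N X. card S = q * N \<and> (\<forall>i<N. X i \<in> S) \<and> (\<forall>i<N. \<forall>j<N. i \<noteq> j \<longrightarrow> orb (X i) \<inter> orb (X j) = {})
    \<and> (\<forall>x\<in>S. \<exists>i<N::nat. x \<in> orb (X i))"
  using assms
proof (induction S rule: finite_psubset_induct)
  case (psubset S)
  show ?case
  proof (cases "S = {}")
    case True
    then show ?thesis by (intro exI[of _ 0]) auto
  next
    case False
    then obtain x where x: "x \<in> S" by blast
    define S' where "S' = S - orb x"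
    have orbx: "x \<in> orb x" "orb x \<subseteq> S" "card (orb x) = q" using psubset.prems(1)[OF x] by auto
    have sub: "S' \<subset> S" using x orbx by (auto simp: S'_def)
    have S'orb: "y \<in> orb y \<and> orb y \<subseteq> S' \<and> card (orb y) = q" if y: "y \<in> S'" for y
    proof -
      have "z \<notin> orb x" if z: "z \<in> orb y" for z
      proof
        assume "z \<in> orb x"
        then have "orb z = orb x" using psubset.prems(2)[OF x] by blast
        moreover have "orb z = orb y" using psubset.prems(2)[of y z] y z by (simp add: S'_def)
        ultimately have "orb y = orb x" by simp
        then show False using y psubset.prems(1)[of y] by (auto simp: S'_def)
      qed
      then show ?thesis using psubset.prems(1)[of y] y by (auto simp: S'_def)
    qed
    have S'eq: "orb y = orb z" if "z \<in> S'" "y \<in> orb z" for y z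
      using psubset.prems(2)[of z y] that by (auto simp: S'_def)
    obtain N X where NX: "card S' = q * N" "\<forall>i<N. X i \<in> S'"
      "\<forall>i<N. \<forall>j<N. i \<noteq> j \<longrightarrow> orb (X i) \<inter> orb (X j) = {}" "\<forall>y\<in>S'. \<exists>i<N::nat. y \<in> orb (X i)"
      using psubset.IH[OF sub S'orb S'eq] by blast
    have "card S = card S' + card (orb x)"
      using card_Diff_subset[of "orb x" S] orbx psubset.hyps(1) card_mono[of S "orb x"] finite_subset[of "orb x" S]
      by (simp add: S'_def)
    then have "card S = q * Suc N" using NX(1) orbx by simp
    moreover have "orb x \<inter> orb y = {} \<and> orb y \<inter> orb x = {}" if "y \<in> S'" for y
      using S'orb[OF that] by (auto simp: S'_def)
    moreover have "\<exists>i<Suc N. y \<in> orb ((X(N := x)) i)" if yS: "y \<in> S" for y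
    proof (cases "y \<in> orb x")
      case True
      then show ?thesis by (intro exI[of _ N]) simp
    next
      case False
      then obtain i where "i < N" "y \<in> orb (X i)" using NX(4) yS by (auto simp: S'_def)
      then show ?thesis by (intro exI[of _ i]) auto
    qed
    moreover have "X i \<in> S" if "i < N" for i using NX(2) that by (auto simp: S'_def)
    ultimately show ?thesis
      using NX(2,3) x by (intro exI[of _ "Suc N"] exI[of _ "X(N := x)"] conjI) (auto simp: less_Suc_eq)
  qed
qed

text \<open>The square with rows \<open>(x, r/x)\<close> and \<open>(g/x, x r g)\<close>. Its cells are numbered 1, 3, 0, 2 in reading
  order, after the diagonals of the large array on which they will lie.\<close>

definition quad :: "('a, 'b) monoid_scheme \<Rightarrow> 'a \<Rightarrow> 'a \<Rightarrow> 'a \<Rightarrow> nat \<Rightarrow> 'a" where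
  "quad G r g x \<epsilon> = (if \<epsilon> = 1 then x else if \<epsilon> = 3 then r \<otimes>\<^bsub>G\<^esub> inv\<^bsub>G\<^esub> x
     else if \<epsilon> = 0 then g \<otimes>\<^bsub>G\<^esub> inv\<^bsub>G\<^esub> x else x \<otimes>\<^bsub>G\<^esub> (r \<otimes>\<^bsub>G\<^esub> g))"

context comm_group
begin

lemma self_inverse:
  assumes "r \<in> carrier G" "r \<otimes> r = \<one>"
  shows "inv r = r" "\<And>z. z \<in> carrier G \<Longrightarrow> r \<otimes> (r \<otimes> z) = z"
  using assms by (simp_all add: inv_equality flip: m_assoc)

lemma mult_inv_cancel: "x \<in> carrier G \<Longrightarrow> z \<in> carrier G \<Longrightarrow> x \<otimes> (inv x \<otimes> z) = z"
  "x \<in> carrier G \<Longrightarrow> z \<in> carrier G \<Longrightarrow> inv x \<otimes> (x \<otimes> z) = z"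
  by (simp_all flip: m_assoc)

lemma mult_inv_eq_iff:
  assumes "a \<in> carrier G" "b \<in> carrier G" "x \<in> carrier G"
  shows "a \<otimes> inv x = b \<longleftrightarrow> a = b \<otimes> x"
  using assms by (auto simp: m_assoc)

lemma quad_closed: "r \<in> carrier G \<Longrightarrow> g \<in> carrier G \<Longrightarrow> x \<in> carrier G \<Longrightarrow> quad G r g x \<epsilon> \<in> carrier G"
  by (simp add: quad_def)

lemma quad_products:
  assumes "r \<in> carrier G" "g \<in> carrier G" "x \<in> carrier G" "r \<otimes> r = \<one>" "g \<otimes> g = \<one>"
  shows "quad G r g x 1 \<otimes> quad G r g x 3 = r" "quad G r g x 0 \<otimes> quad G r g x 2 = r"
    "quad G r g x 0 \<otimes> quad G r g x 1 = g" "quad G r g x 2 \<otimes> quad G r g x 3 = g"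
  using assms by (simp_all add: quad_def m_ac self_inverse mult_inv_cancel)

text \<open>The commuting involutions \<open>x \<mapsto> r/x\<close> and
  \<open>x \<mapsto> g/x\<close> generate a Klein four-group, whose orbits are the quadruples. A
  fixed point of one of them would be a square root of \<open>r\<close> or \<open>g\<close>, and
  \<open>r \<noteq> g\<close> excludes fixed points of their composite
  \<open>x \<mapsto> x r g\<close>; so all orbits have size 4.\<close>

lemma quad_cover:
  assumes S: "S \<subseteq> carrier G" "finite S" and rg: "r \<in> carrier G" "g \<in> carrier G" "r \<otimes> r = \<one>" "g \<otimes> g = \<one>" "r \<noteq> g"
    and closed: "\<And>x. x \<in> S \<Longrightarrow> r \<otimes> inv x \<in> S \<and> g \<otimes> inv x \<in> S"
    and free: "\<And>x. x \<in> S \<Longrightarrow> x \<otimes> x \<noteq> r \<and> x \<otimes> x \<noteq> g"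
  shows "\<exists>N X. card S = 4 * N \<and> (\<forall>i<N. X i \<in> S) \<and> (\<forall>x\<in>S. \<exists>i<N. \<exists>\<epsilon><4. x = quad G r g (X i) \<epsilon>)"
proof -
  define orb where "orb x = {x, r \<otimes> inv x, g \<otimes> inv x, x \<otimes> (r \<otimes> g)}" for x
  note ac = m_ac inv_mult self_inverse[OF rg(1,3)] self_inverse[OF rg(2,4)] mult_inv_cancel rg
  have S_in: "x \<in> carrier G" if "x \<in> S" for x using S that by blast
  have prod: "x \<otimes> (r \<otimes> g) \<in> S" if "x \<in> S" for x
  proof -
    have "r \<otimes> inv (g \<otimes> inv x) \<in> S" using closed that by blast
    then show ?thesis using S_in[OF that] by (simp add: ac)
  qed
  have orb_eq: "orb y = orb x" if x: "x \<in> S" and y: "y \<in> orb x" for x y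
  proof -
    note xc = S_in[OF x]
    consider "y = x" | "y = r \<otimes> inv x" | "y = g \<otimes> inv x" | "y = x \<otimes> (r \<otimes> g)"
      using y by (auto simp: orb_def)
    then show ?thesis
      by cases (use xc in \<open>simp_all add: orb_def ac insert_commute\<close>)
  qed
  have card: "card (orb x) = 4" if x: "x \<in> S" for x
  proof -
    note xc = S_in[OF x]
    have "r \<otimes> g \<noteq> \<one>"
    proof
      assume "r \<otimes> g = \<one>"
      then have "r \<otimes> (r \<otimes> g) = r" using rg by simp
      then show False using rg by (simp add: self_inverse[OF rg(1,3)])
    qed
    then have "x \<noteq> x \<otimes> (r \<otimes> g)" using xc rg by simp
    moreover have "r \<otimes> inv x \<noteq> x" "g \<otimes> inv x \<noteq> x"
      using free[OF x] xc rg by (auto simp: mult_inv_eq_iff)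
    moreover have "r \<otimes> inv x \<noteq> g \<otimes> inv x" using xc rg by simp
    moreover have "r \<otimes> inv x \<noteq> x \<otimes> (r \<otimes> g)"
    proof
      assume "r \<otimes> inv x = x \<otimes> (r \<otimes> g)"
      then have "r \<otimes> (r \<otimes> inv x) = r \<otimes> (x \<otimes> (r \<otimes> g))" by simp
      then have "inv x = x \<otimes> g" using xc by (simp add: ac)
      then have "x \<otimes> inv x \<otimes> g = x \<otimes> (x \<otimes> g) \<otimes> g" by simp
      then have "g = x \<otimes> x" using xc by (simp add: ac)
      then show False using free[OF x] by simp
    qed
    moreover have "g \<otimes> inv x \<noteq> x \<otimes> (r \<otimes> g)"
    proof
      assume "g \<otimes> inv x = x \<otimes> (r \<otimes> g)"
      then have "g \<otimes> (g \<otimes> inv x) = g \<otimes> (x \<otimes> (r \<otimes> g))" by simp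
      then have "inv x = x \<otimes> r" using xc by (simp add: ac)
      then have "x \<otimes> inv x \<otimes> r = x \<otimes> (x \<otimes> r) \<otimes> r" by simp
      then have "r = x \<otimes> x" using xc by (simp add: ac)
      then show False using free[OF x] by simp
    qed
    ultimately show ?thesis by (auto simp: orb_def)
  qed
  have "\<exists>N X. card S = 4 * N \<and> (\<forall>i<N. X i \<in> S) \<and> (\<forall>i<N. \<forall>j<N. i \<noteq> j \<longrightarrow> orb (X i) \<inter> orb (X j) = {})
      \<and> (\<forall>x\<in>S. \<exists>i<N::nat. x \<in> orb (X i))"
  proof (rule uniform_partition[OF S(2)])
    show "x \<in> orb x \<and> orb x \<subseteq> S \<and> card (orb x) = 4" if "x \<in> S" for x
    proof (intro conjI)
      show "orb x \<subseteq> S" using closed[OF that] prod[OF that] that unfolding orb_def by blast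
    qed (use card[OF that] in \<open>simp_all add: orb_def\<close>)
  qed (rule orb_eq)
  then obtain N X where NX: "card S = 4 * N" "\<forall>i<N. X i \<in> S" "\<forall>x\<in>S. \<exists>i<N::nat. x \<in> orb (X i)" by blast
  have "\<exists>\<epsilon><4. x = quad G r g y \<epsilon>" if "x \<in> orb y" for x y
  proof -
    have "\<exists>\<epsilon>\<in>{0, 1, 2, 3}. x = quad G r g y \<epsilon>" using that by (auto simp: orb_def quad_def)
    then obtain \<epsilon> where "\<epsilon> \<in> {0, 1, 2, 3}" "x = quad G r g y \<epsilon>" by blast
    then show ?thesis by (intro exI[of _ \<epsilon>]) auto
  qed
  then show ?thesis using NX by (intro exI[of _ N] exI[of _ X]) blast
qed

lemma finprod_blocks4:
  fixes d :: nat
  assumes "h \<in> {..<4 * d} \<rightarrow> carrier G"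
  shows "finprod G h {..<4 * d} = (\<Otimes>r\<in>{..<d}. (h (4 * r) \<otimes> h (4 * r + 1)) \<otimes> (h (4 * r + 2) \<otimes> h (4 * r + 3)))"
  using assms
proof (induction d)
  case (Suc d)
  have "{..<4 * Suc d} = insert (4 * d + 3) (insert (4 * d + 2) (insert (4 * d + 1) (insert (4 * d) {..<4 * d})))"
    by auto
  then show ?case using Suc by (simp add: lessThan_Suc Pi_def m_ac)
qed simp

end

section \<open>Spreading quadruples over arrays\<close>

text \<open>Quadruple \<open>(t, i)\<close> occupies rows \<open>i\<close> and \<open>i + 1\<close>
  on the four diagonals of block \<open>t\<close>. In each block a row meets the cells 1, 3 of one
  quadruple and 0, 2 of its predecessor, which gives \<open>r t\<close> twice; a column meets cells
  0, 1 of one and 2, 3 of another, which gives \<open>g t\<close> twice. The type is therefore free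
  to change between blocks, but not inside one.\<close>

lemma exists_MS0_quad_diagonals:
  fixes y :: "nat \<Rightarrow> nat \<Rightarrow> nat \<Rightarrow> 'a"
  assumes G: "comm_group G" and ord: "order G = F * e * (4 * d)" and de: "4 * d \<le> e" and pos: "0 < F" "0 < d"
    and y: "\<And>t i \<epsilon>. t < F * d \<Longrightarrow> i < e \<Longrightarrow> \<epsilon> < 4 \<Longrightarrow> y t i \<epsilon> \<in> carrier G"
    and cover: "\<And>x. x \<in> carrier G \<Longrightarrow> \<exists>t<F * d. \<exists>i<e. \<exists>\<epsilon><4. x = y t i \<epsilon>"
    and row: "\<And>t i. t < F * d \<Longrightarrow> i < e \<Longrightarrow> y t i 1 \<otimes>\<^bsub>G\<^esub> y t i 3 = r t \<and> y t i 0 \<otimes>\<^bsub>G\<^esub> y t i 2 = r t"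
    and col: "\<And>t i. t < F * d \<Longrightarrow> i < e \<Longrightarrow> y t i 0 \<otimes>\<^bsub>G\<^esub> y t i 1 = g t \<and> y t i 2 \<otimes>\<^bsub>G\<^esub> y t i 3 = g t"
    and invol: "\<And>t. t < F * d \<Longrightarrow> r t \<otimes>\<^bsub>G\<^esub> r t = \<one>\<^bsub>G\<^esub> \<and> g t \<otimes>\<^bsub>G\<^esub> g t = \<one>\<^bsub>G\<^esub>"
  shows "exists_MS0 G (carrier G) e e (4 * d) (4 * d) F"
proof -
  interpret G: comm_group G by (rule G)
  \<comment> \<open>On even diagonals the quadruple of the preceding row is used; this lowers cells
    0 and 2 by one row, below cells 1 and 3, so that they form a square.\<close>
  define idx where "idx i \<delta> = (if odd \<delta> then i else (i + e - 1) mod e)" for i \<delta> :: nat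
  define u where "u f i \<delta> = y (f * d + \<delta> div 4) (idx i \<delta>) (\<delta> mod 4)" for f i \<delta>
  have e0: "0 < e" using de pos by simp
  have idx: "idx i \<delta> < e" if "i < e" for i \<delta> using that by (simp add: idx_def)
  have t: "f * d + \<delta> div 4 < F * d" if "f < F" "\<delta> < 4 * d" for f \<delta>
  proof -
    have "\<delta> div 4 < d" using that by auto
    then have "f * d + \<delta> div 4 < Suc f * d" by simp
    also have "\<dots> \<le> F * d" using that by (intro mult_le_mono1) simp
    finally show ?thesis .
  qed
  have u_in: "u f i \<delta> \<in> carrier G" if "f < F" "i < e" "\<delta> < 4 * d" for f i \<delta>
    unfolding u_def using t idx that by (intro y) auto
  let ?I = "{..<F} \<times> {..<e} \<times> {..<4 * d}"
  have fin: "finite (carrier G)" using ord pos e0 by (intro card_ge_0_finite) (simp add: order_def)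
  have cI: "card ?I = card (carrier G)" using ord by (simp add: order_def card_cartesian_product)
  have sub: "carrier G \<subseteq> (\<lambda>(f, i, \<delta>). u f i \<delta>) ` ?I"
  proof
    fix x assume "x \<in> carrier G"
    then obtain t i \<epsilon> where x: "t < F * d" "i < e" "\<epsilon> < 4" "x = y t i \<epsilon>" using cover by blast
    define \<delta> where "\<delta> = 4 * (t mod d) + \<epsilon>"
    define i' where "i' = (if odd \<delta> then i else (i + 1) mod e)"
    have "t mod d < d" using pos by simp
    then have "\<delta> < 4 * d" using x(3) by (simp add: \<delta>_def)
    moreover have "idx i' \<delta> = i"
      using x(2) by (auto simp: idx_def i'_def mod_if)
    moreover have "t div d < F" using x(1) by (simp add: less_mult_imp_div_less)
    moreover have "\<delta> div 4 = t mod d" "\<delta> mod 4 = \<epsilon>" using x(3) by (simp_all add: \<delta>_def)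
    moreover have "i' < e" using x(2) e0 by (simp add: i'_def)
    ultimately show "x \<in> (\<lambda>(f, i, \<delta>). u f i \<delta>) ` ?I"
      using x(4) by (intro image_eqI[of _ _ "(t div d, i', \<delta>)"]) (auto simp: u_def)
  qed
  have "(\<lambda>(f, i, \<delta>). u f i \<delta>) ` ?I \<subseteq> carrier G" using u_in by auto
  with sub have img: "(\<lambda>(f, i, \<delta>). u f i \<delta>) ` ?I = carrier G" by blast
  then have "inj_on (\<lambda>(f, i, \<delta>). u f i \<delta>) ?I" using cI by (intro eq_card_imp_inj_on) simp_all
  with img have bij: "bij_betw (\<lambda>(f, i, \<delta>). u f i \<delta>) ?I (carrier G)" by (simp add: bij_betw_def)
  have "1 < 1 * 1 * (4 * 1::nat)" by simp
  also have "\<dots> \<le> F * e * (4 * d)" using pos e0 by (intro mult_le_mono) auto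
  finally have card: "1 < card (carrier G)" using ord by (simp add: order_def)
  show ?thesis
  proof (rule exists_MS0_diagonals[OF G de fin bij card])
    fix f i assume fi: "f < F" "i < e"
    have block: "u f i (4 * q) \<otimes>\<^bsub>G\<^esub> u f i (4 * q + 1) \<otimes>\<^bsub>G\<^esub> (u f i (4 * q + 2) \<otimes>\<^bsub>G\<^esub> u f i (4 * q + 3)) = \<one>\<^bsub>G\<^esub>"
      if q: "q < d" for q
    proof -
      define t where "t = f * d + q"
      define i' where "i' = (i + e - 1) mod e"
      have t': "t < F * d" using t[of f "4 * q"] fi q by (simp add: t_def)
      have i': "i' < e" using e0 by (simp add: i'_def)
      have mods: "(4 * q + 1) mod 4 = 1" "(4 * q + 2) mod 4 = 2" "(4 * q + 3) mod 4 = 3"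
        "(4 * q + 1) div 4 = q" "(4 * q + 2) div 4 = q" "(4 * q + 3) div 4 = q" by presburger+
      have "u f i (4 * q) = y t i' 0" "u f i (4 * q + 1) = y t i 1" "u f i (4 * q + 2) = y t i' 2" "u f i (4 * q + 3) = y t i 3"
        unfolding u_def mods by (simp_all add: idx_def t_def i'_def)
      moreover have "y t i' 0 \<otimes>\<^bsub>G\<^esub> y t i 1 \<otimes>\<^bsub>G\<^esub> (y t i' 2 \<otimes>\<^bsub>G\<^esub> y t i 3)
          = (y t i' 0 \<otimes>\<^bsub>G\<^esub> y t i' 2) \<otimes>\<^bsub>G\<^esub> (y t i 1 \<otimes>\<^bsub>G\<^esub> y t i 3)"
        using y[OF t' i'] y[OF t' fi(2)] by (simp add: G.m_ac)
      ultimately show ?thesis using row[OF t' i'] row[OF t' fi(2)] invol[OF t'] by simp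
    qed
    have "(\<lambda>\<delta>. u f i \<delta>) \<in> {..<4 * d} \<rightarrow> carrier G" using u_in fi by auto
    from G.finprod_blocks4[OF this] show "(\<Otimes>\<^bsub>G\<^esub>\<delta>\<in>{..<4 * d}. u f i \<delta>) = \<one>\<^bsub>G\<^esub>"
      by (rule trans) (rule G.finprod_one_eqI, rule block, simp)
  next
    fix f j assume fj: "f < F" "j < e"
    define R where "R \<delta> = (j + e - \<delta>) mod e" for \<delta>
    have R: "R \<delta> < e" for \<delta> using e0 by (simp add: R_def)
    \<comment> \<open>Going from diagonal \<open>\<delta>\<close> to \<open>\<delta> + 1\<close> in
      a fixed column moves up one row. This matches the shift in \<open>idx\<close>, so the cells on
      diagonals \<open>4 * q\<close>, \<open>4 * q + 1\<close> belong to one quadruple, and likewise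
      those on the next two diagonals.\<close>
    have R_pred: "(R \<delta> + e - 1) mod e = R \<delta>'" if "\<delta> < e" "\<delta>' = \<delta> + 1" for \<delta> \<delta>'
    proof -
      have "(R \<delta> + e - 1) mod e = (R \<delta> + (e - 1)) mod e" using e0 by simp
      also have "\<dots> = (j + e - \<delta> + (e - 1)) mod e" unfolding R_def by (simp add: mod_add_left_eq)
      also have "j + e - \<delta> + (e - 1) = (j + e - \<delta>') + e" using that by simp
      finally show ?thesis by (simp add: R_def)
    qed
    have block: "u f (R (4 * q)) (4 * q) \<otimes>\<^bsub>G\<^esub> u f (R (4 * q + 1)) (4 * q + 1) \<otimes>\<^bsub>G\<^esub>
        (u f (R (4 * q + 2)) (4 * q + 2) \<otimes>\<^bsub>G\<^esub> u f (R (4 * q + 3)) (4 * q + 3)) = \<one>\<^bsub>G\<^esub>"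
      if q: "q < d" for q
    proof -
      define t where "t = f * d + q"
      have t': "t < F * d" using t[of f "4 * q"] fj q by (simp add: t_def)
      have mods: "(4 * q + 1) mod 4 = 1" "(4 * q + 2) mod 4 = 2" "(4 * q + 3) mod 4 = 3"
        "(4 * q + 1) div 4 = q" "(4 * q + 2) div 4 = q" "(4 * q + 3) div 4 = q" by presburger+
      have pred: "(R (4 * q) + e - 1) mod e = R (4 * q + 1)" "(R (4 * q + 2) + e - 1) mod e = R (4 * q + 3)"
        using q de by (intro R_pred; linarith)+
      have "u f (R (4 * q)) (4 * q) = y t (R (4 * q + 1)) 0" "u f (R (4 * q + 1)) (4 * q + 1) = y t (R (4 * q + 1)) 1"
        "u f (R (4 * q + 2)) (4 * q + 2) = y t (R (4 * q + 3)) 2" "u f (R (4 * q + 3)) (4 * q + 3) = y t (R (4 * q + 3)) 3"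
        unfolding u_def mods idx_def pred by (simp_all add: t_def)
      then show ?thesis using col[OF t' R] invol[OF t'] by simp
    qed
    have "(\<lambda>\<delta>. u f (R \<delta>) \<delta>) \<in> {..<4 * d} \<rightarrow> carrier G" using u_in fj R by auto
    from G.finprod_blocks4[OF this] show "(\<Otimes>\<^bsub>G\<^esub>\<delta>\<in>{..<4 * d}. u f ((j + e - \<delta>) mod e) \<delta>) = \<one>\<^bsub>G\<^esub>"
      unfolding R_def[symmetric] by (rule trans) (rule G.finprod_one_eqI, rule block, simp)
  qed
qed


text \<open>A full 4 x 4 array is a 2 x 2 arrangement of squares, with square \<open>a\<close> in
  block \<open>(a div 2, a mod 2)\<close>. Only squares in the same block row share \<open>r\<close>
  and only those in the same block column share \<open>g\<close>, so four different types fit into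
  one array.\<close>

lemma exists_MS0_quad_squares:
  fixes z :: "nat \<Rightarrow> nat \<Rightarrow> nat \<Rightarrow> 'a"
  assumes G: "comm_group G" and ord: "order G = 16 * T" and pos: "0 < T"
    and z: "\<And>t a \<epsilon>. t < T \<Longrightarrow> a < 4 \<Longrightarrow> \<epsilon> < 4 \<Longrightarrow> z t a \<epsilon> \<in> carrier G"
    and cover: "\<And>x. x \<in> carrier G \<Longrightarrow> \<exists>t<T. \<exists>a<4. \<exists>\<epsilon><4. x = z t a \<epsilon>"
    and row: "\<And>t a. t < T \<Longrightarrow> a < 4 \<Longrightarrow> z t a 1 \<otimes>\<^bsub>G\<^esub> z t a 3 = r t (a div 2) \<and> z t a 0 \<otimes>\<^bsub>G\<^esub> z t a 2 = r t (a div 2)"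
    and col: "\<And>t a. t < T \<Longrightarrow> a < 4 \<Longrightarrow> z t a 0 \<otimes>\<^bsub>G\<^esub> z t a 1 = g t (a mod 2) \<and> z t a 2 \<otimes>\<^bsub>G\<^esub> z t a 3 = g t (a mod 2)"
    and invol: "\<And>t b. t < T \<Longrightarrow> b < 2 \<Longrightarrow> r t b \<otimes>\<^bsub>G\<^esub> r t b = \<one>\<^bsub>G\<^esub> \<and> g t b \<otimes>\<^bsub>G\<^esub> g t b = \<one>\<^bsub>G\<^esub>"
  shows "exists_MS0 G (carrier G) 4 4 4 4 T"
proof -
  interpret G: comm_group G by (rule G)
  define cell where "cell a b = (if a = 0 then if b = 0 then 1 else 3 else if b = 0 then 0 else (2::nat))" for a b :: nat
  define E where "E t i j = z t (2 * (i div 2) + j div 2) (cell (i mod 2) (j mod 2))" for t i j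
  \<comment> \<open>Four cyclic diagonals fill a 4 x 4 array, so it can be rewritten in the diagonal
    format.\<close>
  define u where "u t i \<delta> = E t i ((i + \<delta>) mod 4)" for t i \<delta>
  have lt4: "i = 0 \<or> i = 1 \<or> i = 2 \<or> i = 3" if "i < 4" for i :: nat using that by linarith
  have cell: "cell a b < 4" for a b by (simp add: cell_def)
  have E_in: "E t i j \<in> carrier G" if "t < T" "i < 4" "j < 4" for t i j
  proof -
    have "i div 2 \<le> 1" "j div 2 \<le> 1" using that by linarith+
    then show ?thesis unfolding E_def using that cell by (intro z) auto
  qed
  have u_in: "u t i \<delta> \<in> carrier G" if "t < T" "i < 4" for t i \<delta>
    unfolding u_def using that by (intro E_in) auto
  let ?I = "{..<T} \<times> {..<4::nat} \<times> {..<4::nat}"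
  have fin: "finite (carrier G)" using ord pos by (intro card_ge_0_finite) (simp add: order_def)
  have cI: "card ?I = card (carrier G)" using ord by (simp add: order_def card_cartesian_product)
  have "carrier G \<subseteq> (\<lambda>(t, i, \<delta>). u t i \<delta>) ` ?I"
  proof
    fix x assume "x \<in> carrier G"
    then obtain t a \<epsilon> where x: "t < T" "a < 4" "\<epsilon> < 4" "x = z t a \<epsilon>" using cover by blast
    define i where "i = 2 * (a div 2) + (if odd \<epsilon> then 0 else 1)"
    define j where "j = 2 * (a mod 2) + (if \<epsilon> = 0 \<or> \<epsilon> = 1 then 0 else 1)"
    have "a div 2 \<le> 1" "a mod 2 \<le> 1" using x(2) by linarith+
    then have ij: "i < 4" "j < 4" by (auto simp: i_def j_def)
    have "i div 2 = a div 2" "j div 2 = a mod 2" "i mod 2 = (if odd \<epsilon> then 0 else 1)"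
      "j mod 2 = (if \<epsilon> = 0 \<or> \<epsilon> = 1 then 0 else 1)" by (auto simp: i_def j_def)
    moreover have "cell (if odd \<epsilon> then 0 else 1) (if \<epsilon> = 0 \<or> \<epsilon> = 1 then 0 else 1) = \<epsilon>"
      using lt4[OF x(3)] by (auto simp: cell_def)
    ultimately have "E t i j = x" unfolding E_def x(4) by simp
    moreover have "(i + (j + 4 - i) mod 4) mod 4 = j" using ij by (auto simp: mod_if)
    ultimately have "x = u t i ((j + 4 - i) mod 4)" by (simp add: u_def)
    then show "x \<in> (\<lambda>(t, i, \<delta>). u t i \<delta>) ` ?I"
      using x(1) ij by (intro image_eqI[of _ _ "(t, i, (j + 4 - i) mod 4)"]) auto
  qed
  moreover have "(\<lambda>(t, i, \<delta>). u t i \<delta>) ` ?I \<subseteq> carrier G" using u_in by auto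
  ultimately have img: "(\<lambda>(t, i, \<delta>). u t i \<delta>) ` ?I = carrier G" by blast
  then have "inj_on (\<lambda>(t, i, \<delta>). u t i \<delta>) ?I" using cI by (intro eq_card_imp_inj_on) simp_all
  with img have bij: "bij_betw (\<lambda>(t, i, \<delta>). u t i \<delta>) ?I (carrier G)" by (simp add: bij_betw_def)
  have card: "1 < card (carrier G)" using ord pos by (simp add: order_def)
  have four: "finprod G h {..<4} = (h 0 \<otimes>\<^bsub>G\<^esub> h 1) \<otimes>\<^bsub>G\<^esub> (h 2 \<otimes>\<^bsub>G\<^esub> h 3)" if "\<And>i. i < 4 \<Longrightarrow> h i \<in> carrier G" for h :: "nat \<Rightarrow> 'a"
  proof -
    have "{..<4::nat} = {0, 1, 2, 3}" by auto
    then show ?thesis using that by (simp add: G.m_assoc)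
  qed
  show ?thesis
  proof (rule exists_MS0_diagonals[OF G _ fin bij card])
    fix t i :: nat assume ti: "t < T" "i < 4"
    have "E t i 0 \<otimes>\<^bsub>G\<^esub> E t i 1 = r t (i div 2) \<and> E t i 2 \<otimes>\<^bsub>G\<^esub> E t i 3 = r t (i div 2)"
      using lt4[OF ti(2)] row[OF ti(1), of 0] row[OF ti(1), of 1] row[OF ti(1), of 2] row[OF ti(1), of 3]
      by (elim disjE) (simp_all add: E_def cell_def)
    moreover have "(\<Otimes>\<^bsub>G\<^esub>\<delta>\<in>{..<4}. u t i \<delta>) = (E t i 0 \<otimes>\<^bsub>G\<^esub> E t i 1) \<otimes>\<^bsub>G\<^esub> (E t i 2 \<otimes>\<^bsub>G\<^esub> E t i 3)"
      using lt4[OF ti(2)] E_in[OF ti] by (subst four) (auto simp: u_in ti u_def G.m_ac simp flip: numeral_2_eq_2)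
    ultimately show "(\<Otimes>\<^bsub>G\<^esub>\<delta>\<in>{..<4}. u t i \<delta>) = \<one>\<^bsub>G\<^esub>"
      using invol[OF ti(1), of "i div 2"] ti(2) by auto
  next
    fix t j :: nat assume tj: "t < T" "j < 4"
    have E_in': "E t i j \<in> carrier G" if "i < 4" for i using E_in tj that by blast
    have "E t 1 j \<otimes>\<^bsub>G\<^esub> E t 0 j = g t (j div 2) \<and> E t 3 j \<otimes>\<^bsub>G\<^esub> E t 2 j = g t (j div 2)"
      using lt4[OF tj(2)] col[OF tj(1), of 0] col[OF tj(1), of 1] col[OF tj(1), of 2] col[OF tj(1), of 3]
      by (elim disjE) (simp_all add: E_def cell_def)
    moreover have "(\<Otimes>\<^bsub>G\<^esub>\<delta>\<in>{..<4}. u t ((j + 4 - \<delta>) mod 4) \<delta>) = (E t 1 j \<otimes>\<^bsub>G\<^esub> E t 0 j) \<otimes>\<^bsub>G\<^esub> (E t 3 j \<otimes>\<^bsub>G\<^esub> E t 2 j)"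
    proof (subst four)
      show "u t ((j + 4 - i) mod 4) i \<in> carrier G" for i using tj by (intro u_in) simp_all
    qed (use lt4[OF tj(2)] E_in' in \<open>auto simp: u_def G.m_ac simp flip: numeral_2_eq_2\<close>)
    ultimately show "(\<Otimes>\<^bsub>G\<^esub>\<delta>\<in>{..<4}. u t ((j + 4 - \<delta>) mod 4) \<delta>) = \<one>\<^bsub>G\<^esub>"
      using invol[OF tj(1), of "j div 2"] tj(2) by auto
  qed simp
qed

section \<open>Square classes over a Klein four-group\<close>

locale two_involutions = comm_group +
  fixes r g
  assumes fin: "finite (carrier G)"
    and rg: "r \<in> carrier G" "g \<in> carrier G" "r \<otimes> r = \<one>" "g \<otimes> g = \<one>" "r \<noteq> \<one>" "g \<noteq> \<one>" "r \<noteq> g"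
begin

definition V where "V = {\<one>, r, g, r \<otimes> g}"

lemma V_subset: "V \<subseteq> carrier G" using rg by (auto simp: V_def)

lemmas rg_ac = m_ac inv_mult self_inverse[OF rg(1,3)] self_inverse[OF rg(2,4)] mult_inv_cancel rg(1-4)

lemma prod_neq: "r \<otimes> g \<noteq> \<one>" "r \<otimes> g \<noteq> r" "r \<otimes> g \<noteq> g"
proof -
  show "r \<otimes> g \<noteq> \<one>" using rg by (metis inv_equality self_inverse(1) m_comm)
  show "r \<otimes> g \<noteq> r" "r \<otimes> g \<noteq> g" using rg by simp_all
qed

lemma V_mult: "v \<in> V \<Longrightarrow> w \<in> V \<Longrightarrow> v \<otimes> w \<in> V"
  by (auto simp: V_def rg_ac)

lemma V_invol: "v \<in> V \<Longrightarrow> v \<otimes> v = \<one>" "v \<in> V \<Longrightarrow> inv v = v"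
  by (auto simp: V_def rg_ac)

lemma card_V: "card V = 4"
  using rg(5-7) prod_neq prod_neq[symmetric] by (auto simp: V_def)

definition roots where "roots v = {x \<in> carrier G. x \<otimes> x = v}"

definition generic where "generic = {x \<in> carrier G. x \<otimes> x \<notin> V}"

text \<open>As \<open>v\<close> squares to 1, the map \<open>x \<mapsto> v/x\<close> inverts
  squares. Hence every class of elements with a given square in \<open>V\<close>, and the set of
  those with square outside \<open>V\<close>, is stable under these maps for all
  \<open>v \<in> V\<close>, and the type of the quadruples can be chosen separately for each
  class.\<close>

lemma square_inv_mult: "v \<in> V \<Longrightarrow> x \<in> carrier G \<Longrightarrow> (v \<otimes> inv x) \<otimes> (v \<otimes> inv x) = inv (x \<otimes> x)"
proof -
  assume v: "v \<in> V" and x: "x \<in> carrier G"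
  have vc: "v \<in> carrier G" using v V_subset by blast
  have "(v \<otimes> inv x) \<otimes> (v \<otimes> inv x) = (v \<otimes> v) \<otimes> (inv x \<otimes> inv x)" using vc x by (simp add: m_ac)
  then show ?thesis using V_invol(1)[OF v] x by (simp add: inv_mult)
qed

lemma roots_closed: "v \<in> V \<Longrightarrow> w \<in> V \<Longrightarrow> x \<in> roots w \<Longrightarrow> v \<otimes> inv x \<in> roots w"
  using V_subset square_inv_mult[of v x] V_invol(2)[of w] by (auto simp: roots_def)

lemma generic_closed: "v \<in> V \<Longrightarrow> x \<in> generic \<Longrightarrow> v \<otimes> inv x \<in> generic"
proof -
  assume v: "v \<in> V" and x: "x \<in> generic"
  have "inv (x \<otimes> x) \<notin> V" using x V_invol(2) by (auto simp: generic_def) (metis inv_inv m_closed)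
  then show ?thesis using v x V_subset square_inv_mult[of v x] by (auto simp: generic_def)
qed

lemma V_elems: "\<one> \<in> V" "r \<in> V" "g \<in> V" "r \<otimes> g \<in> V" by (auto simp: V_def)

text \<open>The harder case: if some involution of the group is a nonsquare, a single type of
  quadruple suffices, as \<open>nonsquare_quad_diagonals\<close> shows.\<close>

context
  assumes squares: "\<And>v. v \<in> V \<Longrightarrow> roots v \<noteq> {}"
begin

lemma card_roots: "v \<in> V \<Longrightarrow> card (roots v) = card (roots \<one>)"
proof -
  assume v: "v \<in> V"
  then obtain x0 where x0: "x0 \<in> carrier G" "x0 \<otimes> x0 = v" using squares by (auto simp: roots_def)
  have "bij_betw (\<lambda>x. x0 \<otimes> x) (roots \<one>) (roots v)"
  proof (rule bij_betw_byWitness[where f' = "\<lambda>x. inv x0 \<otimes> x"])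
    show "(\<lambda>x. x0 \<otimes> x) ` roots \<one> \<subseteq> roots v"
    proof clarify
      fix x assume "x \<in> roots \<one>"
      then have x: "x \<in> carrier G" "x \<otimes> x = \<one>" by (auto simp: roots_def)
      have "(x0 \<otimes> x) \<otimes> (x0 \<otimes> x) = (x0 \<otimes> x0) \<otimes> (x \<otimes> x)" using x(1) x0(1) by (simp add: m_ac)
      then show "x0 \<otimes> x \<in> roots v" using x x0 by (auto simp: roots_def)
    qed
    show "(\<lambda>x. inv x0 \<otimes> x) ` roots v \<subseteq> roots \<one>"
    proof clarify
      fix x assume "x \<in> roots v"
      then have x: "x \<in> carrier G" "x \<otimes> x = v" by (auto simp: roots_def)
      have "(inv x0 \<otimes> x) \<otimes> (inv x0 \<otimes> x) = inv (x0 \<otimes> x0) \<otimes> (x \<otimes> x)" using x(1) x0(1) by (simp add: m_ac inv_mult)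
      then show "inv x0 \<otimes> x \<in> roots \<one>" using x x0 by (auto simp: roots_def)
    qed
  qed (use x0 in \<open>auto simp: roots_def mult_inv_cancel\<close>)
  then show ?thesis by (simp add: bij_betw_same_card)
qed

lemma roots_disjoint: "v \<noteq> w \<Longrightarrow> roots v \<inter> roots w = {}"
  by (auto simp: roots_def)

lemma finite_roots: "finite (roots v)" using fin by (simp add: roots_def)

lemma carrier_split: "carrier G = (\<Union>v\<in>V. roots v) \<union> generic" "(\<Union>v\<in>V. roots v) \<inter> generic = {}"
  by (auto simp: roots_def generic_def)

lemma order_split: "order G = card (\<Union>v\<in>V. roots v) + card generic"
  unfolding order_def by (subst carrier_split(1), rule card_Un_disjoint)
    (use carrier_split(2) fin finite_roots in \<open>auto simp: generic_def V_def\<close>)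

lemma card_UN_roots: "card (\<Union>v\<in>V. roots v) = 4 * card (roots \<one>)"
proof -
  have "card (\<Union>v\<in>V. roots v) = (\<Sum>v\<in>V. card (roots v))"
    by (rule card_UN_disjoint) (simp_all add: V_def finite_roots roots_disjoint)
  also have "\<dots> = (\<Sum>v\<in>V. card (roots \<one>))" using card_roots by (intro sum.cong) auto
  finally show ?thesis using card_V by simp
qed

text \<open>Here all squares are 1, so the type \<open>(r, g)\<close> has no fixed points.\<close>

lemma roots_quads: "\<exists>N. card (roots \<one>) = 4 * N"
proof -
  have "\<exists>N X. card (roots \<one>) = 4 * N \<and> (\<forall>i<N. X i \<in> roots \<one>) \<and>
      (\<forall>x\<in>roots \<one>. \<exists>i<N. \<exists>\<epsilon><4. x = quad G r g (X i) \<epsilon>)"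
    using rg roots_closed V_elems finite_roots by (intro quad_cover) (auto simp: roots_def)
  then show ?thesis by blast
qed

text \<open>The elements with square in \<open>V\<close> form a subgroup of order
  \<open>4 * card (roots \<one>)\<close>, a multiple of 16 because \<open>roots \<one>\<close>
  splits into quadruples. So 16 divides the group order and the number of remaining
  elements.\<close>

lemma order_dvd: "16 dvd order G" "16 dvd card generic"
proof -
  have "subgroup (\<Union>v\<in>V. roots v) G"
  proof (rule subgroupI)
    show "(\<Union>v\<in>V. roots v) \<subseteq> carrier G" by (auto simp: roots_def)
    show "(\<Union>v\<in>V. roots v) \<noteq> {}" using squares V_elems(1) by auto
    show "inv x \<in> (\<Union>v\<in>V. roots v)" if "x \<in> (\<Union>v\<in>V. roots v)" for x
      using roots_closed[OF V_elems(1)] that by (force simp: roots_def)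
    show "x \<otimes> y \<in> (\<Union>v\<in>V. roots v)" if xy: "x \<in> (\<Union>v\<in>V. roots v)" "y \<in> (\<Union>v\<in>V. roots v)" for x y
    proof -
      have "x \<in> carrier G" "y \<in> carrier G" "x \<otimes> x \<in> V" "y \<otimes> y \<in> V" using xy by (auto simp: roots_def)
      moreover from this have "(x \<otimes> y) \<otimes> (x \<otimes> y) = (x \<otimes> x) \<otimes> (y \<otimes> y)" by (simp add: m_ac)
      ultimately show ?thesis using V_mult by (auto simp: roots_def)
    qed
  qed
  then have "card (\<Union>v\<in>V. roots v) dvd order G"
    using lagrange by (metis dvd_triv_right)
  moreover have U: "16 dvd card (\<Union>v\<in>V. roots v)" using card_UN_roots roots_quads by auto
  ultimately show "16 dvd order G" by (rule dvd_trans[rotated])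
  then show "16 dvd card generic" using U order_split by (metis dvd_add_right_iff)
qed

text \<open>As the square of \<open>x\<close> lies outside \<open>V\<close>, the orbit of
  \<open>x\<close> under multiplication by \<open>V\<close> and inversion has eight elements. The
  number of orbits is even because 16 divides \<open>card generic\<close>. The half obtained
  balances the two types in \<open>square_quad_diagonals\<close>.\<close>

lemma generic_split:
  obtains H where "H \<subseteq> generic" "2 * card H = card generic" "\<And>v x. v \<in> V \<Longrightarrow> x \<in> H \<Longrightarrow> v \<otimes> inv x \<in> H"
proof -
  define orb where "orb x = (\<lambda>v. v \<otimes> x) ` V \<union> (\<lambda>v. v \<otimes> inv x) ` V" for x
  have Vc: "v \<in> carrier G" if "v \<in> V" for v using V_subset that by blast
  have fV: "finite V" by (simp add: V_def)
  have sub: "orb y \<subseteq> orb x" if x: "x \<in> carrier G" and y: "y \<in> orb x" for x y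
  proof
    fix z assume z: "z \<in> orb y"
    obtain v where v: "v \<in> V" "y = v \<otimes> x \<or> y = v \<otimes> inv x" using y by (auto simp: orb_def)
    obtain w where w: "w \<in> V" "z = w \<otimes> y \<or> z = w \<otimes> inv y" using z by (auto simp: orb_def)
    have "z = (w \<otimes> v) \<otimes> x \<or> z = (w \<otimes> v) \<otimes> inv x"
      using v w x Vc by (auto simp: m_assoc inv_mult V_invol(2))
    then show "z \<in> orb x" using V_mult[OF w(1) v(1)] by (auto simp: orb_def)
  qed
  have sym: "x \<in> orb y" if x: "x \<in> carrier G" and y: "y \<in> orb x" for x y
  proof -
    obtain v where v: "v \<in> V" "y = v \<otimes> x \<or> y = v \<otimes> inv x" using y by (auto simp: orb_def)
    have "x = v \<otimes> y \<or> x = v \<otimes> inv y"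
      using v x Vc[OF v(1)] V_invol[OF v(1)]
      by (auto simp: inv_mult self_inverse(2)[OF Vc[OF v(1)] V_invol(1)[OF v(1)]])
    then show ?thesis using v(1) by (auto simp: orb_def)
  qed
  have orb_c: "orb x \<subseteq> carrier G" if "x \<in> carrier G" for x using that Vc by (auto simp: orb_def)
  have orb_eq: "orb y = orb x" if "x \<in> generic" "y \<in> orb x" for x y
  proof -
    have "x \<in> carrier G" using that by (simp add: generic_def)
    moreover from this have "y \<in> carrier G" using orb_c that by blast
    ultimately show ?thesis using sub sym that(2) by blast
  qed
  have orb_generic: "orb x \<subseteq> generic" if x: "x \<in> generic" for x
  proof -
    have "v \<otimes> inv x \<in> generic" if "v \<in> V" for v using generic_closed x that by blast
    moreover have "v \<otimes> x \<in> generic" if "v \<in> V" for v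
    proof -
      have "\<one> \<otimes> inv x \<in> generic" using generic_closed[OF V_elems(1) x] .
      then have "v \<otimes> inv (\<one> \<otimes> inv x) \<in> generic" using generic_closed that by blast
      then show ?thesis using x by (simp add: generic_def)
    qed
    ultimately show ?thesis by (auto simp: orb_def)
  qed
  have card: "card (orb x) = 8" if x: "x \<in> generic" for x
  proof -
    have xc: "x \<in> carrier G" and xV: "x \<otimes> x \<notin> V" using x by (auto simp: generic_def)
    have "card ((\<lambda>v. v \<otimes> x) ` V) = 4" "card ((\<lambda>v. v \<otimes> inv x) ` V) = 4"
      using xc Vc card_V by (auto intro!: card_image[THEN trans] simp: inj_on_def)
    moreover have "(\<lambda>v. v \<otimes> x) ` V \<inter> (\<lambda>v. v \<otimes> inv x) ` V = {}"
    proof (rule ccontr)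
      assume "\<not> ?thesis"
      then obtain v w where vw: "v \<in> V" "w \<in> V" "v \<otimes> x = w \<otimes> inv x" by auto
      then have "v \<otimes> x \<otimes> x = (w \<otimes> inv x) \<otimes> x" by simp
      also have "\<dots> = w" using xc Vc vw by (simp add: m_assoc)
      finally have "v \<otimes> x \<otimes> x = w" .
      then have "v \<otimes> (v \<otimes> (x \<otimes> x)) = v \<otimes> w" using xc Vc vw(1,2) by (simp add: m_assoc)
      then have "x \<otimes> x = v \<otimes> w"
        using self_inverse(2)[OF Vc[OF vw(1)] V_invol(1)[OF vw(1)]] xc by simp
      then show False using xV V_mult vw by simp
    qed
    ultimately show ?thesis unfolding orb_def using fV by (subst card_Un_disjoint) auto
  qed
  have fg: "finite generic" using fin by (simp add: generic_def)
  have "\<exists>N X. card generic = 8 * N \<and> (\<forall>i<N. X i \<in> generic) \<and>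
      (\<forall>i<N. \<forall>j<N. i \<noteq> j \<longrightarrow> orb (X i) \<inter> orb (X j) = {}) \<and> (\<forall>x\<in>generic. \<exists>i<N::nat. x \<in> orb (X i))"
  proof (rule uniform_partition[OF fg])
    show "x \<in> orb x \<and> orb x \<subseteq> generic \<and> card (orb x) = 8" if "x \<in> generic" for x
    proof (intro conjI)
      have "x = \<one> \<otimes> x" using that by (simp add: generic_def)
      then show "x \<in> orb x" using V_elems(1) unfolding orb_def by blast
    qed (use orb_generic card that in auto)
  qed (rule orb_eq)
  then obtain N X where NX: "card generic = 8 * N" "\<forall>i<N. X i \<in> generic"
    "\<forall>i<N. \<forall>j<N. i \<noteq> j \<longrightarrow> orb (X i) \<inter> orb (X j) = {}" by blast
  \<comment> \<open>The first half of the orbits.\<close>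
  define H where "H = (\<Union>i\<in>{..<N div 2}. orb (X i))"
  have "even N" using order_dvd(2) NX(1) by presburger
  have "card H = (\<Sum>i<N div 2. card (orb (X i)))"
    unfolding H_def by (rule card_UN_disjoint) (use NX(3) fV in \<open>auto simp: orb_def\<close>)
  also have "\<dots> = (\<Sum>i<N div 2. 8)" using card NX(2) by (intro sum.cong) auto
  finally have "2 * card H = card generic" using NX(1) \<open>even N\<close> by simp
  moreover have "orb (X i) \<subseteq> generic" if "i < N div 2" for i
    using orb_generic[of "X i"] NX(2) that by simp
  then have "H \<subseteq> generic" unfolding H_def by blast
  moreover have "v \<otimes> inv x \<in> H" if v: "v \<in> V" and x: "x \<in> H" for v x
  proof -
    obtain i where i: "i < N div 2" "x \<in> orb (X i)" using x by (auto simp: H_def)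
    then have "X i \<in> generic" using NX(2) by simp
    then have "orb x = orb (X i)" using orb_eq i by blast
    moreover have "v \<otimes> inv x \<in> orb x" using v by (auto simp: orb_def)
    ultimately show ?thesis using i(1) by (auto simp: H_def)
  qed
  ultimately show thesis using that by blast
qed

lemma quad_cover_V:
  assumes "S \<subseteq> carrier G" "v \<in> V" "w \<in> V" "v \<noteq> w" "\<And>u x. u \<in> V \<Longrightarrow> x \<in> S \<Longrightarrow> u \<otimes> inv x \<in> S"
    "\<And>x. x \<in> S \<Longrightarrow> x \<otimes> x \<noteq> v \<and> x \<otimes> x \<noteq> w"
  shows "\<exists>N X. card S = 4 * N \<and> (\<forall>i<N. X i \<in> S) \<and> (\<forall>x\<in>S. \<exists>i<N. \<exists>\<epsilon><4. x = quad G v w (X i) \<epsilon>)"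
proof (rule quad_cover)
  show "finite S" using fin assms(1) finite_subset by blast
qed (use assms V_subset V_invol in auto)

text \<open>Each of the first \<open>N0\<close> arrays takes one quadruple from each of the four
  square classes. The generic quadruples fill the remaining arrays in groups of four.\<close>

lemma square_quad_squares:
  assumes ord: "order G = 16 * T"
  shows "exists_MS0 G (carrier G) 4 4 4 4 T"
proof -
  \<comment> \<open>Along \<open>a = 0, 1, 2, 3\<close> the types are
    \<open>(r, g), (r, 1), (r g, g), (r g, 1)\<close>, compatible with block rows and block columns.
    Block \<open>a\<close> takes the elements with square \<open>cls a\<close>, that is
    \<open>1, r g, r, g\<close>, which in each case avoids both entries of the type.\<close>
  define cls where "cls a = (if a = 0 then \<one> else if a = 1 then r \<otimes> g else if a = 2 then r else g)" for a :: nat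
  define rr where "rr b = (if b = 0 then r else r \<otimes> g)" for b :: nat
  define gg where "gg b = (if b = 0 then g else \<one>)" for b :: nat
  have V: "cls a \<in> V" "rr a \<in> V" "gg a \<in> V" for a using V_elems by (auto simp: cls_def rr_def gg_def)
  obtain N0 where N0: "card (roots \<one>) = 4 * N0" using roots_quads by blast
  have lt4: "a = 0 \<or> a = 1 \<or> a = 2 \<or> a = 3" if "a < 4" for a :: nat using that by linarith
  have "\<exists>X. (\<forall>i<N0. X i \<in> roots (cls a)) \<and>
      (\<forall>x\<in>roots (cls a). \<exists>i<N0. \<exists>\<epsilon><4. x = quad G (rr (a div 2)) (gg (a mod 2)) (X i) \<epsilon>)" if a: "a < 4" for a
  proof -
    have neq: "rr (a div 2) \<noteq> gg (a mod 2)" "cls a \<noteq> rr (a div 2)" "cls a \<noteq> gg (a mod 2)"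
      using lt4[OF a] rg(5-7) rg(5-7)[symmetric] prod_neq prod_neq[symmetric]
      by (auto simp: cls_def rr_def gg_def)
    have "\<exists>N X. card (roots (cls a)) = 4 * N \<and> (\<forall>i<N. X i \<in> roots (cls a)) \<and>
      (\<forall>x\<in>roots (cls a). \<exists>i<N. \<exists>\<epsilon><4. x = quad G (rr (a div 2)) (gg (a mod 2)) (X i) \<epsilon>)"
      using neq V roots_closed by (intro quad_cover_V) (auto simp: roots_def)
    moreover have "card (roots (cls a)) = 4 * N0" using card_roots V N0 by simp
    ultimately show ?thesis by auto
  qed
  then obtain X where X: "\<And>a i. a < 4 \<Longrightarrow> i < N0 \<Longrightarrow> X a i \<in> roots (cls a)"
    "\<And>a x. a < 4 \<Longrightarrow> x \<in> roots (cls a) \<Longrightarrow> \<exists>i<N0. \<exists>\<epsilon><4. x = quad G (rr (a div 2)) (gg (a mod 2)) (X a i) \<epsilon>"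
    by metis
  have "\<exists>N X. card generic = 4 * N \<and> (\<forall>i<N. X i \<in> generic) \<and>
      (\<forall>x\<in>generic. \<exists>i<N. \<exists>\<epsilon><4. x = quad G r g (X i) \<epsilon>)"
    using rg(7) V_elems generic_closed by (intro quad_cover_V) (auto simp: generic_def)
  then obtain N Y where Y: "card generic = 4 * N" "\<forall>i<N. Y i \<in> generic"
    "\<forall>x\<in>generic. \<exists>i<N. \<exists>\<epsilon><4. x = quad G r g (Y i) \<epsilon>" by blast
  obtain M where M: "N = 4 * M" using order_dvd(2) Y(1) by (auto elim!: dvdE)
  have T: "T = N0 + M" using order_split ord card_UN_roots N0 Y(1) M by simp
  have "0 < order G" using fin by (auto simp: order_def card_gt_0_iff)
  then have T0: "0 < T" using ord by simp
  define \<rho> where "\<rho> t b = (if t < N0 then rr b else r)" for t b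
  define \<gamma> where "\<gamma> t b = (if t < N0 then gg b else g)" for t b
  define x where "x t a = (if t < N0 then X a t else Y (4 * (t - N0) + a))" for t a
  define z where "z t a \<epsilon> = quad G (\<rho> t (a div 2)) (\<gamma> t (a mod 2)) (x t a) \<epsilon>" for t a \<epsilon>
  have \<rho>V: "\<rho> t b \<in> V" "\<gamma> t b \<in> V" for t b using V V_elems by (auto simp: \<rho>_def \<gamma>_def)
  have xc: "x t a \<in> carrier G" if "t < T" "a < 4" for t a
  proof (cases "t < N0")
    case True
    then show ?thesis using X(1)[of a t] that by (simp add: x_def roots_def)
  next
    case False
    then have "4 * (t - N0) + a < N" using that T M by linarith
    then show ?thesis using Y(2) False by (simp add: x_def generic_def)
  qed
  have \<rho>c: "\<rho> t b \<in> carrier G" "\<gamma> t b \<in> carrier G" for t b using \<rho>V V_subset by blast+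
  show ?thesis
  proof (rule exists_MS0_quad_squares[OF comm_group_axioms ord T0, of z \<rho> \<gamma>])
    show "z t a \<epsilon> \<in> carrier G" if "t < T" "a < 4" "\<epsilon> < 4" for t a \<epsilon>
      unfolding z_def using xc that \<rho>c by (intro quad_closed) auto
    show "\<exists>t<T. \<exists>a<4. \<exists>\<epsilon><4. y = z t a \<epsilon>" if "y \<in> carrier G" for y
    proof (cases "y \<in> generic")
      case True
      then obtain i \<epsilon> where i: "i < N" "\<epsilon> < 4" "y = quad G r g (Y i) \<epsilon>" using Y(3) by blast
      have "N0 + i div 4 < T" using i(1) T M by (simp add: less_mult_imp_div_less mult.commute)
      moreover have "y = z (N0 + i div 4) (i mod 4) \<epsilon>" using i(3) by (simp add: z_def \<rho>_def \<gamma>_def x_def)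
      moreover have "i mod 4 < 4" by simp
      ultimately show ?thesis using i(2) by blast
    next
      case False
      then have "y \<otimes> y \<in> V" using \<open>y \<in> carrier G\<close> by (simp add: generic_def)
      then have "\<exists>a\<in>{0, 1, 2, 3}. y \<otimes> y = cls a" by (auto simp: V_def cls_def)
      then obtain a where "a \<in> {0, 1, 2, 3}" "y \<otimes> y = cls a" by blast
      then have a: "a < 4" "y \<in> roots (cls a)" using \<open>y \<in> carrier G\<close> by (auto simp: roots_def)
      then obtain i \<epsilon> where i: "i < N0" "\<epsilon> < 4" "y = quad G (rr (a div 2)) (gg (a mod 2)) (X a i) \<epsilon>"
        using X(2) by blast
      then have "y = z i a \<epsilon>" by (simp add: z_def \<rho>_def \<gamma>_def x_def)
      then show ?thesis using i(1,2) a(1) T by (metis trans_less_add1)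
    qed
    show "z t a 1 \<otimes> z t a 3 = \<rho> t (a div 2) \<and> z t a 0 \<otimes> z t a 2 = \<rho> t (a div 2)"
      "z t a 0 \<otimes> z t a 1 = \<gamma> t (a mod 2) \<and> z t a 2 \<otimes> z t a 3 = \<gamma> t (a mod 2)" if "t < T" "a < 4" for t a
      unfolding z_def using quad_products[OF \<rho>c xc[OF that] V_invol(1)[OF \<rho>V(1)] V_invol(1)[OF \<rho>V(2)]] by auto
    show "\<rho> t b \<otimes> \<rho> t b = \<one> \<and> \<gamma> t b \<otimes> \<gamma> t b = \<one>" for t b using V_invol(1) \<rho>V by blast
  qed
qed

text \<open>The type \<open>(r, g)\<close> is used on elements whose square is neither
  \<open>r\<close> nor \<open>g\<close>, the type \<open>(1, r g)\<close> on elements whose square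
  is neither \<open>1\<close> nor \<open>r g\<close>. The generic elements, free for both, are
  shared out so that each type gets half of the group.\<close>

lemma square_quad_diagonals:
  assumes ord: "order G = F * e * (4 * d)" and de: "4 * d \<le> e" and pos: "0 < F" "0 < d" and e: "\<not> 4 dvd e"
  shows "exists_MS0 G (carrier G) e e (4 * d) (4 * d) F"
proof -
  obtain H where H: "H \<subseteq> generic" "2 * card H = card generic" "\<And>v x. v \<in> V \<Longrightarrow> x \<in> H \<Longrightarrow> v \<otimes> inv x \<in> H"
    using generic_split by blast
  have fg: "finite generic" using fin by (simp add: generic_def)
  have fH: "finite H" using H(1) fg finite_subset by blast
  have H': "v \<otimes> inv x \<in> generic - H" if v: "v \<in> V" and x: "x \<in> generic - H" for v x
  proof -
    have xc: "x \<in> carrier G" "v \<in> carrier G" using x v V_subset by (auto simp: generic_def)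
    have "v \<otimes> inv x \<notin> H"
    proof
      assume "v \<otimes> inv x \<in> H"
      then have "v \<otimes> inv (v \<otimes> inv x) \<in> H" using H(3) v by blast
      moreover have "v \<otimes> inv (v \<otimes> inv x) = x" using xc by (simp add: inv_mult mult_inv_cancel)
      ultimately show False using x by simp
    qed
    then show ?thesis using generic_closed v x by auto
  qed
  define S1 where "S1 = roots \<one> \<union> roots (r \<otimes> g) \<union> H"
  define S2 where "S2 = roots r \<union> roots g \<union> (generic - H)"
  have S: "carrier G = S1 \<union> S2" using carrier_split(1) H(1) by (auto simp: S1_def S2_def V_def)
  have dis: "roots v \<inter> generic = {}" if "v \<in> V" for v using carrier_split(2) that by blast
  have "card S1 = 2 * card (roots \<one>) + card H"
  proof -
    have "card S1 = card (roots \<one> \<union> roots (r \<otimes> g)) + card H"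
      unfolding S1_def using dis V_elems H(1) fH finite_roots by (intro card_Un_disjoint) auto
    also have "card (roots \<one> \<union> roots (r \<otimes> g)) = card (roots \<one>) + card (roots (r \<otimes> g))"
      using finite_roots roots_disjoint prod_neq by (intro card_Un_disjoint) auto
    finally show ?thesis using card_roots[OF V_elems(4)] by simp
  qed
  moreover have "card S2 = 2 * card (roots \<one>) + card H"
  proof -
    have "card S2 = card (roots r \<union> roots g) + card (generic - H)"
      unfolding S2_def using dis V_elems fg finite_roots by (intro card_Un_disjoint) auto
    also have "card (roots r \<union> roots g) = card (roots r) + card (roots g)"
      using finite_roots roots_disjoint rg(7) by (intro card_Un_disjoint) auto
    also have "card (generic - H) = card H" using H(1,2) fH by (simp add: card_Diff_subset)
    finally show ?thesis using card_roots[OF V_elems(2)] card_roots[OF V_elems(3)] by simp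
  qed
  moreover have "order G = 4 * card (roots \<one>) + 2 * card H"
    using order_split card_UN_roots H(2) by simp
  ultimately have half: "2 * card S1 = order G" "2 * card S2 = order G" by simp_all
  have cl1: "u \<otimes> inv x \<in> S1" if "u \<in> V" "x \<in> S1" for u x
    using that roots_closed[OF that(1)] V_elems H(3) by (auto simp: S1_def)
  have cl2: "u \<otimes> inv x \<in> S2" if "u \<in> V" "x \<in> S2" for u x
    using that roots_closed[OF that(1)] V_elems H' by (auto simp: S2_def)
  have sq1: "x \<otimes> x \<noteq> r \<and> x \<otimes> x \<noteq> g" if "x \<in> S1" for x
    using that H(1) rg(5-7)[symmetric] prod_neq V_elems by (auto simp: S1_def roots_def generic_def)
  have sq2: "x \<otimes> x \<noteq> \<one> \<and> x \<otimes> x \<noteq> r \<otimes> g" if "x \<in> S2" for x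
    using that rg(5-7) prod_neq[symmetric] V_elems by (auto simp: S2_def roots_def generic_def)
  obtain N1 X1 where X1: "card S1 = 4 * N1" "\<forall>i<N1. X1 i \<in> S1" "\<forall>x\<in>S1. \<exists>i<N1. \<exists>\<epsilon><4. x = quad G r g (X1 i) \<epsilon>"
    using quad_cover_V[of S1 r g] S V_elems rg(7) cl1 sq1 by auto
  obtain N2 X2 where X2: "card S2 = 4 * N2" "\<forall>i<N2. X2 i \<in> S2"
    "\<forall>x\<in>S2. \<exists>i<N2. \<exists>\<epsilon><4. x = quad G \<one> (r \<otimes> g) (X2 i) \<epsilon>"
    using quad_cover_V[of S2 \<one> "r \<otimes> g"] S V_elems prod_neq(1)[symmetric] cl2 sq2 by auto
  \<comment> \<open>The type is constant on each of the \<open>F * d\<close> blocks of four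
    diagonals, so an even number of blocks is wanted. It follows from \<open>16 dvd order G\<close>,
    since \<open>4\<close> does not divide \<open>e\<close>.\<close>
  have "even (F * d)"
  proof -
    have "16 dvd 4 * (F * d * e)" using order_dvd(1) ord by (simp add: ac_simps)
    then have "4 dvd F * d * e" by presburger
    show ?thesis
    proof (rule ccontr)
      assume "odd (F * d)"
      then have "coprime 4 (F * d)" using coprime_power_left_iff[of 2 2 "F * d"] by simp
      then have "4 dvd e" using \<open>4 dvd F * d * e\<close> by (simp add: coprime_dvd_mult_right_iff)
      then show False using e by simp
    qed
  qed
  then obtain P where P: "F * d = 2 * P" by (auto elim: evenE)
  have "order G = 4 * (F * d) * e" unfolding ord by simp
  also have "\<dots> = 8 * (P * e)" unfolding P by simp
  finally have "order G = 8 * (P * e)" .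
  then have N: "N1 = P * e" "N2 = P * e" using half X1(1) X2(1) by linarith+
  define x where "x t i = (if t < P then X1 (t * e + i) else X2 ((t - P) * e + i))" for t i
  define \<rho> where "\<rho> t = (if t < P then r else \<one>)" for t
  define \<gamma> where "\<gamma> t = (if t < P then g else r \<otimes> g)" for t
  define y where "y t i \<epsilon> = quad G (\<rho> t) (\<gamma> t) (x t i) \<epsilon>" for t i \<epsilon>
  have \<rho>V: "\<rho> t \<in> V" "\<gamma> t \<in> V" for t using V_elems by (auto simp: \<rho>_def \<gamma>_def)
  have \<rho>c: "\<rho> t \<in> carrier G" "\<gamma> t \<in> carrier G" for t using \<rho>V V_subset by blast+
  have lt: "t * e + i < P * e" if "t < P" "i < e" for t i
  proof -
    have "t * e + i < Suc t * e" using that by simp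
    also have "\<dots> \<le> P * e" using that by (intro mult_le_mono1) simp
    finally show ?thesis .
  qed
  have xc: "x t i \<in> carrier G" if "t < F * d" "i < e" for t i
  proof (cases "t < P")
    case True
    then show ?thesis using X1(2) lt[OF True that(2)] N S by (auto simp: x_def)
  next
    case False
    then have "t - P < P" using that P by linarith
    then show ?thesis using X2(2) lt[OF _ that(2)] N S False by (auto simp: x_def)
  qed
  have e0: "0 < e" using de pos by simp
  show ?thesis
  proof (rule exists_MS0_quad_diagonals[OF comm_group_axioms ord de pos, of y \<rho> \<gamma>])
    show "y t i \<epsilon> \<in> carrier G" if "t < F * d" "i < e" "\<epsilon> < 4" for t i \<epsilon>
      unfolding y_def using xc that \<rho>c by (intro quad_closed) auto
    show "\<exists>t<F * d. \<exists>i<e. \<exists>\<epsilon><4. a = y t i \<epsilon>" if "a \<in> carrier G" for a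
    proof (cases "a \<in> S1")
      case True
      then obtain j \<epsilon> where j: "j < N1" "\<epsilon> < 4" "a = quad G r g (X1 j) \<epsilon>" using X1(3) by blast
      have "j div e < P" using j(1) N by (simp add: less_mult_imp_div_less)
      then have "a = y (j div e) (j mod e) \<epsilon>" "j div e < F * d" using j(3) P by (simp_all add: y_def x_def \<rho>_def \<gamma>_def)
      then show ?thesis using j(2) e0 mod_less_divisor[OF e0, of j] by blast
    next
      case False
      then have "a \<in> S2" using S \<open>a \<in> carrier G\<close> by blast
      then obtain j \<epsilon> where j: "j < N2" "\<epsilon> < 4" "a = quad G \<one> (r \<otimes> g) (X2 j) \<epsilon>" using X2(3) by blast
      have "j div e < P" using j(1) N by (simp add: less_mult_imp_div_less)
      then have "a = y (P + j div e) (j mod e) \<epsilon>" "P + j div e < F * d" using j(3) P by (simp_all add: y_def x_def \<rho>_def \<gamma>_def)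
      then show ?thesis using j(2) e0 mod_less_divisor[OF e0, of j] by blast
    qed
    show "y t i 1 \<otimes> y t i 3 = \<rho> t \<and> y t i 0 \<otimes> y t i 2 = \<rho> t"
      "y t i 0 \<otimes> y t i 1 = \<gamma> t \<and> y t i 2 \<otimes> y t i 3 = \<gamma> t" if "t < F * d" "i < e" for t i
      unfolding y_def using quad_products[OF \<rho>c xc[OF that] V_invol(1)[OF \<rho>V(1)] V_invol(1)[OF \<rho>V(2)]] by auto
    show "\<rho> t \<otimes> \<rho> t = \<one> \<and> \<gamma> t \<otimes> \<gamma> t = \<one>" for t using V_invol(1) \<rho>V by blast
  qed
qed

end

end

text \<open>If neither \<open>r\<close> nor \<open>g\<close> is a square, the quadruples of this one
  type cover the whole group.\<close>

lemma (in comm_group) nonsquare_quad_diagonals: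
  assumes fin: "finite (carrier G)" and ord: "order G = F * e * (4 * d)" and de: "4 * d \<le> e" and pos: "0 < F" "0 < d"
    and rg: "r \<in> carrier G" "g \<in> carrier G" "r \<otimes> r = \<one>" "g \<otimes> g = \<one>" "r \<noteq> g"
    and nsq: "\<And>x. x \<in> carrier G \<Longrightarrow> x \<otimes> x \<noteq> r \<and> x \<otimes> x \<noteq> g"
  shows "exists_MS0 G (carrier G) e e (4 * d) (4 * d) F"
proof -
  obtain N X where X: "card (carrier G) = 4 * N" "\<forall>i<N. X i \<in> carrier G"
    "\<forall>x\<in>carrier G. \<exists>i<N. \<exists>\<epsilon><4. x = quad G r g (X i) \<epsilon>"
    using quad_cover[of "carrier G" r g] fin rg nsq by auto
  have N: "N = F * d * e" using X(1) ord by (simp add: order_def)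
  have lt: "t * e + i < N" if "t < F * d" "i < e" for t i
  proof -
    have "t * e + i < Suc t * e" using that by simp
    also have "\<dots> \<le> N" unfolding N using that by (intro mult_le_mono1) simp
    finally show ?thesis .
  qed
  have e0: "0 < e" using de pos by simp
  show ?thesis
  proof (rule exists_MS0_quad_diagonals[OF comm_group_axioms ord de pos,
        of "\<lambda>t i \<epsilon>. quad G r g (X (t * e + i)) \<epsilon>" "\<lambda>_. r" "\<lambda>_. g"])
    show "quad G r g (X (t * e + i)) \<epsilon> \<in> carrier G" if "t < F * d" "i < e" for t i \<epsilon>
      using X(2) lt[OF that] rg by (intro quad_closed) auto
    show "\<exists>t<F * d. \<exists>i<e. \<exists>\<epsilon><4. a = quad G r g (X (t * e + i)) \<epsilon>" if aG: "a \<in> carrier G" for a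
    proof -
      obtain j \<epsilon> where j: "j < N" "\<epsilon> < 4" "a = quad G r g (X j) \<epsilon>" using X(3) aG by blast
      have "j div e < F * d" using j(1) N by (simp add: less_mult_imp_div_less)
      moreover have "a = quad G r g (X (j div e * e + j mod e)) \<epsilon>" using j(3) by simp
      ultimately show ?thesis using j(2) mod_less_divisor[OF e0, of j] by blast
    qed
    show "quad G r g (X (t * e + i)) 1 \<otimes> quad G r g (X (t * e + i)) 3 = r \<and>
        quad G r g (X (t * e + i)) 0 \<otimes> quad G r g (X (t * e + i)) 2 = r"
      "quad G r g (X (t * e + i)) 0 \<otimes> quad G r g (X (t * e + i)) 1 = g \<and>
        quad G r g (X (t * e + i)) 2 \<otimes> quad G r g (X (t * e + i)) 3 = g" if "t < F * d" "i < e" for t i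
      using quad_products[OF rg(1,2) _ rg(3,4)] X(2) lt[OF that] by auto
  qed (use rg in auto)
qed


text \<open>Three cases: a nonsquare involution allows one type throughout; otherwise full 4 x 4
  arrays with mixed types are used if \<open>4 dvd e\<close>, and diagonals with two types if
  not.\<close>

lemma exists_MS0_class_G:
  assumes cls: "in_class_G G" and ord: "order G = n * k * c" and c: "0 < c"
    and par: "2 \<le> s" "s \<le> n" "2 \<le> k" "m * s = n * k" and d4: "gcd s k mod 4 = 0"
  shows "exists_MS0 G (carrier G) m n s k c"
proof -
  have G: "comm_group G" and fin: "finite (carrier G)" using cls by (auto simp: in_class_G_def)
  interpret G: comm_group G by (rule G)
  obtain s' k' e where p: "s = gcd s k * s'" "k = gcd s k * k'" "m = k' * e" "n = s' * e"
    "gcd s k \<le> e" "coprime s' k'" "0 < s'" "0 < k'" "0 < gcd s k"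
    using array_parameters[of s k n m] par by auto
  have "4 dvd gcd s k" using d4 by (simp only: mod_eq_0_iff_dvd)
  then obtain d where d: "gcd s k = 4 * d" by (rule dvdE)
  note p = p[unfolded d]
  have d0: "0 < d" using p(9) by simp
  define F where "F = c * (k' * s')"
  have F0: "0 < F" using c p by (simp add: F_def)
  have ord': "order G = F * e * (4 * d)" unfolding ord F_def by (subst p(2), subst p(4)) simp
  have "even (order G)" unfolding ord' by simp
  then have "1 < card {x \<in> carrier G. G.ord x = 2}" using cls by (auto simp: in_class_G_def)
  then have "\<not> (\<forall>x\<in>{x \<in> carrier G. G.ord x = 2}. \<forall>y\<in>{x \<in> carrier G. G.ord x = 2}. x = y)"
    using card_le_Suc0_iff_eq[of "{x \<in> carrier G. G.ord x = 2}"] fin by auto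
  then obtain r g where rg: "r \<in> carrier G" "g \<in> carrier G" "G.ord r = 2" "G.ord g = 2" "r \<noteq> g" by blast
  have inv2: "x \<otimes>\<^bsub>G\<^esub> x = \<one>\<^bsub>G\<^esub> \<and> x \<noteq> \<one>\<^bsub>G\<^esub>" if "x \<in> carrier G" "G.ord x = 2" for x
    using G.pow_ord_eq_1[OF that(1)] that G.ord_eq_1[of x] by (auto simp: numeral_2_eq_2)
  interpret T: two_involutions G r g
    using rg inv2[of r] inv2[of g] fin by unfold_locales auto
  have inflate: ?thesis if "exists_MS0 G (carrier G) e e (4 * d) (4 * d) F"
  proof -
    have "exists_MS0 G (carrier G) (k' * e) (s' * e) (s' * (4 * d)) (k' * (4 * d)) c"
      using that p(7,8) unfolding F_def by (intro exists_MS0_inflate[OF G]) simp_all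
    moreover have "s' * (4 * d) = s" "k' * (4 * d) = k" using p(1,2) by (simp_all only: mult.commute)
    ultimately show ?thesis using p(3,4) by simp
  qed
  show ?thesis
  proof (cases "\<exists>\<tau>\<in>carrier G. \<tau> \<otimes>\<^bsub>G\<^esub> \<tau> = \<one>\<^bsub>G\<^esub> \<and> T.roots \<tau> = {}")
    case True
    then obtain \<tau> where \<tau>: "\<tau> \<in> carrier G" "\<tau> \<otimes>\<^bsub>G\<^esub> \<tau> = \<one>\<^bsub>G\<^esub>" "T.roots \<tau> = {}" by blast
    have "\<exists>\<sigma>\<in>{r, g}. \<sigma> \<noteq> \<tau>" using rg(5) by auto
    then obtain \<sigma> where \<sigma>: "\<sigma> \<in> carrier G" "\<sigma> \<otimes>\<^bsub>G\<^esub> \<sigma> = \<one>\<^bsub>G\<^esub>" "\<sigma> \<noteq> \<one>\<^bsub>G\<^esub>" "\<sigma> \<noteq> \<tau>" using T.rg by blast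
    \<comment> \<open>A second nonsquare is \<open>\<sigma>\<close> or
      \<open>\<tau> \<sigma>\<close>: if both were squares, so would be their product
      \<open>\<tau>\<close>.\<close>
    have "\<exists>\<sigma>'\<in>carrier G. \<sigma>' \<otimes>\<^bsub>G\<^esub> \<sigma>' = \<one>\<^bsub>G\<^esub> \<and> \<sigma>' \<noteq> \<tau> \<and> T.roots \<sigma>' = {}"
    proof (cases "T.roots \<sigma> = {}")
      case True
      then show ?thesis using \<sigma> by blast
    next
      case False
      then obtain y where y: "y \<in> carrier G" "y \<otimes>\<^bsub>G\<^esub> y = \<sigma>" by (auto simp: T.roots_def)
      have "T.roots (\<tau> \<otimes>\<^bsub>G\<^esub> \<sigma>) = {}"
      proof (rule ccontr)
        assume "T.roots (\<tau> \<otimes>\<^bsub>G\<^esub> \<sigma>) \<noteq> {}"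
        then obtain x where x: "x \<in> carrier G" "x \<otimes>\<^bsub>G\<^esub> x = \<tau> \<otimes>\<^bsub>G\<^esub> \<sigma>" by (auto simp: T.roots_def)
        have "(x \<otimes>\<^bsub>G\<^esub> y) \<otimes>\<^bsub>G\<^esub> (x \<otimes>\<^bsub>G\<^esub> y) = (x \<otimes>\<^bsub>G\<^esub> x) \<otimes>\<^bsub>G\<^esub> (y \<otimes>\<^bsub>G\<^esub> y)"
          using x(1) y(1) by (simp add: G.m_ac)
        also have "\<dots> = \<tau>" using x(2) y(2) \<tau> \<sigma> by (simp add: G.m_assoc)
        finally show False using \<tau>(3) x(1) y(1) by (auto simp: T.roots_def)
      qed
      moreover have "(\<tau> \<otimes>\<^bsub>G\<^esub> \<sigma>) \<otimes>\<^bsub>G\<^esub> (\<tau> \<otimes>\<^bsub>G\<^esub> \<sigma>) = (\<tau> \<otimes>\<^bsub>G\<^esub> \<tau>) \<otimes>\<^bsub>G\<^esub> (\<sigma> \<otimes>\<^bsub>G\<^esub> \<sigma>)"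
        using \<tau>(1) \<sigma>(1) by (simp add: G.m_ac)
      moreover have "\<tau> \<otimes>\<^bsub>G\<^esub> \<sigma> \<noteq> \<tau>" using \<tau>(1) \<sigma>(1,3) by simp
      ultimately show ?thesis using \<tau>(1,2) \<sigma>(1,2) by (intro bexI[of _ "\<tau> \<otimes>\<^bsub>G\<^esub> \<sigma>"]) simp_all
    qed
    then obtain \<sigma>' where "\<sigma>' \<in> carrier G" "\<sigma>' \<otimes>\<^bsub>G\<^esub> \<sigma>' = \<one>\<^bsub>G\<^esub>" "\<sigma>' \<noteq> \<tau>" "T.roots \<sigma>' = {}" by blast
    then have "exists_MS0 G (carrier G) e e (4 * d) (4 * d) F"
      using \<tau> by (intro G.nonsquare_quad_diagonals[OF fin ord' p(5) F0 d0, of \<tau> \<sigma>']) (auto simp: T.roots_def)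
    then show ?thesis by (rule inflate)
  next
    case False
    then have sq: "T.roots v \<noteq> {}" if "v \<in> T.V" for v
      using T.V_invol(1)[OF that] T.V_subset that by blast
    show ?thesis
    proof (cases "4 dvd e")
      case True
      then obtain e' where e': "e = 4 * e'" by (auto elim: dvdE)
      \<comment> \<open>The 4 x 4 arrays are placed in a grid with \<open>k' * e'\<close> rows and
        \<open>s' * e'\<close> columns, \<open>s' * d\<close> of them to a grid row and
        \<open>k' * d\<close> to a grid column.\<close>
      have "order G = 16 * (c * ((k' * e') * (s' * d)))" unfolding ord' F_def e' by simp
      then have "exists_MS0 G (carrier G) 4 4 4 4 (c * ((k' * e') * (s' * d)))"
        using sq by (intro T.square_quad_squares) simp_all
      then have "exists_MS0 G (carrier G) ((k' * e') * 4) ((s' * e') * 4) ((s' * d) * 4) ((k' * d) * 4) c"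
      proof (rule exists_MS0_inflate[OF G])
        show "s' * d \<le> s' * e'" using p(5) e' by simp
      qed (use p(7) d0 e' p(5) in \<open>auto simp: ac_simps\<close>)
      moreover have "(s' * d) * 4 = s" "(k' * d) * 4 = k" using p(1,2) by (simp_all add: ac_simps)
      moreover have "(k' * e') * 4 = m" "(s' * e') * 4 = n" using p(3,4) e' by simp_all
      ultimately show ?thesis by simp
    next
      case False
      show ?thesis
        by (rule inflate, rule T.square_quad_diagonals) (use sq ord' p(5) F0 d0 False in simp_all)
    qed
  qed
qed

section \<open>Half-systems\<close>

lemma hom_finprod:
  assumes "comm_group G" "comm_group H" "h \<in> hom G H" "finite A" "f \<in> A \<rightarrow> carrier G"
  shows "h (finprod G f A) = finprod H (\<lambda>x. h (f x)) A"
proof -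
  interpret G: comm_group G by fact
  interpret H: comm_group H by fact
  interpret group_hom G H h using assms(3) by unfold_locales
  show ?thesis using assms(4,5)
  proof (induction rule: finite_induct)
    case (insert x A)
    then show ?case by (simp add: Pi_def)
  qed simp
qed

lemma exists_MS0_iso:
  assumes "comm_group G" "comm_group H" "G \<cong> H" "exists_MS0 G (nonzero G) m n s k c"
  shows "exists_MS0 H (nonzero H) m n s k c"
proof -
  interpret G: comm_group G by fact
  interpret H: comm_group H by fact
  obtain h where h: "h \<in> hom G H" "bij_betw h (carrier G) (carrier H)"
    using assms(3) by (auto simp: is_iso_def iso_def)
  obtain I :: "(nat \<times> nat \<times> nat) set" and v T R K
    where P: "placement G I v T R K m n s k c" and \<Omega>: "v ` I = nonzero G" "1 < card (nonzero G)"
    using placement_if_exists_MS0[OF assms(1,4)] .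
  have v: "v \<in> I \<rightarrow> carrier G" and fin: "finite I" and inj: "inj_on v I" using P by (auto simp: placement_def)
  have one: "h \<one>\<^bsub>G\<^esub> = \<one>\<^bsub>H\<^esub>" using h(1) by (simp add: hom_one)
  have inj': "inj_on h (carrier G)" using h(2) by (simp add: bij_betw_def)
  have fp: "finprod H (\<lambda>x. h (v x)) J = \<one>\<^bsub>H\<^esub>" if "J \<subseteq> I" "finprod G v J = \<one>\<^bsub>G\<^esub>" for J
  proof -
    have "finite J" "v \<in> J \<rightarrow> carrier G" using that(1) fin v finite_subset by (blast, auto)
    from hom_finprod[OF assms(1,2) h(1) this] show ?thesis using that(2) one by simp
  qed
  have "h ` nonzero G = nonzero H"
    using h(2) one inj_on_image_set_diff[OF inj', of "carrier G" "{\<one>\<^bsub>G\<^esub>}"]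
    by (simp add: nonzero_def bij_betw_def)
  moreover have "inj_on h (nonzero G)" using inj' by (auto simp: nonzero_def inj_on_def)
  ultimately have "card (nonzero H) = card (nonzero G)" "h ` v ` I = nonzero H"
    using \<Omega>(1) card_image by metis+
  then have img: "(\<lambda>x. h (v x)) ` I = nonzero H" "1 < card (nonzero H)"
    using \<Omega>(2) by (simp_all add: image_image)
  have "placement H I (\<lambda>x. h (v x)) T R K m n s k c"
    unfolding placement_def
  proof (intro conjI allI impI)
    have "inj_on h (v ` I)" by (rule inj_on_subset[OF inj']) (use v in auto)
    from comp_inj_on[OF inj this] show "inj_on (\<lambda>x. h (v x)) I" by (simp add: comp_def)
    show "(\<lambda>x. h (v x)) \<in> I \<rightarrow> carrier H" using v h(1) by (auto simp: hom_def)
  qed (use P fp in \<open>auto simp: placement_def\<close>)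
  then show ?thesis using exists_MS0_if_placement[OF assms(2) _ img] by blast
qed

lemma card_2_other:
  assumes "card A = 2" "x \<in> A"
  obtains z where "A = {x, z}" "x \<noteq> z"
proof -
  obtain a b where ab: "A = {a, b}" "a \<noteq> b" using assms(1) unfolding card_2_iff by blast
  show thesis
  proof (cases "x = a")
    case True
    then show ?thesis using that[of b] ab by simp
  next
    case False
    then show ?thesis using that[of a] ab assms(2) by auto
  qed
qed

text \<open>The partner of an entry in its row and its partner in its column both equal its inverse,
  so one element would stand in two cells.\<close>

lemma not_exists_MS0_2x2:
  assumes G: "comm_group G" and c: "0 < c"
  shows "\<not> exists_MS0 G \<Omega> 2 2 2 2 c"
proof
  assume E: "exists_MS0 G \<Omega> 2 2 2 2 c"
  interpret G: comm_group G by (rule G)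
  obtain I :: "(nat \<times> nat \<times> nat) set" and v T R K
    where P: "placement G I v T R K 2 2 2 2 c" using placement_if_exists_MS0[OF G E] .
  have v: "\<And>x. x \<in> I \<Longrightarrow> v x \<in> carrier G" and inj: "inj_on v I" and pos: "inj_on (\<lambda>x. (T x, R x, K x)) I"
    using P by (auto simp: placement_def)
  have two: "\<exists>z. {y \<in> I. Q y} = {x, z} \<and> x \<noteq> z \<and> v x \<otimes>\<^bsub>G\<^esub> v z = \<one>\<^bsub>G\<^esub> \<and> z \<in> I \<and> Q z"
    if Q: "card {y \<in> I. Q y} = 2" "finprod G v {y \<in> I. Q y} = \<one>\<^bsub>G\<^esub>" "x \<in> I" "Q x" for Q x
  proof -
    have "x \<in> {y \<in> I. Q y}" using Q by simp
    with Q(1) obtain z where z: "{y \<in> I. Q y} = {x, z}" "x \<noteq> z" by (rule card_2_other)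
    then have "z \<in> {y \<in> I. Q y}" by simp
    then have "z \<in> I" "Q z" by auto
    moreover have "v x \<otimes>\<^bsub>G\<^esub> v z = \<one>\<^bsub>G\<^esub>" using Q(2) z v \<open>z \<in> I\<close> \<open>x \<in> I\<close> by (simp add: Pi_def)
    ultimately show ?thesis using z by blast
  qed
  have row: "card {x \<in> I. T x = 0 \<and> R x = 0} = 2" "finprod G v {x \<in> I. T x = 0 \<and> R x = 0} = \<one>\<^bsub>G\<^esub>"
    using P c by (auto simp: placement_def)
  then have "{x \<in> I. T x = 0 \<and> R x = 0} \<noteq> {}" by force
  then obtain x where x: "x \<in> I" "T x = 0" "R x = 0" by blast
  then obtain y where y: "x \<noteq> y" "v x \<otimes>\<^bsub>G\<^esub> v y = \<one>\<^bsub>G\<^esub>" "y \<in> I" "T y = 0 \<and> R y = 0"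
    using two[OF row] by blast
  have "card {y \<in> I. T y = 0 \<and> K y = K x} = 2" "finprod G v {y \<in> I. T y = 0 \<and> K y = K x} = \<one>\<^bsub>G\<^esub>"
    using P c x(1) by (auto simp: placement_def)
  then obtain z where z: "x \<noteq> z" "v x \<otimes>\<^bsub>G\<^esub> v z = \<one>\<^bsub>G\<^esub>" "z \<in> I" "T z = 0 \<and> K z = K x"
    using two[of "\<lambda>y. T y = 0 \<and> K y = K x" x] x by blast
  have "v x \<otimes>\<^bsub>G\<^esub> v y = v x \<otimes>\<^bsub>G\<^esub> v z" using y z by simp
  then have "v y = v z" using v x(1) y(3) z(3) by simp
  then have "y = z" using inj y(3) z(3) by (auto simp: inj_on_def)
  then have "x = y" using pos x y z by (auto simp: inj_on_def)
  then show False using y by simp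
qed

text \<open>The equivalence also excludes involutions: a nonzero \<open>x\<close> with
  \<open>inv x = x\<close> would contradict it.\<close>

definition half_system :: "('a, 'b) monoid_scheme \<Rightarrow> 'a set \<Rightarrow> bool" where
  "half_system G R \<longleftrightarrow> R \<subseteq> nonzero G \<and> (\<forall>x\<in>nonzero G. x \<in> R \<longleftrightarrow> inv\<^bsub>G\<^esub> x \<notin> R)"

text \<open>Row 0 is the half-system: the column partner of an entry is its inverse and lies in row
  1.\<close>

lemma half_system_if_exists_MS0:
  assumes G: "comm_group G" and E: "exists_MS0 G (nonzero G) 2 n n 2 1"
  shows "\<exists>R. half_system G R \<and> finprod G (\<lambda>x. x) R = \<one>\<^bsub>G\<^esub>"
proof -
  interpret G: comm_group G by (rule G)
  obtain I :: "(nat \<times> nat \<times> nat) set" and v T R K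
    where P: "placement G I v T R K 2 n n 2 1" and img: "v ` I = nonzero G"
    using placement_if_exists_MS0[OF G E] .
  have v: "\<And>x. x \<in> I \<Longrightarrow> v x \<in> carrier G" and inj: "inj_on v I" and pos: "inj_on (\<lambda>x. (T x, R x, K x)) I"
    and T: "\<And>x. x \<in> I \<Longrightarrow> T x = 0" and R: "\<And>x. x \<in> I \<Longrightarrow> R x < 2" and K: "\<And>x. x \<in> I \<Longrightarrow> K x < n"
    using P by (auto simp: placement_def)
  let ?J = "{x \<in> I. T x = 0 \<and> R x = 0}"
  have mate: "\<exists>z\<in>I. v z = inv\<^bsub>G\<^esub> (v x) \<and> R z \<noteq> R x" if x: "x \<in> I" for x
  proof -
    let ?C = "{y \<in> I. T y = 0 \<and> K y = K x}"
    have C: "card ?C = 2" "finprod G v ?C = \<one>\<^bsub>G\<^esub>" using P K[OF x] by (auto simp: placement_def)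
    have "x \<in> ?C" using x T by simp
    with C(1) obtain z where z: "?C = {x, z}" "x \<noteq> z" by (rule card_2_other)
    then have "z \<in> ?C" by simp
    then have zI: "z \<in> I" "T z = 0" "K z = K x" by auto
    have "v x \<otimes>\<^bsub>G\<^esub> v z = \<one>\<^bsub>G\<^esub>" using C(2) z v zI(1) x by (simp add: Pi_def)
    then have "v z = inv\<^bsub>G\<^esub> (v x)" using v zI(1) x by (metis G.inv_equality G.m_comm)
    moreover have "R z \<noteq> R x"
    proof
      assume "R z = R x"
      then have "(T z, R z, K z) = (T x, R x, K x)" using zI T[OF x] by simp
      then show False using pos zI(1) x z(2) by (auto simp: inj_on_def)
    qed
    ultimately show ?thesis using zI by blast
  qed
  have mem: "v i \<in> v ` ?J \<longleftrightarrow> R i = 0" if "i \<in> I" for i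
    using inj_on_image_mem_iff[OF inj that, of ?J] T[OF that] that by auto
  have "half_system G (v ` ?J)"
    unfolding half_system_def
  proof (intro conjI ballI)
    show "v ` ?J \<subseteq> nonzero G" using img by auto
    fix x assume "x \<in> nonzero G"
    then obtain i where i: "i \<in> I" "x = v i" using img by blast
    obtain z where z: "z \<in> I" "v z = inv\<^bsub>G\<^esub> x" "R z \<noteq> R i" using mate[OF i(1)] i(2) by blast
    have "x \<in> v ` ?J \<longleftrightarrow> R i = 0" unfolding i(2) by (rule mem[OF i(1)])
    moreover have "inv\<^bsub>G\<^esub> x \<in> v ` ?J \<longleftrightarrow> R z = 0" unfolding z(2)[symmetric] by (rule mem[OF z(1)])
    moreover have "R i = 0 \<longleftrightarrow> R z \<noteq> 0" using R[OF i(1)] R[OF z(1)] z(3) by linarith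
    ultimately show "x \<in> v ` ?J \<longleftrightarrow> inv\<^bsub>G\<^esub> x \<notin> v ` ?J" by (simp only: not_not)
  qed
  moreover have "finprod G (\<lambda>x. x) (v ` ?J) = finprod G v ?J"
    using inj v by (subst G.finprod_reindex) (auto simp: inj_on_def)
  moreover have "finprod G v ?J = \<one>\<^bsub>G\<^esub>" using P by (auto simp: placement_def)
  ultimately show ?thesis by auto
qed

lemma half_system_split:
  assumes "comm_group G" "half_system G R"
  shows "nonzero G = R \<union> m_inv G ` R" "R \<inter> m_inv G ` R = {}"
proof -
  interpret G: comm_group G by fact
  have inv_nz: "inv\<^bsub>G\<^esub> x \<in> nonzero G" if "x \<in> nonzero G" for x using that by (auto simp: nonzero_def)
  have R: "R \<subseteq> nonzero G" "\<And>x. x \<in> nonzero G \<Longrightarrow> x \<in> R \<longleftrightarrow> inv\<^bsub>G\<^esub> x \<notin> R"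
    using assms(2) by (auto simp: half_system_def)
  have inv_inv: "inv\<^bsub>G\<^esub> (inv\<^bsub>G\<^esub> x) = x" if "x \<in> nonzero G" for x using that by (simp add: nonzero_def)
  show "nonzero G = R \<union> m_inv G ` R"
  proof (intro equalityI subsetI)
    fix x assume x: "x \<in> nonzero G"
    show "x \<in> R \<union> m_inv G ` R"
    proof (cases "x \<in> R")
      case False
      then have "inv\<^bsub>G\<^esub> x \<in> R" using R(2) x by blast
      then show ?thesis using inv_inv[OF x] by (metis UnI2 imageI)
    qed simp
  next
    fix x assume "x \<in> R \<union> m_inv G ` R"
    then show "x \<in> nonzero G" using R(1) inv_nz by blast
  qed
  show "R \<inter> m_inv G ` R = {}" using R by blast
qed

lemma exists_MS0_if_half_system:
  assumes G: "comm_group G" and R: "half_system G R" "finprod G (\<lambda>x. x) R = \<one>\<^bsub>G\<^esub>"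
    and ord: "order G = 2 * n + 1" "0 < n"
  shows "exists_MS0 G (nonzero G) 2 n n 2 1"
proof -
  interpret G: comm_group G by (rule G)
  have fin: "finite (carrier G)" using ord by (intro card_ge_0_finite) (simp add: order_def)
  have card: "card (nonzero G) = 2 * n" using ord fin by (simp add: nonzero_def order_def)
  note split = half_system_split[OF G R(1)]
  have Rc: "R \<subseteq> carrier G" using R(1) by (auto simp: half_system_def nonzero_def)
  have finR: "finite R" using Rc fin finite_subset by blast
  have "card (m_inv G ` R) = card R"
    by (rule card_image) (use Rc in \<open>auto simp: inj_on_def subset_iff\<close>)
  then have "card R = n" using card_Un_disjoint[OF finR _ split(2)] finR split(1) card by simp
  then obtain w where w: "bij_betw w {..<n} R" using ex_bij_betw_nat_finite[OF finR] by (auto simp: atLeast0LessThan)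
  show ?thesis
  proof (rule exists_MS0_half_systems[OF G, where w = "\<lambda>_. w"])
    show "w j \<in> carrier G" if "j < n" for j using w that Rc by (auto simp: bij_betw_def)
    have "finprod G (\<lambda>x. x) (w ` {..<n}) = (\<Otimes>\<^bsub>G\<^esub>j\<in>{..<n}. w j)"
      by (rule G.finprod_reindex) (use w Rc in \<open>auto simp: bij_betw_def\<close>)
    then show "(\<Otimes>\<^bsub>G\<^esub>j\<in>{..<n}. w j) = \<one>\<^bsub>G\<^esub>" using w R(2) by (simp add: bij_betw_def)
    show "\<exists>t<1::nat. \<exists>j<n. x = w j \<or> x = inv\<^bsub>G\<^esub> (w j)" if "x \<in> nonzero G" for x
      using that w unfolding split(1) bij_betw_def by auto
  qed (use card ord(2) in auto)
qed


lemma (in comm_group) odd_order_self_inverse: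
  assumes "finite (carrier G)" "odd (order G)" "x \<in> carrier G" "inv x = x"
  shows "x = \<one>"
proof -
  have "x \<otimes> x = \<one>" using r_inv[OF assms(3)] assms(4) by simp
  then have "x [^] (2::nat) = \<one>" using assms(3) by (simp add: numeral_2_eq_2)
  then have "ord x dvd 2" using pow_eq_id[OF assms(3)] by simp
  moreover have "odd (ord x)" using ord_dvd_group_order[OF assms(3)] assms(2) by (meson dvd_trans)
  ultimately have "ord x = 1" by (metis dvd_refl prime_nat_iff two_is_prime_nat)
  then show ?thesis using ord_eq_1[OF assms(3)] by simp
qed

text \<open>In a quotient, an element carries the coefficient given by the signed count of the members of
  its coset; the coefficients 1 and 3 are the ones available in every coset of odd size.\<close>

definition weakly_balanced :: "('a, 'b) monoid_scheme \<Rightarrow> bool" where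
  "weakly_balanced G \<longleftrightarrow> (\<exists>R \<kappa>. half_system G R \<and> (\<forall>x\<in>R. \<kappa> x = 1 \<or> \<kappa> x = (3::nat)) \<and> (\<exists>x\<in>R. \<kappa> x = 1) \<and>
     finprod G (\<lambda>x. x [^]\<^bsub>G\<^esub> \<kappa> x) R = \<one>\<^bsub>G\<^esub>)"

lemma weakly_balanced_if_exists_MS0:
  assumes G: "comm_group G" and E: "exists_MS0 G (nonzero G) 2 n n 2 1"
  shows "weakly_balanced G"
proof -
  interpret G: comm_group G by (rule G)
  obtain R where R: "half_system G R" "finprod G (\<lambda>x. x) R = \<one>\<^bsub>G\<^esub>"
    using half_system_if_exists_MS0[OF assms] by blast
  have "1 < card (nonzero G)" using E by (auto simp: exists_MS0_def magic_pfa_set_def)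
  then have "nonzero G \<noteq> {}" by auto
  then have "R \<noteq> {}" using half_system_split(1)[OF G R(1)] by auto
  moreover have Rc: "R \<subseteq> carrier G" using R(1) by (auto simp: half_system_def nonzero_def)
  moreover have "finprod G (\<lambda>x. x [^]\<^bsub>G\<^esub> (1::nat)) R = finprod G (\<lambda>x. x) R"
    by (rule G.finprod_cong') (use Rc in auto)
  ultimately show ?thesis
    unfolding weakly_balanced_def using R by (intro exI[of _ R] exI[of _ "\<lambda>_. 1"]) auto
qed

lemma weakly_balanced_iso:
  assumes "comm_group G" "comm_group H" "G \<cong> H" "finite (carrier G)" "weakly_balanced G"
  shows "weakly_balanced H"
proof -
  interpret G: comm_group G by fact
  interpret H: comm_group H by fact
  obtain h where h: "h \<in> hom G H" "bij_betw h (carrier G) (carrier H)"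
    using assms(3) by (auto simp: is_iso_def iso_def)
  interpret h: group_hom G H h using h(1) by unfold_locales
  obtain R \<kappa> where R: "half_system G R" "\<forall>x\<in>R. \<kappa> x = 1 \<or> \<kappa> x = (3::nat)" "\<exists>x\<in>R. \<kappa> x = 1"
    "finprod G (\<lambda>x. x [^]\<^bsub>G\<^esub> \<kappa> x) R = \<one>\<^bsub>G\<^esub>"
    using assms(5) unfolding weakly_balanced_def by blast
  have inj: "inj_on h (carrier G)" and img: "h ` carrier G = carrier H" using h(2) by (auto simp: bij_betw_def)
  have Rc: "R \<subseteq> carrier G" using R(1) by (auto simp: half_system_def nonzero_def)
  have finR: "finite R" using Rc assms(4) finite_subset by blast
  define g where "g = inv_into R h"
  have injR: "inj_on h R" using inj Rc inj_on_subset by blast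
  have g: "g (h x) = x" if "x \<in> R" for x unfolding g_def by (rule inv_into_f_f[OF injR that])
  have mem: "h x \<in> h ` R \<longleftrightarrow> x \<in> R" if "x \<in> carrier G" for x
    using inj_on_image_mem_iff[OF inj that Rc] .
  have one: "h x = \<one>\<^bsub>H\<^esub> \<longleftrightarrow> x = \<one>\<^bsub>G\<^esub>" if "x \<in> carrier G" for x
    using inj that by (metis G.one_closed h.hom_one inj_onD)
  have "half_system H (h ` R)"
    unfolding half_system_def
  proof (intro conjI ballI)
    show "h ` R \<subseteq> nonzero H" using R(1) img one by (auto simp: half_system_def nonzero_def)
    fix y assume "y \<in> nonzero H"
    then obtain x where x: "x \<in> carrier G" "y = h x" "x \<in> nonzero G" using img one by (auto simp: nonzero_def)
    then have "x \<in> R \<longleftrightarrow> inv\<^bsub>G\<^esub> x \<notin> R" using R(1) by (auto simp: half_system_def)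
    then show "y \<in> h ` R \<longleftrightarrow> inv\<^bsub>H\<^esub> y \<notin> h ` R"
      using mem[OF x(1)] mem[of "inv\<^bsub>G\<^esub> x"] x by simp
  qed
  moreover have "finprod H (\<lambda>y. y [^]\<^bsub>H\<^esub> \<kappa> (g y)) (h ` R) = \<one>\<^bsub>H\<^esub>"
  proof -
    have "finprod H (\<lambda>y. y [^]\<^bsub>H\<^esub> \<kappa> (g y)) (h ` R) = finprod H (\<lambda>x. h x [^]\<^bsub>H\<^esub> \<kappa> (g (h x))) R"
      by (rule H.finprod_reindex[OF _ injR]) (use Rc in auto)
    also have "\<dots> = finprod H (\<lambda>x. h (x [^]\<^bsub>G\<^esub> \<kappa> x)) R"
      by (rule H.finprod_cong') (use Rc g in \<open>auto simp: h.hom_nat_pow\<close>)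
    also have "\<dots> = h (finprod G (\<lambda>x. x [^]\<^bsub>G\<^esub> \<kappa> x) R)"
      by (rule hom_finprod[symmetric, OF assms(1,2) h(1) finR]) (use Rc in auto)
    finally show ?thesis using R(4) by simp
  qed
  ultimately show ?thesis
    unfolding weakly_balanced_def using R(2,3) g
    by (intro exI[of _ "h ` R"] exI[of _ "\<lambda>y. \<kappa> (g y)"]) auto
qed

section \<open>The groups of order 5 and 9\<close>

text \<open>\<open>1 * 1 + 3 * 3 = 10\<close>. With all coefficients 1 this fails, because no signed
  sum of 1 and 2 is divisible by 5.\<close>

lemma weakly_balanced_5: "weakly_balanced (integer_mod_group 5)"
proof -
  interpret G: comm_group "integer_mod_group 5" by (rule abelian_integer_mod_group)
  have nz: "nonzero (integer_mod_group 5) = {1, 2, 3, 4}" by (auto simp: nonzero_integer_mod_group)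
  have c: "x \<in> carrier (integer_mod_group 5)" if "x \<in> {1, 2, 3, 4}" for x
    using that by (auto simp: carrier_integer_mod_group)
  have "half_system (integer_mod_group 5) {1, 3}"
    unfolding half_system_def nz using c by auto
  moreover have "finprod (integer_mod_group 5) (\<lambda>x. x [^]\<^bsub>integer_mod_group 5\<^esub> (if x = 1 then 1 else 3::nat)) {1, 3} = 0"
    using c by (simp add: carrier_integer_mod_group)
  ultimately show ?thesis
    unfolding weakly_balanced_def
    by (intro exI[of _ "{1, 3}"] exI[of _ "\<lambda>x. if x = 1 then 1 else 3"]) auto
qed

abbreviation (input) "Z33 \<equiv> integer_mod_group 3 \<times>\<times> integer_mod_group 3"

lemma comm_group_Z33: "comm_group Z33"
  by (intro group.group_comm_groupI DirProd_group group_integer_mod_group)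
    (auto simp: DirProd_def mult_integer_mod_group add.commute)

lemma Z33_simps:
  "carrier Z33 = {0, 1, 2} \<times> {0, 1, 2}" "\<one>\<^bsub>Z33\<^esub> = (0, 0)"
  "(a, b) \<otimes>\<^bsub>Z33\<^esub> (a', b') = ((a + a') mod 3, (b + b') mod 3)"
  "a \<in> {0, 1, 2} \<Longrightarrow> b \<in> {0, 1, 2} \<Longrightarrow> inv\<^bsub>Z33\<^esub> (a, b) = ((- a) mod 3, (- b) mod 3)"
proof -
  have c3: "carrier (integer_mod_group 3) = {0, 1, 2}" by (auto simp: carrier_integer_mod_group)
  show "carrier Z33 = {0, 1, 2} \<times> {0, 1, 2}" by (simp add: DirProd_def c3)
  show "\<one>\<^bsub>Z33\<^esub> = (0, 0)" "(a, b) \<otimes>\<^bsub>Z33\<^esub> (a', b') = ((a + a') mod 3, (b + b') mod 3)"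
    by (simp_all add: DirProd_def)
  show "a \<in> {0, 1, 2} \<Longrightarrow> b \<in> {0, 1, 2} \<Longrightarrow> inv\<^bsub>Z33\<^esub> (a, b) = ((- a) mod 3, (- b) mod 3)"
    by (subst inv_DirProd) (auto simp: c3)
qed

lemma nonzero_Z33: "nonzero Z33 = {(0,1), (0,2), (1,0), (1,1), (1,2), (2,0), (2,1), (2,2)}"
  unfolding nonzero_def Z33_simps by auto

lemma (in comm_group) finprod_four:
  assumes "distinct [a, b, c, d]" "\<And>x. x \<in> {a, b, c, d} \<Longrightarrow> f x \<in> carrier G"
  shows "finprod G f {a, b, c, d} = f a \<otimes> (f b \<otimes> (f c \<otimes> f d))"
  using assms by (simp add: Pi_def)

text \<open>The coefficient 3 annihilates \<open>(1, 2)\<close>, and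
  \<open>(1, 0), (0, 1), (2, 2)\<close> sum to 0.\<close>

lemma weakly_balanced_Z33: "weakly_balanced Z33"
proof -
  interpret G: comm_group Z33 by (rule comm_group_Z33)
  let ?R = "{(1,0), (0,1), (2,2), (1,2)} :: (int \<times> int) set"
  have "half_system Z33 ?R"
    unfolding half_system_def nonzero_Z33 by (auto simp: Z33_simps(4))
  moreover have "finprod Z33 (\<lambda>x. x [^]\<^bsub>Z33\<^esub> (if x = (1, 2) then 3 else 1::nat)) ?R = \<one>\<^bsub>Z33\<^esub>"
  proof -
    let ?f = "\<lambda>x. x [^]\<^bsub>Z33\<^esub> (if x = (1, 2) then 3 else 1::nat)"
    have c: "x \<in> carrier Z33" if "x \<in> ?R" for x using that unfolding Z33_simps by auto
    have "(1, 2) [^]\<^bsub>Z33\<^esub> (3::nat) = (0, 0)"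
      by (simp add: numeral_3_eq_3 Z33_simps)
    then have f: "?f (1, 0) = (1, 0)" "?f (0, 1) = (0, 1)" "?f (2, 2) = (2, 2)" "?f (1, 2) = (0, 0)"
      using c[THEN G.nat_pow_eone] by auto
    have "finprod Z33 ?f ?R = ?f (1, 0) \<otimes>\<^bsub>Z33\<^esub> (?f (0, 1) \<otimes>\<^bsub>Z33\<^esub> (?f (2, 2) \<otimes>\<^bsub>Z33\<^esub> ?f (1, 2)))"
      by (rule G.finprod_four) (use c in \<open>auto intro!: G.nat_pow_closed simp del: carrier_DirProd\<close>)
    then show ?thesis unfolding f by (simp only: Z33_simps) simp
  qed
  ultimately show ?thesis
    unfolding weakly_balanced_def
    by (intro exI[of _ ?R] exI[of _ "\<lambda>x. if x = (1, 2) then 3 else 1"]) auto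
qed

text \<open>A half-system consists of \<open>(a, 0), (0, b), (c, c), (e, -e)\<close> with all
  letters 1 or -1 modulo 3. Three such numbers sum to 0 only if they are equal, so the first
  coordinate gives \<open>c = e\<close> and the second \<open>c = -e\<close>.\<close>

lemma not_exists_MS0_Z33: "\<not> exists_MS0 Z33 (nonzero Z33) 2 4 4 2 1"
proof
  assume E: "exists_MS0 Z33 (nonzero Z33) 2 4 4 2 1"
  interpret G: comm_group Z33 by (rule comm_group_Z33)
  obtain R where R: "half_system Z33 R" "finprod Z33 (\<lambda>x. x) R = \<one>\<^bsub>Z33\<^esub>"
    using half_system_if_exists_MS0[OF comm_group_Z33 E] by blast
  have sub: "R \<subseteq> nonzero Z33" using R(1) by (simp add: half_system_def)
  have alt: "x \<in> R \<longleftrightarrow> inv\<^bsub>Z33\<^esub> x \<notin> R" if "x \<in> nonzero Z33" for x using R(1) that by (auto simp: half_system_def)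
  have alts: "(1,0) \<in> R \<longleftrightarrow> (2,0) \<notin> R" "(0,1) \<in> R \<longleftrightarrow> (0,2) \<notin> R" "(1,1) \<in> R \<longleftrightarrow> (2,2) \<notin> R"
    "(1,2) \<in> R \<longleftrightarrow> (2,1) \<notin> R"
    using alt[of "(1,0)"] alt[of "(0,1)"] alt[of "(1,1)"] alt[of "(1,2)"]
    by (auto simp: nonzero_Z33 Z33_simps(4))
  define a :: int where "a = (if (1,0) \<in> R then 1 else 2)"
  define b :: int where "b = (if (0,1) \<in> R then 1 else 2)"
  define c :: int where "c = (if (1,1) \<in> R then 1 else 2)"
  define e :: int where "e = (if (1,2) \<in> R then 1 else 2)"
  have abce: "a \<in> {1, 2}" "b \<in> {1, 2}" "c \<in> {1, 2}" "e \<in> {1, 2}" by (auto simp: a_def b_def c_def e_def)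
  have "x \<in> R \<longleftrightarrow> x \<in> {(a, 0), (0, b), (c, c), (e, 3 - e)}" for x
  proof (cases "x \<in> nonzero Z33")
    case True
    have memb: "(1,0) \<in> R \<longleftrightarrow> a = 1" "(2,0) \<in> R \<longleftrightarrow> a = 2" "(0,1) \<in> R \<longleftrightarrow> b = 1" "(0,2) \<in> R \<longleftrightarrow> b = 2"
      "(1,1) \<in> R \<longleftrightarrow> c = 1" "(2,2) \<in> R \<longleftrightarrow> c = 2" "(1,2) \<in> R \<longleftrightarrow> e = 1" "(2,1) \<in> R \<longleftrightarrow> e = 2"
      using alts by (simp_all add: a_def b_def c_def e_def)
    have ne: "a \<noteq> 0" "b \<noteq> 0" "c \<noteq> 0" "e \<noteq> 0" using abce by auto
    have "x = (0,1) \<or> x = (0,2) \<or> x = (1,0) \<or> x = (1,1) \<or> x = (1,2) \<or> x = (2,0) \<or> x = (2,1) \<or> x = (2,2)"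
      using True unfolding nonzero_Z33 by simp
    then show ?thesis by (elim disjE; simp add: memb; use ne in linarith)
  next
    case False
    moreover have "{(a, 0), (0, b), (c, c), (e, 3 - e)} \<subseteq> nonzero Z33"
      unfolding nonzero_Z33 using abce by auto
    ultimately show ?thesis using sub by blast
  qed
  then have Req: "R = {(a, 0), (0, b), (c, c), (e, 3 - e)}" by blast
  have cl: "(a, 0) \<in> carrier Z33" "(0, b) \<in> carrier Z33" "(c, c) \<in> carrier Z33" "(e, 3 - e) \<in> carrier Z33"
    using abce unfolding Z33_simps by auto
  have "finprod Z33 (\<lambda>x. x) R = (a, 0) \<otimes>\<^bsub>Z33\<^esub> ((0, b) \<otimes>\<^bsub>Z33\<^esub> ((c, c) \<otimes>\<^bsub>Z33\<^esub> (e, 3 - e)))"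
    unfolding Req by (rule G.finprod_four) (use cl abce in \<open>auto simp del: carrier_DirProd\<close>)
  then have "(a + (c + e) mod 3) mod 3 = 0" "((b + (c + (3 - e)) mod 3) mod 3) mod 3 = 0"
    using R(2) by (simp_all add: Z33_simps)
  then show False using abce by auto
qed


section \<open>Lifting half-systems from a quotient\<close>

lemma (in comm_group) finprod_inv:
  assumes "finite A" "f \<in> A \<rightarrow> carrier G"
  shows "(\<Otimes>x\<in>A. inv (f x)) = inv (finprod G f A)"
  using assms
proof (induction rule: finite_induct)
  case (insert x A)
  then show ?case by (simp add: Pi_def inv_mult)
qed simp

lemma (in group) subgroup_pow_card:
  assumes "subgroup K G" "k \<in> K"
  shows "k [^] card K = \<one>"
proof -
  interpret K: group "G\<lparr>carrier := K\<rparr>" using subgroup_imp_group[OF assms(1)] .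
  have "k [^]\<^bsub>G\<lparr>carrier := K\<rparr>\<^esub> order (G\<lparr>carrier := K\<rparr>) = \<one>\<^bsub>G\<lparr>carrier := K\<rparr>\<^esub>"
    by (rule K.pow_order_eq_1) (simp add: assms(2))
  then show ?thesis by (simp add: order_def flip: nat_pow_consistent)
qed

text \<open>Over each class of the half-system of the quotient the signs are distributed with the prescribed
  surplus \<open>\<kappa>\<close>, so the total lies in the kernel; translating the negative part of one coset with
  surplus 1 by \<open>k\<close> changes the total by the factor \<open>k\<close>.\<close>

lemma half_system_lift:
  fixes G :: "('a, 'b) monoid_scheme" and H :: "('c, 'd) monoid_scheme"
  assumes G: "comm_group G" and H: "comm_group H" and fin: "finite (carrier G)" and odd: "odd (order G)"
    and f: "f \<in> hom G H" "f ` carrier G = carrier H" and ker: "\<exists>x\<in>carrier G. x \<noteq> \<one>\<^bsub>G\<^esub> \<and> f x = \<one>\<^bsub>H\<^esub>"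
    and weak: "weakly_balanced H"
  shows "\<exists>R. half_system G R \<and> finprod G (\<lambda>x. x) R = \<one>\<^bsub>G\<^esub>"
proof -
  interpret G: comm_group G by (rule G)
  interpret H: comm_group H by (rule H)
  interpret f: group_hom G H f using f(1) by unfold_locales
  obtain R \<kappa> y0 where R: "half_system H R" "\<And>y. y \<in> R \<Longrightarrow> \<kappa> y = 1 \<or> \<kappa> y = (3::nat)" "y0 \<in> R" "\<kappa> y0 = 1"
    "finprod H (\<lambda>y. y [^]\<^bsub>H\<^esub> \<kappa> y) R = \<one>\<^bsub>H\<^esub>"
    using weak unfolding weakly_balanced_def by blast
  have finH: "finite (carrier H)" using fin f(2) by (metis finite_imageI)
  have Rc: "y \<in> carrier H" "y \<noteq> \<one>\<^bsub>H\<^esub>" if "y \<in> R" for y using R(1) that by (auto simp: half_system_def nonzero_def)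
  have finR: "finite R" using Rc finH by (meson finite_subset subsetI)
  have alt: "y \<in> R \<longleftrightarrow> inv\<^bsub>H\<^esub> y \<notin> R" if "y \<in> carrier H" "y \<noteq> \<one>\<^bsub>H\<^esub>" for y
  proof -
    have "y \<in> nonzero H" using that by (simp add: nonzero_def)
    with R(1) show ?thesis unfolding half_system_def by (elim conjE bspec)
  qed
  define K where "K = {x \<in> carrier G. f x = \<one>\<^bsub>H\<^esub>}"
  have K: "subgroup K G" using f.subgroup_kernel by (simp add: K_def kernel_def)
  define q where "q = card K"
  have "q dvd order G" unfolding q_def using G.lagrange[OF K] by (metis dvd_triv_right)
  then have oddq: "odd q" using odd by (meson dvd_trans)
  have finK: "finite K" using fin by (simp add: K_def)
  have q3: "3 \<le> q"
  proof -
    obtain x where x: "x \<in> carrier G" "x \<noteq> \<one>\<^bsub>G\<^esub>" "f x = \<one>\<^bsub>H\<^esub>" using ker by blast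
    have "card {x, \<one>\<^bsub>G\<^esub>} \<le> q" unfolding q_def by (rule card_mono[OF finK]) (use x in \<open>auto simp: K_def\<close>)
    then have "2 \<le> q" using x(2) by simp
    then show ?thesis using oddq by presburger
  qed
  define Fb where "Fb y = {x \<in> carrier G. f x = y}" for y
  have finFb: "finite (Fb y)" for y using fin by (simp add: Fb_def)
  have cardFb: "card (Fb y) = q" if "y \<in> carrier H" for y
  proof -
    have "y \<in> f ` carrier G" unfolding f(2) by (rule that)
    then obtain x0 where x0: "x0 \<in> carrier G" "f x0 = y" by blast
    have "bij_betw (\<lambda>k. x0 \<otimes>\<^bsub>G\<^esub> k) K (Fb y)"
      by (rule bij_betw_byWitness[where f' = "\<lambda>x. inv\<^bsub>G\<^esub> x0 \<otimes>\<^bsub>G\<^esub> x"])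
        (use x0 in \<open>auto simp: K_def Fb_def G.mult_inv_cancel\<close>)
    then show ?thesis by (simp add: bij_betw_same_card q_def)
  qed
  have "\<exists>W. W \<subseteq> Fb y \<and> 2 * card W + \<kappa> y = q" if y: "y \<in> R" for y
  proof -
    have "(q - \<kappa> y) div 2 \<le> card (Fb y)" using cardFb[OF Rc(1)[OF y]] by simp
    then obtain W where "W \<subseteq> Fb y" "card W = (q - \<kappa> y) div 2" by (rule obtain_subset_with_card_n)
    \<comment> \<open>\<open>q\<close> is odd and at least 3, so \<open>q - \<kappa> y\<close> is
      even and the subtraction is not truncated.\<close>
    moreover have "2 * ((q - \<kappa> y) div 2) + \<kappa> y = q" using R(2)[OF y] oddq q3 by presburger
    ultimately show ?thesis by auto
  qed
  then obtain W where W: "\<And>y. y \<in> R \<Longrightarrow> W y \<subseteq> Fb y" "\<And>y. y \<in> R \<Longrightarrow> 2 * card (W y) + \<kappa> y = q" by metis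
  \<comment> \<open>The choice depends only on the unordered pair, so \<open>x\<close> and its
    inverse get the same representative; on the kernel any half-system will do.\<close>
  define pick where "pick x = (SOME y. y \<in> {x, inv\<^bsub>G\<^esub> x})" for x
  define RK where "RK = {x \<in> K. x \<noteq> \<one>\<^bsub>G\<^esub> \<and> pick x = x}"
  have RK: "x \<in> RK \<longleftrightarrow> inv\<^bsub>G\<^esub> x \<notin> RK" if x: "x \<in> K" "x \<noteq> \<one>\<^bsub>G\<^esub>" for x
  proof -
    have xc: "x \<in> carrier G" using x by (simp add: K_def)
    have ix: "inv\<^bsub>G\<^esub> x \<in> K" "inv\<^bsub>G\<^esub> x \<noteq> \<one>\<^bsub>G\<^esub>" using x by (auto simp: K_def)
    have "pick x \<in> {x, inv\<^bsub>G\<^esub> x}" unfolding pick_def by (rule someI[of _ x]) simp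
    moreover have "pick (inv\<^bsub>G\<^esub> x) = pick x" using xc by (simp add: pick_def disj_commute)
    moreover have "inv\<^bsub>G\<^esub> x \<noteq> x" using G.odd_order_self_inverse[OF fin odd xc] x(2) by blast
    ultimately show ?thesis using x ix by (auto simp: RK_def)
  qed
  \<comment> \<open>Each \<open>y \<in> R\<close> contributes its fibre without \<open>V y\<close>,
    together with the inverses of \<open>V y\<close>; the last clause describes the latter from the
    fibre over the inverse of \<open>y\<close>.\<close>
  define sys where "sys V = {x \<in> carrier G. if f x = \<one>\<^bsub>H\<^esub> then x \<in> RK
    else if f x \<in> R then x \<notin> V (f x) else inv\<^bsub>G\<^esub> x \<in> V (inv\<^bsub>H\<^esub> (f x))}" for V :: "'c \<Rightarrow> 'a set"
  have hs: "half_system G (sys V)" for V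
    unfolding half_system_def
  proof (intro conjI ballI subsetI)
    show "x \<in> nonzero G" if "x \<in> sys V" for x
      using that by (auto simp: sys_def nonzero_def RK_def)
    fix x assume "x \<in> nonzero G"
    then have x: "x \<in> carrier G" "x \<noteq> \<one>\<^bsub>G\<^esub>" by (auto simp: nonzero_def)
    show "x \<in> sys V \<longleftrightarrow> inv\<^bsub>G\<^esub> x \<notin> sys V"
    proof (cases "f x = \<one>\<^bsub>H\<^esub>")
      case True
      then have "x \<in> sys V \<longleftrightarrow> x \<in> RK" "inv\<^bsub>G\<^esub> x \<in> sys V \<longleftrightarrow> inv\<^bsub>G\<^esub> x \<in> RK" using x(1) by (simp_all add: sys_def)
      then show ?thesis using RK[of x] x True by (simp only: K_def mem_Collect_eq simp_thms)
    next
      case False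
      have fx: "f x \<in> carrier H" "inv\<^bsub>H\<^esub> (f x) \<noteq> \<one>\<^bsub>H\<^esub>" using x(1) False by simp_all
      show ?thesis
      proof (cases "f x \<in> R")
        case True
        then have "inv\<^bsub>H\<^esub> (f x) \<notin> R" using alt[OF fx(1) False] by blast
        then have "x \<in> sys V \<longleftrightarrow> x \<notin> V (f x)" "inv\<^bsub>G\<^esub> x \<in> sys V \<longleftrightarrow> x \<in> V (f x)"
          using True False fx x(1) by (simp_all add: sys_def)
        then show ?thesis by blast
      next
        case nR: False
        then have "inv\<^bsub>H\<^esub> (f x) \<in> R" using alt[OF fx(1) False] by blast
        then have "x \<in> sys V \<longleftrightarrow> inv\<^bsub>G\<^esub> x \<in> V (inv\<^bsub>H\<^esub> (f x))" "inv\<^bsub>G\<^esub> x \<in> sys V \<longleftrightarrow> inv\<^bsub>G\<^esub> x \<notin> V (inv\<^bsub>H\<^esub> (f x))"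
          using nR False fx x(1) by (simp_all add: sys_def)
        then show ?thesis by blast
      qed
    qed
  qed
  define Q where "Q A = finprod G (\<lambda>x. x) A" for A
  have Qc: "Q A \<in> carrier G" if "A \<subseteq> carrier G" for A unfolding Q_def by (rule G.finprod_closed) (use that in auto)
  have Fbc: "Fb y \<subseteq> carrier G" for y by (auto simp: Fb_def)
  \<comment> \<open>Omitting \<open>V y\<close> and adding its inverses divides the product of the
    fibre by the square of the product of \<open>V y\<close>. Under \<open>f\<close> the exponent of
    \<open>y\<close> becomes \<open>q - 2 * card (V y)\<close>, which is \<open>\<kappa> y\<close>
    for \<open>V = W\<close>.\<close>
  define tm where "tm V y = Q (Fb y) \<otimes>\<^bsub>G\<^esub> (inv\<^bsub>G\<^esub> Q (V y) \<otimes>\<^bsub>G\<^esub> inv\<^bsub>G\<^esub> Q (V y))" for V y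
  have tmc: "tm V y \<in> carrier G" if "V y \<subseteq> Fb y" for V y
  proof -
    have "V y \<subseteq> carrier G" using that Fbc by blast
    then show ?thesis unfolding tm_def using Qc[OF Fbc] Qc by simp
  qed
  have prod: "Q (sys V) = Q RK \<otimes>\<^bsub>G\<^esub> (\<Otimes>\<^bsub>G\<^esub>y\<in>R. tm V y)" if V: "\<And>y. y \<in> R \<Longrightarrow> V y \<subseteq> Fb y" for V
  proof -
    define \<phi> where "\<phi> x = (if f x = \<one>\<^bsub>H\<^esub> \<or> f x \<in> R then f x else inv\<^bsub>H\<^esub> (f x))" for x
    have sysc: "sys V \<subseteq> carrier G" by (auto simp: sys_def)
    have "Q (sys V) = (\<Otimes>\<^bsub>G\<^esub>y\<in>insert \<one>\<^bsub>H\<^esub> R. Q {x \<in> sys V. \<phi> x = y})"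
      unfolding Q_def
    proof (rule G.finprod_fibres)
      show "finite (sys V)" using sysc fin finite_subset by blast
      show "\<phi> ` sys V \<subseteq> insert \<one>\<^bsub>H\<^esub> R"
      proof clarify
        fix x assume "x \<in> sys V" "\<phi> x \<notin> R"
        then have "f x \<in> carrier H" using sysc by auto
        then show "\<phi> x = \<one>\<^bsub>H\<^esub>" using alt[of "f x"] \<open>\<phi> x \<notin> R\<close> by (auto simp: \<phi>_def split: if_splits)
      qed
    qed (use finR sysc in auto)
    also have "\<dots> = Q {x \<in> sys V. \<phi> x = \<one>\<^bsub>H\<^esub>} \<otimes>\<^bsub>G\<^esub> (\<Otimes>\<^bsub>G\<^esub>y\<in>R. Q {x \<in> sys V. \<phi> x = y})"
      by (rule G.finprod_insert[OF finR]) (use Rc sysc in \<open>auto intro!: Qc\<close>)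
    also have "{x \<in> sys V. \<phi> x = \<one>\<^bsub>H\<^esub>} = RK"
    proof (intro equalityI subsetI)
      fix x assume "x \<in> {x \<in> sys V. \<phi> x = \<one>\<^bsub>H\<^esub>}"
      then have x: "x \<in> sys V" "\<phi> x = \<one>\<^bsub>H\<^esub>" by auto
      then have "x \<in> carrier G" using sysc by blast
      then have "f x = \<one>\<^bsub>H\<^esub>" using x(2) by (auto simp: \<phi>_def split: if_splits)
      then show "x \<in> RK" using x(1) by (simp add: sys_def)
    qed (auto simp: RK_def K_def sys_def \<phi>_def)
    also have "(\<Otimes>\<^bsub>G\<^esub>y\<in>R. Q {x \<in> sys V. \<phi> x = y}) = (\<Otimes>\<^bsub>G\<^esub>y\<in>R. tm V y)"
    proof (rule G.finprod_cong'[OF refl])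
      fix y assume y: "y \<in> R"
      have yi: "inv\<^bsub>H\<^esub> y \<notin> R" "inv\<^bsub>H\<^esub> y \<noteq> \<one>\<^bsub>H\<^esub>" using alt[OF Rc[OF y]] Rc[OF y] y by simp_all
      have Vc: "V y \<subseteq> carrier G" and Vf: "\<And>x. x \<in> V y \<Longrightarrow> f x = y" using V[OF y] by (auto simp: Fb_def)
      have eq: "{x \<in> sys V. \<phi> x = y} = (Fb y - V y) \<union> m_inv G ` V y"
      proof (intro equalityI subsetI)
        fix x assume "x \<in> {x \<in> sys V. \<phi> x = y}"
        then have x: "x \<in> sys V" "\<phi> x = y" by auto
        have xc: "x \<in> carrier G" using x sysc by blast
        show "x \<in> (Fb y - V y) \<union> m_inv G ` V y"
        proof (cases "f x = \<one>\<^bsub>H\<^esub> \<or> f x \<in> R")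
          case True
          then have "f x = y" using x(2) by (simp add: \<phi>_def)
          then show ?thesis using x(1) y Rc[OF y] xc by (auto simp: sys_def Fb_def)
        next
          case False
          then have "inv\<^bsub>H\<^esub> (f x) = y" using x(2) by (simp add: \<phi>_def)
          then have "inv\<^bsub>G\<^esub> x \<in> V y" using x(1) False by (auto simp: sys_def)
          then show ?thesis using xc by (metis G.inv_inv UnI2 imageI)
        qed
      next
        fix x assume "x \<in> (Fb y - V y) \<union> m_inv G ` V y"
        then show "x \<in> {x \<in> sys V. \<phi> x = y}"
        proof
          assume "x \<in> Fb y - V y"
          then show ?thesis using y Rc[OF y] by (auto simp: sys_def \<phi>_def Fb_def)
        next
          assume "x \<in> m_inv G ` V y"
          then obtain z where z: "z \<in> V y" "x = inv\<^bsub>G\<^esub> z" by blast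
          have zc: "z \<in> carrier G" "f z = y" using z Vc Vf by auto
          have "f x = inv\<^bsub>H\<^esub> y" "inv\<^bsub>G\<^esub> x = z" using z zc by auto
          then show ?thesis using yi z zc Rc[OF y] by (auto simp: sys_def \<phi>_def)
        qed
      qed
      have "f x \<noteq> y" if x: "x \<in> m_inv G ` V y" for x
      proof -
        obtain z where z: "z \<in> V y" "x = inv\<^bsub>G\<^esub> z" using x by blast
        then have "z \<in> carrier G" "f z = y" using Vc Vf by auto
        then have "f x = inv\<^bsub>H\<^esub> y" using z(2) by simp
        then show ?thesis using yi(1) y by auto
      qed
      then have dis: "(Fb y - V y) \<inter> m_inv G ` V y = {}" by (auto simp: Fb_def)
      have finV: "finite (V y)" using V[OF y] finFb finite_subset by blast
      have "Q ((Fb y - V y) \<union> m_inv G ` V y) = Q (Fb y - V y) \<otimes>\<^bsub>G\<^esub> Q (m_inv G ` V y)"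
        unfolding Q_def by (rule G.finprod_Un_disjoint) (use finFb[of y] finV dis Fbc[of y] Vc in auto)
      also have "Q (m_inv G ` V y) = inv\<^bsub>G\<^esub> Q (V y)"
      proof -
        have "Q (m_inv G ` V y) = (\<Otimes>\<^bsub>G\<^esub>x\<in>V y. inv\<^bsub>G\<^esub> x)"
          unfolding Q_def by (rule G.finprod_reindex) (use Vc in \<open>auto simp: inj_on_def subset_iff\<close>)
        also have "\<dots> = inv\<^bsub>G\<^esub> Q (V y)" unfolding Q_def by (rule G.finprod_inv[OF finV]) (use Vc in auto)
        finally show ?thesis .
      qed
      also have "Q (Fb y - V y) = Q (Fb y) \<otimes>\<^bsub>G\<^esub> inv\<^bsub>G\<^esub> Q (V y)"
      proof -
        have "Q (Fb y) = Q ((Fb y - V y) \<union> V y)" using V[OF y] by (simp add: Un_absorb2)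
        also have "\<dots> = Q (Fb y - V y) \<otimes>\<^bsub>G\<^esub> Q (V y)"
          unfolding Q_def by (rule G.finprod_Un_disjoint) (use finFb[of y] finV Fbc[of y] Vc in auto)
        finally have e: "Q (Fb y) = Q (Fb y - V y) \<otimes>\<^bsub>G\<^esub> Q (V y)" .
        have "Q (Fb y - V y) \<in> carrier G" by (rule Qc) (use Fbc in blast)
        then show ?thesis unfolding e using Qc[OF Vc] by (simp add: G.m_assoc)
      qed
      finally show "Q {x \<in> sys V. \<phi> x = y} = tm V y"
        unfolding eq tm_def using Qc[OF Vc] Qc[OF Fbc] by (simp add: G.m_assoc)
    qed (use V tmc in auto)
    finally show ?thesis .
  qed
  have finW: "finite (W y)" if "y \<in> R" for y using W(1)[OF that] finFb finite_subset by blast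
  have fQ: "f (Q A) = y [^]\<^bsub>H\<^esub> card A" if A: "A \<subseteq> Fb y" "y \<in> carrier H" for A y
  proof -
    have Ac: "A \<subseteq> carrier G" "finite A" using A Fbc finFb finite_subset by blast+
    have "f (Q A) = finprod H (\<lambda>x. f x) A"
      unfolding Q_def by (rule hom_finprod[OF G H f(1) Ac(2)]) (use Ac in auto)
    also have "\<dots> = finprod H (\<lambda>_. y) A"
      by (rule H.finprod_cong') (use A in \<open>auto simp: Fb_def\<close>)
    finally show ?thesis using H.finprod_const[OF A(2)] by simp
  qed
  have ftm: "f (tm W y) = y [^]\<^bsub>H\<^esub> \<kappa> y" if y: "y \<in> R" for y
  proof -
    have yc: "y \<in> carrier H" using Rc y by blast
    have Wc: "Q (W y) \<in> carrier G" using W(1)[OF y] Fbc by (intro Qc) blast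
    define z where "z = y [^]\<^bsub>H\<^esub> card (W y)"
    have zc: "z \<in> carrier H" using yc by (simp add: z_def)
    have "f (tm W y) = y [^]\<^bsub>H\<^esub> q \<otimes>\<^bsub>H\<^esub> (inv\<^bsub>H\<^esub> z \<otimes>\<^bsub>H\<^esub> inv\<^bsub>H\<^esub> z)"
      unfolding tm_def using Wc Qc[OF Fbc, of y] fQ[OF _ yc, of "Fb y"] fQ[OF W(1)[OF y] yc] cardFb[OF yc]
      by (simp add: z_def)
    also have "q = \<kappa> y + (card (W y) + card (W y))" using W(2)[OF y] by simp
    also have "y [^]\<^bsub>H\<^esub> (\<kappa> y + (card (W y) + card (W y))) = y [^]\<^bsub>H\<^esub> \<kappa> y \<otimes>\<^bsub>H\<^esub> (z \<otimes>\<^bsub>H\<^esub> z)"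
      using yc by (simp add: z_def H.nat_pow_mult)
    also have "y [^]\<^bsub>H\<^esub> \<kappa> y \<otimes>\<^bsub>H\<^esub> (z \<otimes>\<^bsub>H\<^esub> z) \<otimes>\<^bsub>H\<^esub> (inv\<^bsub>H\<^esub> z \<otimes>\<^bsub>H\<^esub> inv\<^bsub>H\<^esub> z) = y [^]\<^bsub>H\<^esub> \<kappa> y"
      using yc zc by (simp add: H.m_assoc H.mult_inv_cancel)
    finally show ?thesis .
  qed
  have prodW: "Q (sys W) = Q RK \<otimes>\<^bsub>G\<^esub> (\<Otimes>\<^bsub>G\<^esub>y\<in>R. tm W y)" by (rule prod) (rule W(1))
  define P where "P = Q (sys W)"
  have RKc: "RK \<subseteq> K" by (auto simp: RK_def)
  have PK: "P \<in> K"
  proof -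
    have RKG: "RK \<subseteq> carrier G" using RKc by (auto simp: K_def)
    have fRK: "f (Q RK) = \<one>\<^bsub>H\<^esub>"
      using fQ[of RK "\<one>\<^bsub>H\<^esub>"] RKc by (simp add: K_def Fb_def)
    have tmW: "(\<lambda>y. tm W y) \<in> R \<rightarrow> carrier G" using W(1) tmc by auto
    have "f (\<Otimes>\<^bsub>G\<^esub>y\<in>R. tm W y) = (\<Otimes>\<^bsub>H\<^esub>y\<in>R. f (tm W y))"
      by (rule hom_finprod[OF G H f(1) finR tmW])
    also have "\<dots> = (\<Otimes>\<^bsub>H\<^esub>y\<in>R. y [^]\<^bsub>H\<^esub> \<kappa> y)"
      by (rule H.finprod_cong'[OF refl]) (use ftm Rc in auto)
    finally have "f P = \<one>\<^bsub>H\<^esub>"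
      unfolding P_def prodW using fRK R(5) Qc[OF RKG] G.finprod_closed[OF tmW] by simp
    moreover have "P \<in> carrier G" unfolding P_def by (rule Qc) (auto simp: sys_def)
    ultimately show ?thesis by (simp add: K_def)
  qed
  define k where "k = inv\<^bsub>G\<^esub> P"
  have kK: "k \<in> K" unfolding k_def using K PK by (simp add: subgroup.m_inv_closed)
  have kc: "k \<in> carrier G" using kK by (simp add: K_def)
  \<comment> \<open>Translation by a kernel element keeps the set inside its coset.\<close>
  define W' where "W' = W(y0 := (\<lambda>x. x \<otimes>\<^bsub>G\<^esub> k) ` W y0)"
  have W0: "W y0 \<subseteq> carrier G" using W(1)[OF R(3)] Fbc by blast
  have W': "W' y \<subseteq> Fb y" if "y \<in> R" for y
    using W(1)[OF that] W(1)[OF R(3)] kK Rc(1)[OF R(3)] by (auto simp: W'_def K_def Fb_def)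
  define w where "w = card (W y0)"
  have qw: "q = Suc (w + w)" using W(2)[OF R(3)] R(4) by (simp add: w_def)
  have "Q (W' y0) = Q (W y0) \<otimes>\<^bsub>G\<^esub> k [^]\<^bsub>G\<^esub> w"
  proof -
    have "Q (W' y0) = (\<Otimes>\<^bsub>G\<^esub>x\<in>W y0. x \<otimes>\<^bsub>G\<^esub> k)"
      unfolding Q_def W'_def fun_upd_same
      by (rule G.finprod_reindex) (use W0 kc in \<open>auto simp: inj_on_def subset_iff\<close>)
    also have "\<dots> = Q (W y0) \<otimes>\<^bsub>G\<^esub> (\<Otimes>\<^bsub>G\<^esub>x\<in>W y0. k)"
      unfolding Q_def by (rule G.finprod_multf) (use W0 kc in auto)
    finally show ?thesis by (simp add: w_def G.finprod_const[OF kc])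
  qed
  \<comment> \<open>The translation contributes \<open>k\<close> to the power
    \<open>- 2 * w\<close>; since \<open>q = 2 * w + 1\<close> and \<open>k\<close> to the power
    \<open>q\<close> is 1, this is \<open>k\<close> itself.\<close>
  have tm0: "tm W' y0 = tm W y0 \<otimes>\<^bsub>G\<^esub> k"
  proof -
    have kw: "k [^]\<^bsub>G\<^esub> w \<in> carrier G" using kc by simp
    have "k [^]\<^bsub>G\<^esub> q = \<one>\<^bsub>G\<^esub>" unfolding q_def by (rule G.subgroup_pow_card[OF K kK])
    then have "(k [^]\<^bsub>G\<^esub> w \<otimes>\<^bsub>G\<^esub> k [^]\<^bsub>G\<^esub> w) \<otimes>\<^bsub>G\<^esub> k = \<one>\<^bsub>G\<^esub>" unfolding qw using kc by (simp add: G.nat_pow_mult)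
    then have "inv\<^bsub>G\<^esub> (k [^]\<^bsub>G\<^esub> w \<otimes>\<^bsub>G\<^esub> k [^]\<^bsub>G\<^esub> w) = k"
      using kc kw by (intro G.inv_equality) (simp_all add: G.m_comm)
    then have ik: "inv\<^bsub>G\<^esub> (k [^]\<^bsub>G\<^esub> w) \<otimes>\<^bsub>G\<^esub> inv\<^bsub>G\<^esub> (k [^]\<^bsub>G\<^esub> w) = k" using kw by (simp add: G.inv_mult)
    have "tm W' y0 = tm W y0 \<otimes>\<^bsub>G\<^esub> (inv\<^bsub>G\<^esub> (k [^]\<^bsub>G\<^esub> w) \<otimes>\<^bsub>G\<^esub> inv\<^bsub>G\<^esub> (k [^]\<^bsub>G\<^esub> w))"
      unfolding tm_def \<open>Q (W' y0) = Q (W y0) \<otimes>\<^bsub>G\<^esub> k [^]\<^bsub>G\<^esub> w\<close>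
      using Qc[OF W0] Qc[OF Fbc, of y0] kw by (simp add: G.inv_mult G.m_ac)
    then show ?thesis unfolding ik .
  qed
  have "Q (sys W') = P \<otimes>\<^bsub>G\<^esub> k"
  proof -
    have ins: "R = insert y0 (R - {y0})" using R(3) by blast
    have split: "(\<Otimes>\<^bsub>G\<^esub>y\<in>R. tm V y) = tm V y0 \<otimes>\<^bsub>G\<^esub> (\<Otimes>\<^bsub>G\<^esub>y\<in>R - {y0}. tm V y)"
      if V: "\<And>y. y \<in> R \<Longrightarrow> V y \<subseteq> Fb y" for V
      by (subst ins, rule G.finprod_insert) (use finR tmc V R(3) in auto)
    have splitW: "(\<Otimes>\<^bsub>G\<^esub>y\<in>R. tm W y) = tm W y0 \<otimes>\<^bsub>G\<^esub> (\<Otimes>\<^bsub>G\<^esub>y\<in>R - {y0}. tm W y)" by (rule split) (rule W(1))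
    have splitW': "(\<Otimes>\<^bsub>G\<^esub>y\<in>R. tm W' y) = tm W' y0 \<otimes>\<^bsub>G\<^esub> (\<Otimes>\<^bsub>G\<^esub>y\<in>R - {y0}. tm W' y)" by (rule split) (rule W')
    have prodW': "Q (sys W') = Q RK \<otimes>\<^bsub>G\<^esub> (\<Otimes>\<^bsub>G\<^esub>y\<in>R. tm W' y)" by (rule prod) (rule W')
    have rest: "(\<Otimes>\<^bsub>G\<^esub>y\<in>R - {y0}. tm W' y) = (\<Otimes>\<^bsub>G\<^esub>y\<in>R - {y0}. tm W y)"
      by (rule G.finprod_cong'[OF refl]) (use tmc W(1) in \<open>auto simp: W'_def tm_def\<close>)
    have c: "Q RK \<in> carrier G" "tm W y0 \<in> carrier G" "(\<Otimes>\<^bsub>G\<^esub>y\<in>R - {y0}. tm W y) \<in> carrier G"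
      using RKc tmc[of W, OF W(1)[OF R(3)]] W(1) tmc by (auto intro!: Qc G.finprod_closed simp: K_def)
    show ?thesis
      unfolding P_def prodW prodW' splitW splitW' rest tm0
      using c kc by (simp add: G.m_ac)
  qed
  also have "\<dots> = \<one>\<^bsub>G\<^esub>" using PK by (simp add: k_def K_def)
  finally show ?thesis using hs unfolding Q_def by blast
qed


section \<open>Groups of odd order and their quotients\<close>

lemma (in comm_group) cyclic_iso:
  assumes fin: "finite (carrier G)" and a: "a \<in> carrier G" "ord a = order G"
  shows "integer_mod_group (order G) \<cong> G"
proof -
  have N0: "0 < order G" using fin by (auto simp: order_def card_gt_0_iff)
  let ?Z = "integer_mod_group (order G)"
  have "(\<lambda>z::int. a [^] z) \<in> hom ?Z G"
  proof (rule homI)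
    show "a [^] (x \<otimes>\<^bsub>?Z\<^esub> y) = a [^] x \<otimes> a [^] y" for x y :: int
    proof -
      have "a [^] ((x + y) mod int (order G)) = a [^] (x + y)"
        using int_pow_eq[OF a(1)] a(2) by (simp add: minus_mod_eq_mult_div flip: mod_eq_dvd_iff)
      then show ?thesis using a(1) by (simp add: int_pow_mult)
    qed
  qed (use a in simp)
  moreover have inj: "inj_on (\<lambda>z::int. a [^] z) (carrier ?Z)"
  proof (rule inj_onI)
    fix x y :: int assume xy: "x \<in> carrier ?Z" "y \<in> carrier ?Z" "a [^] x = a [^] y"
    then have "int (order G) dvd y - x" using int_pow_eq[OF a(1)] a(2) by simp
    then have "y = x" by (rule dvd_diff_imp_eq) (use xy N0 in \<open>auto simp: carrier_integer_mod_group\<close>)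
    then show "x = y" by simp
  qed
  moreover have "(\<lambda>z::int. a [^] z) ` carrier ?Z = carrier G"
  proof (rule card_subset_eq[OF fin])
    show "card ((\<lambda>z::int. a [^] z) ` carrier ?Z) = card (carrier G)"
      unfolding card_image[OF inj] using order_integer_mod_group[OF N0] by (simp add: order_def)
  qed (use a in auto)
  ultimately have "(\<lambda>z::int. a [^] z) \<in> iso ?Z G" by (simp add: iso_def bij_betw_def)
  then show ?thesis by (auto simp: is_iso_def)
qed

text \<open>The order is divisible by 3, so there is an element of order 3; the hypothesis then
  gives order 9 and exponent 3, and an element outside the subgroup generated by \<open>a\<close>
  completes a basis.\<close>

lemma (in comm_group) elementary_9_iso:
  assumes fin: "finite (carrier G)" and nt: "order G \<noteq> 1"
    and ords: "\<And>a. a \<in> carrier G \<Longrightarrow> a \<noteq> \<one> \<Longrightarrow> order G = 3 * ord a"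
  shows "Z33 \<cong> G"
proof -
  have "carrier G \<noteq> {\<one>}" using nt by (auto simp: order_def)
  then obtain a0 where "a0 \<in> carrier G" "a0 \<noteq> \<one>" using one_closed by blast
  then have "order G = 3 ^ 1 * ord a0" using ords by simp
  \<comment> \<open>Sylow's theorem with exponent 1, in the role of Cauchy's theorem.\<close>
  then obtain S where S: "subgroup S G" "card S = 3 ^ 1"
    using sylow_thm[of 3 G 1 "ord a0"] fin is_group by auto
  have "S \<noteq> {\<one>}" using S(2) by auto
  then obtain a where a: "a \<in> S" "a \<noteq> \<one>" using subgroup.one_closed[OF S(1)] by blast
  have ac: "a \<in> carrier G" using a(1) subgroup.subset[OF S(1)] by blast
  have "a [^] (3::nat) = \<one>" using subgroup_pow_card[OF S(1) a(1)] S(2) by simp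
  then have "ord a dvd 3" using pow_eq_id[OF ac] by simp
  moreover have "ord a \<noteq> 1" using ord_eq_1[OF ac] a(2) by simp
  moreover from \<open>ord a dvd 3\<close> have "ord a \<le> 3" by (simp add: dvd_imp_le)
  then have "ord a = 0 \<or> ord a = 1 \<or> ord a = 2 \<or> ord a = 3" by linarith
  ultimately have orda: "ord a = 3" by (elim disjE) simp_all
  have ord9: "order G = 9" using ords[OF ac a(2)] orda by simp
  have ord3: "ord x = 3" if "x \<in> carrier G" "x \<noteq> \<one>" for x using ords[OF that] ord9 by simp
  let ?Y = "generate G {a}"
  have Y: "subgroup ?Y G" using ac by (intro generate_is_subgroup) simp
  have "card ?Y = 3" using generate_pow_card[OF ac] orda by simp
  then have "carrier G \<noteq> ?Y" using ord9 by (auto simp: order_def)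
  then obtain b where b: "b \<in> carrier G" "b \<notin> ?Y" using subgroup.subset[OF Y] by blast
  have "b \<noteq> \<one>" using b(2) subgroup.one_closed[OF Y] by auto
  then have ordb: "ord b = 3" using ord3 b by simp
  define \<phi> where "\<phi> = (\<lambda>(i::int, j::int). a [^] i \<otimes> b [^] j)"
  have red: "x [^] ((i + j) mod 3) = x [^] i \<otimes> x [^] j" if "x \<in> carrier G" "ord x = 3" for x and i j :: int
  proof -
    have "x [^] ((i + j) mod 3) = x [^] (i + j)"
      using int_pow_eq[OF that(1)] that(2) by (simp add: minus_mod_eq_mult_div flip: mod_eq_dvd_iff)
    then show ?thesis using that(1) by (simp add: int_pow_mult)
  qed
  have "\<phi> \<in> hom Z33 G"
  proof (rule homI)
    show "\<phi> x \<in> carrier G" for x using ac b by (simp add: \<phi>_def case_prod_beta)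
    fix x y :: "int \<times> int"
    obtain i j i' j' where xy: "x = (i, j)" "y = (i', j')" by (cases x, cases y)
    show "\<phi> (x \<otimes>\<^bsub>Z33\<^esub> y) = \<phi> x \<otimes> \<phi> y"
      unfolding xy Z33_simps(3) \<phi>_def prod.case red[OF ac orda] red[OF b(1) ordb]
      using ac b(1) by (simp add: m_ac)
  qed
  moreover have inj: "inj_on \<phi> (carrier Z33)"
  proof (rule inj_onI)
    fix x y assume x: "x \<in> carrier Z33" and y: "y \<in> carrier Z33" and eq: "\<phi> x = \<phi> y"
    obtain i j i' j' where xy: "x = (i, j)" "y = (i', j')" by (cases x, cases y)
    have rng: "i \<in> {0, 1, 2}" "j \<in> {0, 1, 2}" "i' \<in> {0, 1, 2}" "j' \<in> {0, 1, 2}"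
      using x y unfolding xy Z33_simps by auto
    have e: "a [^] i \<otimes> b [^] j = a [^] i' \<otimes> b [^] j'" using eq by (simp add: \<phi>_def xy)
    have d: "b [^] (j - j') = a [^] (i' - i)"
    proof -
      have "b [^] (j - j') = inv (a [^] i) \<otimes> (a [^] i \<otimes> b [^] j) \<otimes> inv (b [^] j')"
        using ac b(1) by (simp add: int_pow_diff mult_inv_cancel)
      also have "\<dots> = a [^] (i' - i)"
        unfolding e using ac b(1) m_comm[of "inv (a [^] i)" "a [^] i'"] by (simp add: int_pow_diff m_assoc)
      finally show ?thesis .
    qed
    have inY: "b [^] (j - j') \<in> ?Y"
      unfolding d using subgroup_int_pow_closed[OF Y] generate.incl[of a "{a}" G] by simp
    have "j = j'"
    proof (rule ccontr)
      assume "j \<noteq> j'"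
      \<comment> \<open>\<open>j - j'\<close> is prime to 3, so its square is 1 modulo 3, and
        raising the power of \<open>b\<close> once more to \<open>j - j'\<close> returns
        \<open>b\<close>.\<close>
      then have "(3::int) dvd (j - j') * (j - j') - 1" using rng by auto
      then have "b [^] ((j - j') * (j - j')) = b [^] (1::int)"
        using int_pow_eq[OF b(1), of 1 "(j - j') * (j - j')"] ordb by simp
      then have "(b [^] (j - j')) [^] (j - j') = b" using b(1) by (simp add: int_pow_pow)
      moreover have "(b [^] (j - j')) [^] (j - j') \<in> ?Y" using subgroup_int_pow_closed[OF Y inY] .
      ultimately show False using b(2) by simp
    qed
    moreover from this have "a [^] i = a [^] i'" using e ac b(1) by simp
    then have "int 3 dvd i' - i" using int_pow_eq[OF ac] orda by simp
    then have "i = i'" using rng by auto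
    ultimately show "x = y" by (simp add: xy)
  qed
  moreover have "\<phi> ` carrier Z33 = carrier G"
  proof (rule card_subset_eq[OF fin])
    have "card (carrier Z33) = 9" unfolding Z33_simps(1) by (simp add: card_cartesian_product)
    then show "card (\<phi> ` carrier Z33) = card (carrier G)"
      unfolding card_image[OF inj] using ord9 by (simp add: order_def)
  qed (use ac b in \<open>auto simp: \<phi>_def\<close>)
  ultimately have "\<phi> \<in> iso Z33 G" by (simp add: iso_def bij_betw_def)
  then show ?thesis by (auto simp: is_iso_def)
qed

lemma exists_MS0_cyclic_two_rows:
  assumes G: "comm_group G" and fin: "finite (carrier G)" and a: "a \<in> carrier G" "group.ord G a = order G"
    and ord: "order G = 2 * n + 1" "3 \<le> n"
  shows "exists_MS0 G (nonzero G) 2 n n 2 1"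
proof -
  interpret G: comm_group G by (rule G)
  have "exists_MS0 (integer_mod_group (order G)) (nonzero (integer_mod_group (order G))) 2 n n 2 1"
    using exists_MS0_two_rows[of n 1] ord by simp
  then show ?thesis
    by (rule exists_MS0_iso[OF abelian_integer_mod_group G G.cyclic_iso[OF fin a]])
qed

text \<open>Order 5 is separate: it means \<open>n = 2\<close>, where no two-rowed array
  exists.\<close>

lemma weakly_balanced_cyclic:
  assumes G: "comm_group G" and fin: "finite (carrier G)" and a: "a \<in> carrier G" "group.ord G a = order G"
    and ord: "odd (order G)" "order G \<noteq> 1" "order G \<noteq> 3"
  shows "weakly_balanced G"
proof (cases "order G = 5")
  case True
  interpret G: comm_group G by (rule G)
  have "integer_mod_group 5 \<cong> G" using G.cyclic_iso[OF fin a] True by simp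
  moreover have "finite (carrier (integer_mod_group 5))" by (simp add: carrier_integer_mod_group)
  ultimately show ?thesis
    using weakly_balanced_iso[OF abelian_integer_mod_group G] weakly_balanced_5 by blast
next
  case False
  then have "order G = 2 * (order G div 2) + 1" "3 \<le> order G div 2" using ord by presburger+
  from exists_MS0_cyclic_two_rows[OF G fin a this] show ?thesis
    by (rule weakly_balanced_if_exists_MS0[OF G])
qed

text \<open>For noncyclic \<open>G\<close>, the quotient is taken by a largest nontrivial subgroup
  of index different from 1 and 3. If there is none, all nontrivial cyclic subgroups have index 3
  and \<open>G\<close> is the excluded group of order 9.\<close>

lemma exists_MS0_two_rows_group:
  assumes G: "comm_group G" and fin: "finite (carrier G)" and ord: "order G = 2 * n + 1" "3 \<le> n"
    and Z33: "\<not> G \<cong> Z33"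
  shows "exists_MS0 G (nonzero G) 2 n n 2 1"
proof (cases "\<exists>a\<in>carrier G. group.ord G a = order G")
  case True
  then show ?thesis using exists_MS0_cyclic_two_rows[OF G fin _ _ ord] by blast
next
  case noncyclic: False
  interpret G: comm_group G by (rule G)
  have odd: "odd (order G)" using ord by simp
  define P where "P K \<longleftrightarrow> subgroup K G \<and> K \<noteq> {\<one>\<^bsub>G\<^esub>} \<and> order G \<noteq> card K \<and> order G \<noteq> 3 * card K" for K
  have "\<exists>K. P K"
  proof (rule ccontr)
    assume none: "\<nexists>K. P K"
    have "order G = 3 * G.ord a" if a: "a \<in> carrier G" "a \<noteq> \<one>\<^bsub>G\<^esub>" for a
    proof -
      have "subgroup (generate G {a}) G" using a by (intro G.generate_is_subgroup) simp
      moreover have "generate G {a} \<noteq> {\<one>\<^bsub>G\<^esub>}" using a(2) generate.incl[of a "{a}" G] by auto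
      moreover have "order G \<noteq> card (generate G {a})" using noncyclic a(1) G.generate_pow_card[OF a(1)] by auto
      ultimately have "order G = 3 * card (generate G {a})" using none unfolding P_def by blast
      then show ?thesis using G.generate_pow_card[OF a(1)] by simp
    qed
    then have "Z33 \<cong> G" using ord by (intro G.elementary_9_iso[OF fin]) auto
    then have "G \<cong> Z33" by (rule group.iso_sym[OF comm_group.axioms(2)[OF comm_group_Z33]])
    then show False using Z33 by simp
  qed
  then obtain K0 where "P K0" by blast
  moreover have "\<forall>K. P K \<longrightarrow> card K < order G + 1"
    using fin by (auto simp: P_def order_def less_Suc_eq_le intro!: card_mono dest: subgroup.subset)
  ultimately obtain K where K: "P K" "\<And>K'. P K' \<Longrightarrow> card K' \<le> card K"
    using ex_has_greatest_nat[of P K0 card "order G + 1"] by auto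
  have KG: "subgroup K G" using K(1) by (simp add: P_def)
  have KN: "K \<lhd> G" using G.subgroup_imp_normal[OF KG] .
  define H where "H = G Mod K"
  define f where "f = (\<lambda>x. K #>\<^bsub>G\<^esub> x)"
  have H: "comm_group H" unfolding H_def by (rule G.abelian_FactGroup[OF KG])
  interpret H: comm_group H by (rule H)
  have f: "f \<in> hom G H" unfolding f_def H_def by (rule normal.r_coset_hom_Mod[OF KN])
  interpret f: group_hom G H f using f by unfold_locales
  have surj: "f ` carrier G = carrier H" by (simp add: f_def H_def carrier_FactGroup)
  have finH: "finite (carrier H)" using fin surj by (metis finite_imageI)
  have ker: "f x = \<one>\<^bsub>H\<^esub> \<longleftrightarrow> x \<in> K" if "x \<in> carrier G" for x
    using that G.coset_join1[OF _ that KG] G.coset_join2[OF that KG]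
    by (auto simp: f_def H_def)
  have ordH: "order G = order H * card K"
    using G.lagrange[OF KG] by (simp add: H_def order_def FactGroup_def)
  have finK: "finite K" using fin subgroup.subset[OF KG] finite_subset by blast
  have K0: "0 < card K" using finK subgroup.one_closed[OF KG] card_gt_0_iff by blast
  have fibre: "card {x \<in> carrier G. f x = y} = card K" if y: "y \<in> carrier H" for y
  proof -
    have "y \<in> f ` carrier G" unfolding surj by (rule y)
    then obtain x0 where x0: "x0 \<in> carrier G" "f x0 = y" by blast
    have Kc: "k \<in> carrier G" if "k \<in> K" for k using that subgroup.subset[OF KG] by blast
    have "bij_betw (\<lambda>k. x0 \<otimes>\<^bsub>G\<^esub> k) K {x \<in> carrier G. f x = y}"
    proof (rule bij_betw_byWitness[where f' = "\<lambda>x. inv\<^bsub>G\<^esub> x0 \<otimes>\<^bsub>G\<^esub> x"])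
      show "(\<lambda>k. x0 \<otimes>\<^bsub>G\<^esub> k) ` K \<subseteq> {x \<in> carrier G. f x = y}"
      proof
        fix x assume "x \<in> (\<lambda>k. x0 \<otimes>\<^bsub>G\<^esub> k) ` K"
        then obtain k where k: "k \<in> K" "x = x0 \<otimes>\<^bsub>G\<^esub> k" by blast
        have "f k = \<one>\<^bsub>H\<^esub>" using ker[OF Kc[OF k(1)]] k(1) by simp
        then show "x \<in> {x \<in> carrier G. f x = y}" using k x0 y Kc[OF k(1)] by simp
      qed
      show "(\<lambda>x. inv\<^bsub>G\<^esub> x0 \<otimes>\<^bsub>G\<^esub> x) ` {x \<in> carrier G. f x = y} \<subseteq> K"
      proof clarify
        fix x assume x: "x \<in> carrier G" "y = f x"
        have "f (inv\<^bsub>G\<^esub> x0 \<otimes>\<^bsub>G\<^esub> x) = \<one>\<^bsub>H\<^esub>" using x x0 by simp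
        then show "inv\<^bsub>G\<^esub> x0 \<otimes>\<^bsub>G\<^esub> x \<in> K"
          using ker[of "inv\<^bsub>G\<^esub> x0 \<otimes>\<^bsub>G\<^esub> x"] x(1) x0(1) by blast
      qed
    qed (use x0 Kc in \<open>auto simp: G.mult_inv_cancel\<close>)
    then show ?thesis by (simp add: bij_betw_same_card)
  qed
  have oddH: "odd (order H)" using odd ordH by simp
  have H13: "order H \<noteq> 1" "order H \<noteq> 3" using K(1) ordH by (auto simp: P_def)
  have "weakly_balanced H"
  proof (cases "\<exists>a\<in>carrier H. H.ord a = order H")
    case True
    then show ?thesis using weakly_balanced_cyclic[OF H finH _ _ oddH H13] by blast
  next
    case nc: False
    have "order H = 3 * H.ord a" if a: "a \<in> carrier H" "a \<noteq> \<one>\<^bsub>H\<^esub>" for a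
    proof -
      let ?Y = "generate H {a}"
      have Y: "subgroup ?Y H" using a by (intro H.generate_is_subgroup) simp
      have Yc: "?Y \<subseteq> carrier H" using subgroup.subset[OF Y] .
      have cY: "card ?Y = H.ord a" using H.generate_pow_card[OF a(1)] by simp
      \<comment> \<open>The preimage of a nontrivial cyclic subgroup of \<open>H\<close> is larger
        than \<open>K\<close>, so by maximality its index is 1 or 3; index 1 would make
        \<open>H\<close> cyclic.\<close>
      define K' where "K' = {x \<in> carrier G. f x \<in> ?Y}"
      have K'G: "subgroup K' G"
        by (rule G.subgroupI)
          (use subgroup.one_closed[OF Y] subgroup.m_inv_closed[OF Y] subgroup.m_closed[OF Y] in \<open>auto simp: K'_def\<close>)
      have "card K' = card ?Y * card K"
      proof (rule card_fibres_const[where g = f])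
        show "finite K'" using fin by (simp add: K'_def)
        show "finite ?Y" using Yc finH finite_subset by blast
        show "f ` K' \<subseteq> ?Y" by (auto simp: K'_def)
        show "card {x \<in> K'. f x = y} = card K" if y: "y \<in> ?Y" for y
        proof -
          have "{x \<in> K'. f x = y} = {x \<in> carrier G. f x = y}" using y by (auto simp: K'_def)
          then show ?thesis using fibre y Yc by auto
        qed
      qed
      then have cK': "card K' = H.ord a * card K" using cY by simp
      have "H.ord a \<noteq> 1" using H.ord_eq_1[OF a(1)] a(2) by simp
      moreover have "0 < H.ord a" using H.ord_ge_1[OF finH a(1)] by simp
      ultimately have "1 < H.ord a" by simp
      then have gt: "card K < card K'" using cK' K0 by simp
      then have "\<not> P K'" using K(2) by fastforce
      moreover have "K' \<noteq> {\<one>\<^bsub>G\<^esub>}" using gt K0 by auto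
      ultimately have "order G = card K' \<or> order G = 3 * card K'" using K'G by (auto simp: P_def)
      then have "order H = H.ord a \<or> order H = 3 * H.ord a" using cK' ordH K0 by auto
      then show ?thesis using nc a(1) by auto
    qed
    then have "Z33 \<cong> H" using H13 by (intro H.elementary_9_iso[OF finH]) auto
    moreover have "finite (carrier Z33)" unfolding Z33_simps(1) by simp
    ultimately show ?thesis using weakly_balanced_iso[OF comm_group_Z33 H] weakly_balanced_Z33 by blast
  qed
  moreover have "\<exists>x\<in>carrier G. x \<noteq> \<one>\<^bsub>G\<^esub> \<and> f x = \<one>\<^bsub>H\<^esub>"
  proof -
    have "K \<noteq> {\<one>\<^bsub>G\<^esub>}" using K(1) by (simp add: P_def)
    then obtain x where "x \<in> K" "x \<noteq> \<one>\<^bsub>G\<^esub>" using subgroup.one_closed[OF KG] by blast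
    then show ?thesis using ker subgroup.subset[OF KG] by blast
  qed
  ultimately obtain R where "half_system G R" "finprod G (\<lambda>x. x) R = \<one>\<^bsub>G\<^esub>"
    using half_system_lift[OF G H fin odd f surj] by blast
  then show ?thesis using exists_MS0_if_half_system[OF G] ord by simp
qed

section \<open>Sums in cyclic groups and the theorem\<close>

lemma finprod_integer_mod_group:
  assumes "0 < N" "finite A" "A \<subseteq> carrier (integer_mod_group N)"
  shows "finprod (integer_mod_group N) (\<lambda>x. x) A = \<Sum>A mod int N"
proof -
  interpret G: comm_group "integer_mod_group N" by (rule abelian_integer_mod_group)
  have "finprod (integer_mod_group N) (\<lambda>x. x) A = finprod (integer_mod_group N) (\<lambda>x. x mod int N) A"
    by (rule G.finprod_cong') (use assms in \<open>auto simp: carrier_integer_mod_group subset_iff\<close>)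
  also have "\<dots> = \<Sum>A mod int N"
    by (rule G.finprod_hom_sum) (use assms in \<open>auto simp: carrier_integer_mod_group mod_simps\<close>)
  finally show ?thesis .
qed

text \<open>The sum \<open>N * (N - 1) / 2\<close> is \<open>N / 2\<close> modulo an even
  \<open>N\<close>: the elements of the group add up to its unique involution.\<close>

lemma even_cyclic_sum_nonzero:
  assumes "0 < N" "even N"
  shows "\<Sum>{0..<int N} mod int N \<noteq> 0"
proof
  assume "\<Sum>{0..<int N} mod int N = 0"
  then have dvd: "int N dvd \<Sum>{0..<int N}" by (simp add: dvd_eq_mod_eq_0)
  have "2 * (\<Sum>i<N. int i) = int N * (int N - 1)" by (induction N) (simp_all add: algebra_simps)
  moreover have "\<Sum>{0..<int N} = (\<Sum>i<N. int i)"
    by (rule sum.reindex_bij_witness[of _ int nat]) auto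
  ultimately have sum: "2 * \<Sum>{0..<int N} = int N * (int N - 1)" by simp
  obtain M where M: "N = 2 * M" using assms(2) by (auto elim: evenE)
  have "2 * int N dvd 2 * \<Sum>{0..<int N}" using dvd by (rule mult_dvd_mono[OF dvd_refl])
  then have "2 * int N dvd int N * (int N - 1)" unfolding sum .
  then have "int N * 2 dvd int N * (int N - 1)" by (simp add: mult.commute)
  then have "2 dvd int N - 1" using assms(1) by simp
  then show False using M by presburger
qed

text \<open>\<open>m / 2\<close> two-rowed arrays are stacked, which is inflation into a grid with a
  single column.\<close>

lemma exists_MS0_cyclic_rectangle_nonzero:
  assumes "even m" "0 < m" "3 \<le> n"
  shows "exists_MS0 (integer_mod_group (m * n + 1)) (nonzero (integer_mod_group (m * n + 1))) m n n m 1"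
proof -
  obtain g where g: "m = 2 * g" using assms(1) by (auto elim: evenE)
  have "exists_MS0 (integer_mod_group (2 * n * g + 1)) (nonzero (integer_mod_group (2 * n * g + 1))) 2 n n 2 (1 * (g * 1))"
    using exists_MS0_two_rows[of n g] assms g by simp
  then have "exists_MS0 (integer_mod_group (2 * n * g + 1)) (nonzero (integer_mod_group (2 * n * g + 1)))
      (g * 2) (1 * n) (1 * n) (g * 2) 1"
    by (rule exists_MS0_inflate[OF abelian_integer_mod_group]) simp_all
  moreover have "2 * n * g + 1 = m * n + 1" "g * 2 = m" using g by simp_all
  ultimately show ?thesis by (simp only: mult_1)
qed

lemma iso_same_order: "G \<cong> H \<Longrightarrow> order G = order H"
  by (auto simp: is_iso_def iso_def order_def dest: bij_betw_same_card)

theorem mainTheorem2: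
  fixes m n s k c :: nat
  assumes "0 < m" "0 < n" "0 < s" "0 < k" "0 < c"
    and "2 \<le> s" "s \<le> n" "2 \<le> k" "k \<le> m" "m * s = n * k"
  defines "d \<equiv> gcd s k"
  shows
    "(exists_MS0 (integer_mod_group (n*k*c)) (carrier (integer_mod_group (n*k*c))) m n s k c
        \<longleftrightarrow> odd (n*k*c))
   \<and> (d mod 4 = 0 \<longrightarrow>
        (\<forall>(\<Gamma> :: ('g, 'h) monoid_scheme). in_class_G \<Gamma> \<and> order \<Gamma> = n*k*c \<longrightarrow>
           exists_MS0 \<Gamma> (carrier \<Gamma>) m n s k c))
   \<and> (odd (n*k) \<and> gcd n (d - 1) = 1 \<longrightarrow>
        exists_M0 (DirProd (integer_mod_group d) (integer_mod_group (n*k div d)))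
          (carrier (DirProd (integer_mod_group d) (integer_mod_group (n*k div d)))) m n s k)
   \<and> (exists_MS0 (integer_mod_group (2*n*c+1)) (nonzero (integer_mod_group (2*n*c+1))) 2 n n 2 c
        \<longleftrightarrow> 3 \<le> n)
   \<and> (exists_M0 (integer_mod_group (m*n+1)) (nonzero (integer_mod_group (m*n+1))) m n n m
        \<longleftrightarrow> even (m*n) \<and> 5 < m*n)
   \<and> (\<forall>(\<Gamma> :: ('p, 'q) monoid_scheme). comm_group \<Gamma> \<and> finite (carrier \<Gamma>) \<and> order \<Gamma> = 2*n+1 \<longrightarrow>
        (exists_M0 \<Gamma> (nonzero \<Gamma>) 2 n n 2
          \<longleftrightarrow> \<not> (\<Gamma> \<cong> integer_mod_group 5)
              \<and> \<not> (\<Gamma> \<cong> DirProd (integer_mod_group 3) (integer_mod_group 3))))"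
proof (intro conjI)
  have n2: "2 \<le> n" and m2: "2 \<le> m" using assms by linarith+
  have pos: "0 < n * k * c" using assms by simp
  show "exists_MS0 (integer_mod_group (n*k*c)) (carrier (integer_mod_group (n*k*c))) m n s k c \<longleftrightarrow> odd (n*k*c)"
  proof
    assume "exists_MS0 (integer_mod_group (n*k*c)) (carrier (integer_mod_group (n*k*c))) m n s k c"
    from finprod_eq_one_if_exists_MS0[OF abelian_integer_mod_group this]
    have "finprod (integer_mod_group (n*k*c)) (\<lambda>x. x) {0..<int (n*k*c)} = 0"
      using pos by (simp add: carrier_integer_mod_group)
    moreover have "finprod (integer_mod_group (n*k*c)) (\<lambda>x. x) {0..<int (n*k*c)} = \<Sum>{0..<int (n*k*c)} mod int (n*k*c)"
      by (rule finprod_integer_mod_group[OF pos]) (use pos in \<open>auto simp: carrier_integer_mod_group\<close>)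
    ultimately show "odd (n*k*c)" using even_cyclic_sum_nonzero[OF pos] by metis
  next
    assume "odd (n*k*c)"
    then show "exists_MS0 (integer_mod_group (n*k*c)) (carrier (integer_mod_group (n*k*c))) m n s k c"
      using assms by (intro exists_MS0_cyclic_odd)
  qed
  show "d mod 4 = 0 \<longrightarrow> (\<forall>(\<Gamma> :: ('g, 'h) monoid_scheme). in_class_G \<Gamma> \<and> order \<Gamma> = n*k*c \<longrightarrow>
           exists_MS0 \<Gamma> (carrier \<Gamma>) m n s k c)"
  proof (intro impI allI)
    fix \<Gamma> :: "('g, 'h) monoid_scheme"
    assume "d mod 4 = 0" "in_class_G \<Gamma> \<and> order \<Gamma> = n*k*c"
    then show "exists_MS0 \<Gamma> (carrier \<Gamma>) m n s k c"
      using assms by (intro exists_MS0_class_G) (simp_all add: d_def)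
  qed
  show "odd (n*k) \<and> gcd n (d - 1) = 1 \<longrightarrow>
        exists_M0 (DirProd (integer_mod_group d) (integer_mod_group (n*k div d)))
          (carrier (DirProd (integer_mod_group d) (integer_mod_group (n*k div d)))) m n s k"
    unfolding d_def using assms(6-10) by (intro impI exists_M0_two_cyclic) simp_all
  show "exists_MS0 (integer_mod_group (2*n*c+1)) (nonzero (integer_mod_group (2*n*c+1))) 2 n n 2 c \<longleftrightarrow> 3 \<le> n"
  proof
    assume E: "exists_MS0 (integer_mod_group (2*n*c+1)) (nonzero (integer_mod_group (2*n*c+1))) 2 n n 2 c"
    have "n \<noteq> 2" using E not_exists_MS0_2x2[OF abelian_integer_mod_group assms(5)] by blast
    then show "3 \<le> n" using n2 by simp
  qed (rule exists_MS0_two_rows[OF _ assms(5)])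
  show "exists_M0 (integer_mod_group (m*n+1)) (nonzero (integer_mod_group (m*n+1))) m n n m
        \<longleftrightarrow> even (m*n) \<and> 5 < m*n"
    unfolding exists_M0_iff_exists_MS0
  proof
    assume E: "exists_MS0 (integer_mod_group (m*n+1)) (nonzero (integer_mod_group (m*n+1))) m n n m 1"
    have "even (m * n)"
    proof (rule ccontr)
      assume "odd (m * n)"
      then have N: "0 < m * n + 1" "even (m * n + 1)" by simp_all
      have nz: "nonzero (integer_mod_group (m * n + 1)) = {1..<int (m * n + 1)}"
        by (rule nonzero_integer_mod_group[OF N(1)])
      have "\<Sum>{1..<int (m * n + 1)} mod int (m * n + 1) = finprod (integer_mod_group (m * n + 1)) (\<lambda>x. x) {1..<int (m * n + 1)}"
        by (rule finprod_integer_mod_group[symmetric, OF N(1)]) (auto simp: carrier_integer_mod_group)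
      also have "\<dots> = 0"
        using finprod_eq_one_if_exists_MS0[OF abelian_integer_mod_group E] unfolding nz by simp
      finally have "\<Sum>{1..<int (m * n + 1)} mod int (m * n + 1) = 0" .
      moreover have "{0..<int (m * n + 1)} = insert 0 {1..<int (m * n + 1)}"
        using N(1) by (auto simp del: of_nat_mult of_nat_add)
      then have "\<Sum>{0..<int (m * n + 1)} = \<Sum>{1..<int (m * n + 1)}" by simp
      ultimately show False using even_cyclic_sum_nonzero[OF N] by simp
    qed
    moreover have "5 < m * n"
    proof (rule ccontr)
      \<comment> \<open>With both sides at least 2, a product of at most 5 leaves only the 2 x 2
        array.\<close>
      assume "\<not> 5 < m * n"
      moreover have "\<not> (m = 2 \<and> n = 2)" using E not_exists_MS0_2x2[OF abelian_integer_mod_group, of 1] by auto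
      moreover have "6 \<le> m * n" if "3 \<le> m" using mult_le_mono[OF that n2] by simp
      moreover have "6 \<le> m * n" if "3 \<le> n" using mult_le_mono[OF m2 that] by simp
      ultimately show False using m2 n2 by linarith
    qed
    ultimately show "even (m * n) \<and> 5 < m * n" by blast
  next
    assume e: "even (m * n) \<and> 5 < m * n"
    show "exists_MS0 (integer_mod_group (m*n+1)) (nonzero (integer_mod_group (m*n+1))) m n n m 1"
    proof (cases "even m \<and> 3 \<le> n")
      case True
      then show ?thesis using m2 by (intro exists_MS0_cyclic_rectangle_nonzero) auto
    next
      case False
      \<comment> \<open>The other case has \<open>m\<close> odd or \<open>n = 2\<close>; in both,
        \<open>n\<close> is even and \<open>m \<ge> 3\<close>, so the transposed array can be
        built.\<close>
      have "even n \<and> 3 \<le> m"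
      proof (cases "even m")
        case True
        then have "n = 2" using False n2 by simp
        then show ?thesis using e by simp
      next
        case False
        moreover from this have "m \<noteq> 2" by auto
        ultimately show ?thesis using e m2 by simp
      qed
      then have "exists_MS0 (integer_mod_group (n*m+1)) (nonzero (integer_mod_group (n*m+1))) n m m n 1"
        using n2 by (intro exists_MS0_cyclic_rectangle_nonzero) auto
      from exists_MS0_transpose[OF abelian_integer_mod_group this] show ?thesis by (simp add: mult.commute)
    qed
  qed
  show "\<forall>(\<Gamma> :: ('p, 'q) monoid_scheme). comm_group \<Gamma> \<and> finite (carrier \<Gamma>) \<and> order \<Gamma> = 2*n+1 \<longrightarrow>
        (exists_M0 \<Gamma> (nonzero \<Gamma>) 2 n n 2
          \<longleftrightarrow> \<not> (\<Gamma> \<cong> integer_mod_group 5)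
              \<and> \<not> (\<Gamma> \<cong> DirProd (integer_mod_group 3) (integer_mod_group 3)))"
    unfolding exists_M0_iff_exists_MS0
  proof (intro allI impI)
    fix \<Gamma> :: "('p, 'q) monoid_scheme"
    assume "comm_group \<Gamma> \<and> finite (carrier \<Gamma>) \<and> order \<Gamma> = 2*n+1"
    then have \<Gamma>: "comm_group \<Gamma>" "finite (carrier \<Gamma>)" "order \<Gamma> = 2*n+1" by auto
    interpret \<Gamma>: comm_group \<Gamma> by (rule \<Gamma>(1))
    show "exists_MS0 \<Gamma> (nonzero \<Gamma>) 2 n n 2 1 \<longleftrightarrow> \<not> \<Gamma> \<cong> integer_mod_group 5 \<and> \<not> \<Gamma> \<cong> Z33"
    proof
      assume E: "exists_MS0 \<Gamma> (nonzero \<Gamma>) 2 n n 2 1"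
      have "\<not> \<Gamma> \<cong> integer_mod_group 5"
      proof
        assume "\<Gamma> \<cong> integer_mod_group 5"
        then have "n = 2" using iso_same_order[of \<Gamma>] \<Gamma>(3) order_integer_mod_group[of 5] by fastforce
        then show False using E not_exists_MS0_2x2[OF \<Gamma>(1), of 1] by simp
      qed
      moreover have "\<not> \<Gamma> \<cong> Z33"
      proof
        assume iso: "\<Gamma> \<cong> Z33"
        have "order Z33 = 9" unfolding order_def Z33_simps(1) by (simp add: card_cartesian_product)
        then have "n = 4" using iso_same_order[OF iso] \<Gamma>(3) by simp
        then show False using exists_MS0_iso[OF \<Gamma>(1) comm_group_Z33 iso E] not_exists_MS0_Z33 by simp
      qed
      ultimately show "\<not> \<Gamma> \<cong> integer_mod_group 5 \<and> \<not> \<Gamma> \<cong> Z33" by blast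
    next
      assume niso: "\<not> \<Gamma> \<cong> integer_mod_group 5 \<and> \<not> \<Gamma> \<cong> Z33"
      have "n \<noteq> 2"
      proof
        assume "n = 2"
        then have ord5: "order \<Gamma> = 5" using \<Gamma>(3) by simp
        then have "carrier \<Gamma> \<noteq> {\<one>\<^bsub>\<Gamma>\<^esub>}" by (auto simp: order_def)
        then obtain a where a: "a \<in> carrier \<Gamma>" "a \<noteq> \<one>\<^bsub>\<Gamma>\<^esub>" using \<Gamma>.one_closed by blast
        have dvd: "\<Gamma>.ord a dvd 5" using \<Gamma>.ord_dvd_group_order[OF a(1)] ord5 by simp
        have "\<Gamma>.ord a \<noteq> 1" using \<Gamma>.ord_eq_1[OF a(1)] a(2) by simp
        moreover have "\<Gamma>.ord a \<le> 5" using dvd by (simp add: dvd_imp_le)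
        then have "\<Gamma>.ord a = 0 \<or> \<Gamma>.ord a = 1 \<or> \<Gamma>.ord a = 2 \<or> \<Gamma>.ord a = 3 \<or> \<Gamma>.ord a = 4 \<or> \<Gamma>.ord a = 5" by linarith
        ultimately have "\<Gamma>.ord a = order \<Gamma>" using dvd ord5 by (elim disjE) simp_all
        from \<Gamma>.cyclic_iso[OF \<Gamma>(2) a(1) this] have "integer_mod_group 5 \<cong> \<Gamma>" using ord5 by simp
        then have "\<Gamma> \<cong> integer_mod_group 5" by (rule group.iso_sym[OF group_integer_mod_group])
        then show False using niso by blast
      qed
      then show "exists_MS0 \<Gamma> (nonzero \<Gamma>) 2 n n 2 1"
        using exists_MS0_two_rows_group[OF \<Gamma>] n2 niso by simp
    qed
  qed
qed


end
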